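(* Let $n,k\ge 1$, $r\ge 0$, and let $W\subseteq J^{r}(S^n,\mathbb{R}^k)$ be a nonempty intrinsic semialgebraic subset with $0<\mathrm{codim}(W)\le n$. Then there exist $d(W)\in\mathbb{N}$ and $c_2(W)>0$ such that for every $d\ge d(W)$ there is a nonempty open set $U_d^W$ in the space $\mathbb{R}[x_0,\ldots,x_n]_{(d)}^k$ of polynomial maps of degree $d$ with the property that for every $p=(p_1,\ldots,p_k)\in U_d^W$, $$b\big(\Sigma^W(p)\big)\ \ge\ c_2(W)\,d^n .$$
   Context: $S^n\subset\mathbb{R}^{n+1}$ is the unit sphere. A polynomial map of degree $d$ is $p=(p_1,\ldots,p_k):S^n\to\mathbb{R}^k$, where each $p_i\in\mathbb{R}[x_0,\ldots,x_n]_{(d)}$ is a homogeneous polynomial of degree $d$ restricted to $S^n$. $J^r(S^n,\mathbb{R}^k)$ denotes the bundle of $r$-jets of maps $S^n\to\mathbb{R}^k$, $J^r(n,k)$ the bundle of $r$-jets of maps $\mathbb{R}^n\to\mathbb{R}^k$, and $j^rp:S^n\to J^r(S^n,\mathbb{R}^k)$ the $r$-th jet extension of $p$. A subset $W\subseteq J^r(S^n,\mathbb{R}^k)$ is called intrinsic if there is $W_0\subseteq J^r(n,k)$ such that for every embedding $\varphi:\mathbb{R}^n\hookrightarrow S^n$ one has $(j^r\varphi)^*(W)=W_0$ (i.e. $W$ is invariant under diffeomorphisms of $S^n$). The $W$-type singularity of $p$ is $\Sigma^W(p):=(j^rp)^{-1}(W)\subseteq S^n$, and $b(\cdot)$ denotes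 the sum of the Betti numbers. *)

theory Defs
  imports "HOL-Analysis.Analysis" "HOL-Homology.Homology"
begin

definition partial_at :: "'n::finite \<Rightarrow> (real^'n \<Rightarrow> real) \<Rightarrow> real^'n \<Rightarrow> real" where
  "partial_at i f y = deriv (\<lambda>t::real. f (y + t *\<^sub>R axis i 1)) 0"

primrec pderivs :: "'n::finite list \<Rightarrow> (real^'n \<Rightarrow> real) \<Rightarrow> real^'n \<Rightarrow> real" where
  "pderivs [] f = f"
| "pderivs (i # is) f = partial_at i (pderivs is f)"

definition smooth_map :: "(real^'a::finite \<Rightarrow> real^'b::finite) \<Rightarrow> bool" where
  "smooth_map f \<longleftrightarrow> (\<forall>is j. pderivs is (\<lambda>z. f z $ j) differentiable_on UNIV)"

definition idx_list :: "'n::finite list" where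
  "idx_list = (SOME xs. distinct xs \<and> set xs = UNIV)"

definition mpartial :: "('n::finite \<Rightarrow> nat) \<Rightarrow> (real^'n \<Rightarrow> real) \<Rightarrow> real^'n \<Rightarrow> real" where
  "mpartial \<beta> f = pderivs (concat (map (\<lambda>i. replicate (\<beta> i) i) idx_list)) f"

definition sphere_set :: "(real^'m::finite) set" where
  "sphere_set = {x. norm x = 1}"

definition embedding_into_sphere :: "(real^'n::finite \<Rightarrow> real^'m::finite) \<Rightarrow> bool" where
  "embedding_into_sphere \<phi> \<longleftrightarrow>
     smooth_map \<phi> \<and> range \<phi> \<subseteq> sphere_set \<and>
     (\<forall>y. \<exists>D. (\<phi> has_derivative D) (at y) \<and> inj D) \<and>
     (\<exists>\<psi>. homeomorphism UNIV (range \<phi>) \<phi> \<psi>)"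

text \<open>Coordinates of J^r(n,k): the base point (Inl i) and the partial derivatives
  of order at most r of the components (Inr (beta, j)).\<close>
type_synonym ('n,'k) jet = "'n + ('n \<Rightarrow> nat) \<times> 'k \<Rightarrow> real"

definition jet_vars :: "nat \<Rightarrow> ('n::finite + ('n \<Rightarrow> nat) \<times> 'k::finite) set" where
  "jet_vars r = range Inl \<union> {Inr (\<beta>, j) | \<beta> j. sum \<beta> UNIV \<le> r}"

definition jet :: "nat \<Rightarrow> (real^'n::finite \<Rightarrow> real^'k::finite) \<Rightarrow> real^'n \<Rightarrow> ('n,'k) jet" where
  "jet r g y = (\<lambda>v. case v of Inl i \<Rightarrow> y $ i
                   | Inr (\<beta>, j) \<Rightarrow> if sum \<beta> UNIV \<le> r then mpartial \<beta> (\<lambda>z. g z $ j) y else 0)"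

definition coord_space :: "'v set \<Rightarrow> ('v \<Rightarrow> real) set" where
  "coord_space V = {x. \<forall>v. v \<notin> V \<longrightarrow> x v = 0}"

definition mpoly_eval :: "'v set \<Rightarrow> (real \<times> ('v \<Rightarrow> nat)) list \<Rightarrow> ('v \<Rightarrow> real) \<Rightarrow> real" where
  "mpoly_eval V ps x = sum_list (map (\<lambda>(a, \<alpha>). a * (\<Prod>v\<in>V. x v ^ \<alpha> v)) ps)"

inductive semialgebraic :: "'v set \<Rightarrow> ('v \<Rightarrow> real) set \<Rightarrow> bool" for V where
  pos: "semialgebraic V {x \<in> coord_space V. 0 < mpoly_eval V P x}"
| zero: "semialgebraic V {x \<in> coord_space V. mpoly_eval V P x = 0}"
| union: "semialgebraic V A \<Longrightarrow> semialgebraic V B \<Longrightarrow> semialgebraic V (A \<union> B)"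
| compl: "semialgebraic V A \<Longrightarrow> semialgebraic V (coord_space V - A)"

definition proj_has_interior :: "'v set \<Rightarrow> ('v \<Rightarrow> real) set \<Rightarrow> bool" where
  "proj_has_interior I S \<longleftrightarrow> (\<exists>x\<in>S. \<exists>e>0. \<forall>y. (\<forall>i\<in>I. \<bar>y i - x i\<bar> < e) \<longrightarrow>
                                  (\<exists>z\<in>S. \<forall>i\<in>I. z i = y i))"

definition sa_dim :: "'v set \<Rightarrow> ('v \<Rightarrow> real) set \<Rightarrow> nat" where
  "sa_dim V S = Max {card I | I. I \<subseteq> V \<and> proj_has_interior I S}"

definition jet_codim :: "nat \<Rightarrow> ('n::finite,'k::finite) jet set \<Rightarrow> int" where
  "jet_codim r W0 = int (card (jet_vars r :: ('n + ('n \<Rightarrow> nat) \<times> 'k) set)) - int (sa_dim (jet_vars r) W0)"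

text \<open>W0 is the common pullback (j^r phi)^* W of a subset W of J^r(S^n,R^k) under all
  embeddings phi: R^n -> S^n.  Equivalently: membership of j^r_y(f o phi) in W0 depends only
  on the point phi y of the sphere and on f, not on the embedding.\<close>
definition intrinsic :: "nat \<Rightarrow> ('n::finite,'k::finite) jet set \<Rightarrow> ('m::finite itself) \<Rightarrow> bool" where
  "intrinsic r W0 _ \<longleftrightarrow>
     W0 \<subseteq> coord_space (jet_vars r) \<and>
     (\<forall>(\<phi>::real^'n \<Rightarrow> real^'m) \<psi> y z (f::real^'m \<Rightarrow> real^'k).
        embedding_into_sphere \<phi> \<longrightarrow> embedding_into_sphere \<psi> \<longrightarrow> \<phi> y = \<psi> z \<longrightarrow> smooth_map f \<longrightarrow>
        (jet r (f \<circ> \<phi>) y \<in> W0 \<longleftrightarrow> jet r (f \<circ> \<psi>) z \<in> W0))"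

definition Sigma_W :: "nat \<Rightarrow> ('n::finite,'k::finite) jet set \<Rightarrow> (real^'m::finite \<Rightarrow> real^'k) \<Rightarrow> (real^'m) set" where
  "Sigma_W r W0 p = {x \<in> sphere_set. \<exists>(\<phi>::real^'n \<Rightarrow> real^'m) y.
       embedding_into_sphere \<phi> \<and> \<phi> y = x \<and> jet r (p \<circ> \<phi>) y \<in> W0}"

definition monomials :: "nat \<Rightarrow> ('m::finite \<Rightarrow> nat) set" where
  "monomials d = {\<alpha>. sum \<alpha> UNIV = d}"

definition coeff_space :: "nat \<Rightarrow> ('k \<Rightarrow> ('m::finite \<Rightarrow> nat) \<Rightarrow> real) set" where
  "coeff_space d = {c. \<forall>j \<alpha>. \<alpha> \<notin> monomials d \<longrightarrow> c j \<alpha> = 0}"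

definition poly_map :: "nat \<Rightarrow> ('k::finite \<Rightarrow> ('m::finite \<Rightarrow> nat) \<Rightarrow> real) \<Rightarrow> real^'m \<Rightarrow> real^'k" where
  "poly_map d c x = (\<chi> j. \<Sum>\<alpha>\<in>monomials d. c j \<alpha> * (\<Prod>i\<in>UNIV. (x $ i) ^ \<alpha> i))"

definition open_in_coeff_space :: "nat \<Rightarrow> ('k::finite \<Rightarrow> ('m::finite \<Rightarrow> nat) \<Rightarrow> real) set \<Rightarrow> bool" where
  "open_in_coeff_space d U \<longleftrightarrow> U \<subseteq> coeff_space d \<and>
     (\<forall>c\<in>U. \<exists>e>0. \<forall>c'\<in>coeff_space d.
        (\<forall>j. \<forall>\<alpha>\<in>monomials d. \<bar>c' j \<alpha> - c j \<alpha>\<bar> < e) \<longrightarrow> c' \<in> U)"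

definition Z_independent :: "('a, 'b) monoid_scheme \<Rightarrow> 'a set \<Rightarrow> bool" where
  "Z_independent G A \<longleftrightarrow> finite A \<and> A \<subseteq> carrier G \<and>
     (\<forall>c::'a \<Rightarrow> int. finprod G (\<lambda>a. a [^]\<^bsub>G\<^esub> c a) A = \<one>\<^bsub>G\<^esub> \<longrightarrow> (\<forall>a\<in>A. c a = 0))"

definition group_rank :: "('a, 'b) monoid_scheme \<Rightarrow> ennreal" where
  "group_rank G = (SUP A \<in> {A. Z_independent G A}. of_nat (card A))"

definition betti_sum :: "'a::topological_space set \<Rightarrow> ennreal" where
  "betti_sum S = suminf (\<lambda>p::nat. group_rank (homology_group (int p) (top_of_set S)))"

end

theory Submission
  imports Defs "HOL-Computational_Algebra.Polynomial"
begin

text \<open>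
  The lower bound comes from \<open>H\<^sub>0\<close>: the singular locus splits into at least \<open>c d ^ n\<close> clopen pieces.

  Choose a point of \<open>W\<close> whose coordinates are as algebraically independent as the codimension
  \<open>s \<le> n\<close> allows. Eliminating one variable after the other gives at most \<open>s\<close> equations in triangular
  form cutting out a subset of \<open>W\<close> near that point. For generic higher derivatives a germ with this
  jet meets these equations transversally, so by Brouwer's theorem the intersection persists under
  perturbations that are small in \<open>C\<^sup>r\<close>. Since \<open>W\<close> has positive codimension, some jet \<open>b\<close> has a
  neighbourhood free of \<open>W\<close>. Gluing the germ into a map with jet \<open>b\<close> gives a polynomial \<open>F\<close> whose
  singular locus meets the interior of a small compact set \<open>K\<close>, stably, but not its boundary.

  For odd \<open>m\<close>, \<open>sin (m \<alpha>)\<close> is a polynomial of degree \<open>m\<close> in \<open>sin \<alpha>\<close>. Substituting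
  \<open>x\<^sub>i = sin \<alpha>\<^sub>i\<close>, \<open>\<alpha>\<^sub>i = (2 \<pi> j\<^sub>i + \<omega>\<^sub>i) / m\<close>, a polynomial in the \<open>sin (m \<alpha>\<^sub>i) = sin \<omega>\<^sub>i\<close> looks
  the same in each of about \<open>m ^ n\<close> charts of the sphere, which is why \<open>F\<close> is taken as a polynomial in
  these sines; it becomes homogeneous of any large degree of the right parity by multiplication
  with powers of \<open>\<bar>x\<bar>\<^sup>2 = 1\<close>.
\<close>

section \<open>Polynomial expressions and triangular systems\<close>

text \<open>The obstacle is that \<open>W\<close> is arbitrary while jet extensions are not
  arbitrary sections: the velocity of an r-jet extension at a point is read off from its (r+1)-jet,
  whose entries are tied together by the symmetry of mixed derivatives. So transversality to
  \<open>W\<close> is not a free choice of a linear map. Genericity takes the place of a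
  stratification: at a point subject to no avoidable relation with the countably many polynomials in
  sight, the equations have independent gradients, and generic higher derivatives make the total
  derivatives independent as well. Since the m-fold angle forgets the chart, transversality and the
  admissible perturbation of jets are settled once, before the degree is known. The factor 8 (n + 1)
  in the number of charts keeps all n angles below 1 / (n + 1), with 8 bounding 2 pi; then the
  squares of the sines sum to less than 1 and the last coordinate can be solved for. Intrinsicness
  is needed for the boundary of \<open>K\<close>: \<open>Sigma_W\<close> accepts a point as soon as
  some embedding sees the singularity there, so avoiding it in one chart must exclude it in
  all.\<close>

datatype ('c, 'v) pex =
  Cst 'c | Var 'v | Add "('c, 'v) pex" "('c, 'v) pex" | Mul "('c, 'v) pex" "('c, 'v) pex"

instance pex :: (countable, countable) countable by countable_datatype

abbreviation pconsts :: "('c, 'v) pex \<Rightarrow> 'c set" where "pconsts \<equiv> set1_pex"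
abbreviation pvars :: "('c, 'v) pex \<Rightarrow> 'v set" where "pvars \<equiv> set2_pex"

primrec peval :: "(real, 'v) pex \<Rightarrow> ('v \<Rightarrow> real) \<Rightarrow> real" where
  "peval (Cst c) x = c"
| "peval (Var v) x = x v"
| "peval (Add a b) x = peval a x + peval b x"
| "peval (Mul a b) x = peval a x * peval b x"

primrec pd :: "'v \<Rightarrow> (real, 'v) pex \<Rightarrow> (real, 'v) pex" where
  "pd u (Cst c) = Cst 0"
| "pd u (Var v) = Cst (if v = u then 1 else 0)"
| "pd u (Add a b) = Add (pd u a) (pd u b)"
| "pd u (Mul a b) = Add (Mul (pd u a) b) (Mul a (pd u b))"

text \<open>Renaming constants through an enumeration of \<open>C\<close> exhibits each such
  expression as the image of one with natural numbers as constants, and those form a countable type.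
  Countability is what lets a generic value avoid all algebraic conditions at once.\<close>

lemma countable_pex_over:
  fixes C :: "'c set"
  assumes "countable C"
  shows "countable {e :: ('c, 'v::countable) pex. pconsts e \<subseteq> C}"
proof -
  have "e \<in> range (map_pex (from_nat_into C) (id :: 'v \<Rightarrow> 'v))" if "pconsts e \<subseteq> C" for e :: "('c, 'v) pex"
  proof
    have "map_pex (from_nat_into C \<circ> to_nat_on C) id e = map_pex id id e"
      using that assms by (intro pex.map_cong) auto
    then show "e = map_pex (from_nat_into C) id (map_pex (to_nat_on C) id e)"
      by (simp add: pex.map_comp pex.map_id)
  qed simp
  then have "{e :: ('c, 'v) pex. pconsts e \<subseteq> C} \<subseteq> range (map_pex (from_nat_into C) id)"
    by blast
  then show ?thesis
    by (rule countable_subset) auto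
qed

section \<open>Evaluation and formal partial derivatives\<close>

lemma finite_pvars [simp]: "finite (pvars e)"
  by (induction e) auto

lemma peval_cong: "(\<And>u. u \<in> pvars e \<Longrightarrow> x u = y u) \<Longrightarrow> peval e x = peval e y"
  by (induction e) auto

lemma pd_notin [simp]: "u \<notin> pvars e \<Longrightarrow> peval (pd u e) x = 0"
  by (induction e) auto

lemma pvars_pd: "pvars (pd u e) \<subseteq> pvars e"
  by (induction e) auto

lemma pconsts_pd: "pconsts e \<subseteq> C \<Longrightarrow> 0 \<in> C \<Longrightarrow> 1 \<in> C \<Longrightarrow> pconsts (pd u e) \<subseteq> C"
  by (induction e) auto

lemma pd_has_derivative:
  "((\<lambda>z. peval e (x(u := z))) has_real_derivative peval (pd u e) (x(u := z))) (at z)"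
  by (induction e) (auto intro!: derivative_eq_intros simp: algebra_simps)

text \<open>Both formal derivatives compute the slope of the same function along the
  \<open>u\<close> axis. An expression may therefore be replaced by a normal form of equal value
  without losing its derivatives.\<close>

lemma pd_semantic:
  assumes "\<And>x. peval e x = peval e' x"
  shows "peval (pd u e) x = peval (pd u e') x"
  using pd_has_derivative[of e x u "x u"] pd_has_derivative[of e' x u "x u"] DERIV_unique assms
  by fastforce

lemma peval_tendsto:
  "(\<And>u. u \<in> pvars e \<Longrightarrow> ((\<lambda>n. X n u) \<longlongrightarrow> x u) F) \<Longrightarrow> ((\<lambda>n. peval e (X n)) \<longlongrightarrow> peval e x) F"
  by (induction e) (auto intro!: tendsto_intros)

text \<open>Closeness is demanded only in the finitely many variables of \<open>e\<close>, so the
  statement applies to points with infinitely many jet coordinates.\<close>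

lemma peval_near:
  assumes "\<epsilon> > 0"
  shows "\<exists>\<delta>>0. \<forall>y. (\<forall>u\<in>pvars e. \<bar>y u - x u\<bar> < \<delta>) \<longrightarrow> \<bar>peval e y - peval e x\<bar> < \<epsilon>"
proof (rule ccontr)
  assume "\<not> ?thesis"
  then have "\<forall>n. \<exists>y. (\<forall>u\<in>pvars e. \<bar>y u - x u\<bar> < 1 / real (Suc n)) \<and> \<not> \<bar>peval e y - peval e x\<bar> < \<epsilon>"
    by (metis of_nat_0_less_iff zero_less_Suc zero_less_divide_1_iff)
  then obtain Y where Y: "\<And>n u. u \<in> pvars e \<Longrightarrow> \<bar>Y n u - x u\<bar> < 1 / real (Suc n)"
      and N: "\<And>n. \<not> \<bar>peval e (Y n) - peval e x\<bar> < \<epsilon>"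
    by metis
  have "(\<lambda>n. Y n u) \<longlonglongrightarrow> x u" if "u \<in> pvars e" for u
  proof (rule Lim_null[THEN iffD2], rule Lim_null_comparison)
    show "\<forall>\<^sub>F n in sequentially. norm (Y n u - x u) \<le> 1 / real (Suc n)"
      using Y[OF that] by (auto intro!: always_eventually less_imp_le)
    show "(\<lambda>n. 1 / real (Suc n)) \<longlonglongrightarrow> 0"
      by (rule LIMSEQ_Suc[OF lim_1_over_n])
  qed
  then have "(\<lambda>n. peval e (Y n)) \<longlonglongrightarrow> peval e x"
    by (rule peval_tendsto)
  then show False
    using N assms by (metis LIMSEQ_iff order_refl real_norm_def)
qed

text \<open>Horner form of a polynomial in \<open>v\<close>, constant coefficient first;
  \<open>ladd\<close> and \<open>lmul\<close> are sum and product of coefficient lists. Lengths are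
  tracked instead of degrees, since the top coefficient may vanish at the point of interest.\<close>

primrec plist :: "'v \<Rightarrow> (real, 'v) pex list \<Rightarrow> (real, 'v) pex" where
  "plist v [] = Cst 0"
| "plist v (c # cs) = Add c (Mul (Var v) (plist v cs))"

fun ladd :: "(real, 'v) pex list \<Rightarrow> (real, 'v) pex list \<Rightarrow> (real, 'v) pex list" where
  "ladd [] bs = bs"
| "ladd as [] = as"
| "ladd (a # as) (b # bs) = Add a b # ladd as bs"

primrec lmul :: "(real, 'v) pex list \<Rightarrow> (real, 'v) pex list \<Rightarrow> (real, 'v) pex list" where
  "lmul [] bs = []"
| "lmul (a # as) bs = ladd (map (Mul a) bs) (Cst 0 # lmul as bs)"

text \<open>Plays the role of the polynomial ring over \<open>C\<close> in the variables
  \<open>P\<close>. \<open>C\<close> need not be closed under arithmetic, because sums and products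
  of constants stay unevaluated; a finite \<open>C\<close> is enough later.\<close>

definition pover :: "real set \<Rightarrow> 'v set \<Rightarrow> (real, 'v) pex set" where
  "pover C P = {e. pconsts e \<subseteq> C \<and> pvars e \<subseteq> P}"

lemma pover_simps [simp]:
  "Cst c \<in> pover C P \<longleftrightarrow> c \<in> C"
  "Var v \<in> pover C P \<longleftrightarrow> v \<in> P"
  "Add a b \<in> pover C P \<longleftrightarrow> a \<in> pover C P \<and> b \<in> pover C P"
  "Mul a b \<in> pover C P \<longleftrightarrow> a \<in> pover C P \<and> b \<in> pover C P"
  by (auto simp: pover_def)

lemma pover_mono: "P \<subseteq> Q \<Longrightarrow> e \<in> pover C P \<Longrightarrow> e \<in> pover C Q"
  by (auto simp: pover_def)

lemma pover_pd: "e \<in> pover C P \<Longrightarrow> 0 \<in> C \<Longrightarrow> 1 \<in> C \<Longrightarrow> pd u e \<in> pover C P"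
  using pvars_pd[of u e] pconsts_pd[of e C u] by (auto simp: pover_def)

lemma peval_ladd: "peval (plist v (ladd as bs)) x = peval (plist v as) x + peval (plist v bs) x"
  by (induction as bs rule: ladd.induct) (auto simp: algebra_simps)

lemma peval_map_Mul: "peval (plist v (map (Mul a) bs)) x = peval a x * peval (plist v bs) x"
  by (induction bs) (auto simp: algebra_simps)

lemma peval_lmul: "peval (plist v (lmul as bs)) x = peval (plist v as) x * peval (plist v bs) x"
  by (induction as) (auto simp: algebra_simps peval_ladd peval_map_Mul)

lemma ladd_over: "set as \<subseteq> pover C P \<Longrightarrow> set bs \<subseteq> pover C P \<Longrightarrow> set (ladd as bs) \<subseteq> pover C P"
  by (induction as bs rule: ladd.induct) auto

lemma lmul_over:
  "0 \<in> C \<Longrightarrow> set as \<subseteq> pover C P \<Longrightarrow> set bs \<subseteq> pover C P \<Longrightarrow> set (lmul as bs) \<subseteq> pover C P"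
proof (induction as)
  case (Cons a as)
  then show ?case by (simp del: ladd.simps, intro ladd_over) auto
qed auto

lemma plist_exists:
  assumes "0 \<in> C" "1 \<in> C" "e \<in> pover C (insert v P)"
  shows "\<exists>cs. set cs \<subseteq> pover C P \<and> (\<forall>x. peval e x = peval (plist v cs) x)"
  using assms(3)
proof (induction e)
  case (Cst c)
  then show ?case by (intro exI[of _ "[Cst c]"]) auto
next
  case (Var w)
  show ?case
  proof (cases "w = v")
    case True
    then show ?thesis using assms by (intro exI[of _ "[Cst 0, Cst 1]"]) auto
  next
    case False
    then show ?thesis using Var by (intro exI[of _ "[Var w]"]) auto
  qed
next
  case (Add a b)
  then obtain as bs where "set as \<subseteq> pover C P" "\<forall>x. peval a x = peval (plist v as) x"
    "set bs \<subseteq> pover C P" "\<forall>x. peval b x = peval (plist v bs) x" by auto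
  then show ?case by (intro exI[of _ "ladd as bs"]) (simp add: ladd_over peval_ladd)
next
  case (Mul a b)
  then obtain as bs where "set as \<subseteq> pover C P" "\<forall>x. peval a x = peval (plist v as) x"
    "set bs \<subseteq> pover C P" "\<forall>x. peval b x = peval (plist v bs) x" by auto
  then show ?case using assms(1) by (intro exI[of _ "lmul as bs"]) (simp add: lmul_over peval_lmul)
qed

lemma plist_over:
  "0 \<in> C \<Longrightarrow> set cs \<subseteq> pover C P \<Longrightarrow> plist v cs \<in> pover C (insert v P)"
  by (induction cs) (auto intro: pover_mono[of P])

lemma poly_all_derivs_zero:
  fixes p :: "real poly"
  assumes "\<And>m. poly ((pderiv ^^ m) p) z = 0"
  shows "p = 0"
  using assms
proof (induction "degree p" arbitrary: p)
  case 0
  then obtain c where "p = [:c:]" by (metis degree_eq_zeroE)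
  with 0(2)[of 0] show ?case by simp
next
  case (Suc k)
  have "pderiv p = 0"
  proof (rule Suc.hyps(1))
    show "k = degree (pderiv p)" using Suc.hyps(2) by (simp add: degree_pderiv)
    show "poly ((pderiv ^^ m) (pderiv p)) z = 0" for m
      using Suc.prems[of "Suc m"] by (simp add: funpow_swap1)
  qed
  then show ?case using Suc.hyps(2) by (simp add: pderiv_eq_0_iff)
qed

lemma peval_plist_Poly:
  assumes "v \<notin> P" "set cs \<subseteq> pover C P"
  shows "peval (plist v cs) (x(v := z)) = poly (Poly (map (\<lambda>c. peval c x) cs)) z"
  using assms(2)
proof (induction cs)
  case (Cons c cs)
  have "peval c (x(v := z)) = peval c x"
    using Cons.prems assms(1) by (intro peval_cong) (auto simp: pover_def)
  with Cons show ?case by (simp del: fun_upd_apply) simp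
qed simp

text \<open>With the other variables frozen, the iterated \<open>pd v\<close> are the derivatives of
  one univariate polynomial at \<open>x v\<close>. If all of them vanish, it is the zero polynomial,
  and its coefficients are the values of \<open>cs\<close> at \<open>x\<close>.\<close>

lemma plist_coeffs_vanish:
  assumes "v \<notin> P" "set cs \<subseteq> pover C P"
    and 0: "\<And>m. peval ((pd v ^^ m) (plist v cs)) x = 0"
  shows "\<forall>c\<in>set cs. peval c x = 0"
proof -
  define p where "p = Poly (map (\<lambda>c. peval c x) cs)"
  have "peval ((pd v ^^ m) (plist v cs)) (x(v := z)) = poly ((pderiv ^^ m) p) z" for m z
  proof (induction m arbitrary: z)
    case 0
    show ?case unfolding p_def funpow_0 by (rule peval_plist_Poly[OF assms(1,2)])
  next
    case (Suc m)
    have "((\<lambda>z. poly ((pderiv ^^ m) p) z) has_real_derivative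
        peval (pd v ((pd v ^^ m) (plist v cs))) (x(v := z))) (at z)"
      using pd_has_derivative[of "(pd v ^^ m) (plist v cs)" x v z] by (simp only: Suc)
    then have "peval (pd v ((pd v ^^ m) (plist v cs))) (x(v := z)) = poly (pderiv ((pderiv ^^ m) p)) z"
      by (rule DERIV_unique[OF _ poly_DERIV])
    then show ?case by (simp del: fun_upd_apply)
  qed
  from this[of _ "x v"] have "p = 0"
    using 0 by (intro poly_all_derivs_zero[of _ "x v"]) simp
  then obtain k where "map (\<lambda>c. peval c x) cs = replicate k 0"
    unfolding p_def by (auto simp: Poly_eq_0)
  then show ?thesis
    by (metis (no_types, lifting) in_set_replicate list.set_map image_eqI)
qed

lemma plist_append_one:
  "peval (plist v (cs @ [c])) x = peval (plist v cs) x + peval c x * x v ^ length cs"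
  by (induction cs) (auto simp: algebra_simps)

lemma plist_shift:
  "peval (plist v (replicate k (Cst 0) @ cs)) x = x v ^ k * peval (plist v cs) x"
  by (induction k) (auto simp: algebra_simps)

lemma plist_zeros [simp]: "peval (plist v (replicate k (Cst 0))) x = 0"
  by (induction k) auto

text \<open>A pointwise substitute for membership in the local ideal of the \<open>f a\<close>. The
  statement about zeros serves to stay inside the semialgebraic set, the one about gradients serves
  transversality; both are kept by the division in \<open>good_cancel\<close>, on which
  pseudo-division relies.\<close>

definition good :: "'v set \<Rightarrow> ('v \<Rightarrow> (real, 'v) pex) \<Rightarrow> ('v \<Rightarrow> real) \<Rightarrow> (real, 'v) pex \<Rightarrow> bool" where
  "good A f x g \<longleftrightarrow> peval g x = 0 \<and>
     (\<exists>\<epsilon>>0. \<forall>y. (\<forall>u. \<bar>y u - x u\<bar> < \<epsilon>) \<longrightarrow> (\<forall>a\<in>A. peval (f a) y = 0) \<longrightarrow> peval g y = 0) \<and>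
     (\<exists>l. \<forall>u. peval (pd u g) x = (\<Sum>a\<in>A. l a * peval (pd u (f a)) x))"

lemma goodE:
  assumes "good A f x g"
  obtains \<epsilon> l where "peval g x = 0" "\<epsilon> > 0"
    "\<And>y. (\<forall>u. \<bar>y u - x u\<bar> < \<epsilon>) \<Longrightarrow> (\<forall>a\<in>A. peval (f a) y = 0) \<Longrightarrow> peval g y = 0"
    "\<And>u. peval (pd u g) x = (\<Sum>a\<in>A. l a * peval (pd u (f a)) x)"
  using assms unfolding good_def by blast

lemma good_zero: "(\<And>y. peval g y = 0) \<Longrightarrow> good A f x g"
proof -
  assume *: "\<And>y. peval g y = 0"
  have "peval (pd u g) x = 0" for u using pd_semantic[of g "Cst 0" u x] * by simp
  then show ?thesis unfolding good_def using * 
    by (auto intro!: exI[of _ 1] exI[of _ "\<lambda>_. 0"])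
qed

lemma good_semantic:
  assumes "good A f x g" "\<And>y. peval h y = peval g y"
  shows "good A f x h"
  using assms unfolding good_def by (simp add: pd_semantic[OF assms(2)])

lemma good_add:
  assumes "good A f x g" "good A f x h"
  shows "good A f x (Add g h)"
proof -
  obtain e1 l1 where g: "peval g x = 0" "e1 > 0"
    "\<And>y. (\<forall>u. \<bar>y u - x u\<bar> < e1) \<Longrightarrow> (\<forall>a\<in>A. peval (f a) y = 0) \<Longrightarrow> peval g y = 0"
    "\<And>u. peval (pd u g) x = (\<Sum>a\<in>A. l1 a * peval (pd u (f a)) x)"
    using assms(1) by (rule goodE) blast
  obtain e2 l2 where h: "peval h x = 0" "e2 > 0"
    "\<And>y. (\<forall>u. \<bar>y u - x u\<bar> < e2) \<Longrightarrow> (\<forall>a\<in>A. peval (f a) y = 0) \<Longrightarrow> peval h y = 0"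
    "\<And>u. peval (pd u h) x = (\<Sum>a\<in>A. l2 a * peval (pd u (f a)) x)"
    using assms(2) by (rule goodE) blast
  have "\<exists>\<epsilon>>0. \<forall>y. (\<forall>u. \<bar>y u - x u\<bar> < \<epsilon>) \<longrightarrow> (\<forall>a\<in>A. peval (f a) y = 0) \<longrightarrow> peval (Add g h) y = 0"
    using g h by (intro exI[of _ "min e1 e2"]) auto
  moreover have "\<exists>l. \<forall>u. peval (pd u (Add g h)) x = (\<Sum>a\<in>A. l a * peval (pd u (f a)) x)"
    by (intro exI[of _ "\<lambda>a. l1 a + l2 a"]) (simp add: g(4) h(4) distrib_right sum.distrib)
  ultimately show ?thesis using g h unfolding good_def by simp
qed

lemma good_mul:
  assumes "good A f x g"
  shows "good A f x (Mul h g)"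
proof -
  obtain e1 l1 where *: "peval g x = 0" "e1 > 0"
    "\<And>y. (\<forall>u. \<bar>y u - x u\<bar> < e1) \<Longrightarrow> (\<forall>a\<in>A. peval (f a) y = 0) \<Longrightarrow> peval g y = 0"
    "\<And>u. peval (pd u g) x = (\<Sum>a\<in>A. l1 a * peval (pd u (f a)) x)"
    using assms(1) by (rule goodE) blast
  have "\<exists>\<epsilon>>0. \<forall>y. (\<forall>u. \<bar>y u - x u\<bar> < \<epsilon>) \<longrightarrow> (\<forall>a\<in>A. peval (f a) y = 0) \<longrightarrow> peval (Mul h g) y = 0"
    using * by (intro exI[of _ e1]) auto
  moreover have "\<exists>l. \<forall>u. peval (pd u (Mul h g)) x = (\<Sum>a\<in>A. l a * peval (pd u (f a)) x)"
    by (intro exI[of _ "\<lambda>a. peval h x * l1 a"]) (simp add: * sum_distrib_left mult.assoc)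
  ultimately show ?thesis using * unfolding good_def by simp
qed

text \<open>Localisation at \<open>x\<close>: the factor \<open>h\<close> stays nonzero nearby, and
  because \<open>g\<close> vanishes at \<open>x\<close> the product rule merely rescales its
  gradient by \<open>peval h x\<close>.\<close>

lemma good_cancel:
  assumes "good A f x (Mul h g)" "peval h x \<noteq> 0"
  shows "good A f x g"
proof -
  obtain e1 l1 where "peval (Mul h g) x = 0" and *: "e1 > 0"
    "\<And>y. (\<forall>u. \<bar>y u - x u\<bar> < e1) \<Longrightarrow> (\<forall>a\<in>A. peval (f a) y = 0) \<Longrightarrow> peval (Mul h g) y = 0"
    "\<And>u. peval (pd u (Mul h g)) x = (\<Sum>a\<in>A. l1 a * peval (pd u (f a)) x)"
    using assms(1) by (rule goodE) blast
  then have gx: "peval g x = 0" using assms(2) by simp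
  obtain d where d: "d > 0" "\<And>y. (\<forall>u\<in>pvars h. \<bar>y u - x u\<bar> < d) \<Longrightarrow> \<bar>peval h y - peval h x\<bar> < \<bar>peval h x\<bar>"
    using peval_near[of "\<bar>peval h x\<bar>" h x] assms(2) by auto
  have "\<exists>\<epsilon>>0. \<forall>y. (\<forall>u. \<bar>y u - x u\<bar> < \<epsilon>) \<longrightarrow> (\<forall>a\<in>A. peval (f a) y = 0) \<longrightarrow> peval g y = 0"
  proof (intro exI[of _ "min e1 d"] conjI allI impI)
    fix y assume y: "\<forall>u. \<bar>y u - x u\<bar> < min e1 d" "\<forall>a\<in>A. peval (f a) y = 0"
    then have "peval (Mul h g) y = 0" using *(2)[of y] by auto
    moreover have "peval h y \<noteq> 0" using d(2)[of y] y by auto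
    ultimately show "peval g y = 0" by simp
  qed (use * d in auto)
  moreover have "\<exists>l. \<forall>u. peval (pd u g) x = (\<Sum>a\<in>A. l a * peval (pd u (f a)) x)"
  proof (intro exI allI)
    fix u
    have "peval h x * peval (pd u g) x = (\<Sum>a\<in>A. l1 a * peval (pd u (f a)) x)"
      using *(3)[of u] gx by simp
    then have "peval (pd u g) x = (\<Sum>a\<in>A. l1 a * peval (pd u (f a)) x) / peval h x"
      using assms(2) by (simp add: field_simps)
    then show "peval (pd u g) x = (\<Sum>a\<in>A. (l1 a / peval h x) * peval (pd u (f a)) x)"
      by (simp add: sum_divide_distrib)
  qed
  ultimately show ?thesis using gx unfolding good_def by blast
qed

lemma good_plist:
  assumes "\<And>c. c \<in> set cs \<Longrightarrow> good A f x c"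
  shows "good A f x (plist v cs)"
  using assms
proof (induction cs)
  case Nil
  show ?case by (rule good_zero) simp
next
  case (Cons c cs)
  then show ?case by (simp add: good_add good_mul)
qed

lemma good_extend:
  assumes "good A f x g" "finite B" "A \<subseteq> B" "\<And>a. a \<in> A \<Longrightarrow> f' a = f a"
  shows "good B f' x g"
proof -
  obtain e1 l1 where *: "peval g x = 0" "e1 > 0"
    "\<And>y. (\<forall>u. \<bar>y u - x u\<bar> < e1) \<Longrightarrow> (\<forall>a\<in>A. peval (f a) y = 0) \<Longrightarrow> peval g y = 0"
    "\<And>u. peval (pd u g) x = (\<Sum>a\<in>A. l1 a * peval (pd u (f a)) x)"
    using assms(1) by (rule goodE) blast
  have "\<exists>\<epsilon>>0. \<forall>y. (\<forall>u. \<bar>y u - x u\<bar> < \<epsilon>) \<longrightarrow> (\<forall>a\<in>B. peval (f' a) y = 0) \<longrightarrow> peval g y = 0"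
  proof (intro exI[of _ e1] conjI allI impI *(2))
    fix y assume "\<forall>u. \<bar>y u - x u\<bar> < e1" "\<forall>a\<in>B. peval (f' a) y = 0"
    then show "peval g y = 0" using *(3)[of y] assms(3,4) by (metis subsetD)
  qed
  moreover have "(\<Sum>a\<in>B. (if a \<in> A then l1 a else 0) * peval (pd u (f' a)) x) =
      (\<Sum>a\<in>A. l1 a * peval (pd u (f a)) x)" for u
    using assms by (intro sum.mono_neutral_cong_right) auto
  then have "\<forall>u. peval (pd u g) x = (\<Sum>a\<in>B. (if a \<in> A then l1 a else 0) * peval (pd u (f' a)) x)"
    using *(4) by simp
  ultimately show ?thesis using *(1) unfolding good_def by (intro conjI) (assumption, assumption, rule exI)
qed

lemma good_self:
  assumes "finite A" "a \<in> A" "peval (f a) x = 0"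
  shows "good A f x (f a)"
proof -
  have "(\<Sum>b\<in>A. (if b = a then 1 else 0) * peval (pd u (f b)) x) = peval (pd u (f a)) x" for u
  proof -
    have "(\<Sum>b\<in>A. (if b = a then 1 else 0) * peval (pd u (f b)) x) = (\<Sum>b\<in>A. if b = a then peval (pd u (f b)) x else 0)"
      by (rule sum.cong) auto
    then show ?thesis using assms by simp
  qed
  then have "\<exists>l. \<forall>u. peval (pd u (f a)) x = (\<Sum>b\<in>A. l b * peval (pd u (f b)) x)"
    by metis
  moreover have "\<exists>\<epsilon>>0. \<forall>y. (\<forall>u. \<bar>y u - x u\<bar> < \<epsilon>) \<longrightarrow> (\<forall>a\<in>A. peval (f a) y = 0) \<longrightarrow> peval (f a) y = 0"
    using assms by (intro exI[of _ 1]) auto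
  ultimately show ?thesis using assms unfolding good_def by blast
qed

text \<open>A triangular system: locally at \<open>x\<close> it cuts out the zero set of all expressions
  over \<open>C\<close> in the variables \<open>P\<close> that vanish at \<open>x\<close>.\<close>

definition triangular :: "real set \<Rightarrow> ('v \<Rightarrow> real) \<Rightarrow> 'v set \<Rightarrow> 'v set \<Rightarrow> ('v \<Rightarrow> (real, 'v) pex) \<Rightarrow> bool" where
  "triangular C x P A f \<longleftrightarrow> finite A \<and> A \<subseteq> P \<and>
     (\<forall>a\<in>A. f a \<in> pover C P \<and> peval (f a) x = 0) \<and>
     (\<forall>l. (\<forall>u. (\<Sum>a\<in>A. l a * peval (pd u (f a)) x) = 0) \<longrightarrow> (\<forall>a\<in>A. l a = 0)) \<and>
     (\<forall>g\<in>pover C P. peval g x = 0 \<longrightarrow> good A f x g)"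

lemma triangular_empty: "triangular C x {} {} f"
  unfolding triangular_def
proof (auto, goal_cases)
  case (1 g)
  have "peval g y = peval g x" for y by (rule peval_cong) (use 1 in \<open>auto simp: pover_def\<close>)
  then show ?case using 1 by (intro good_zero) simp
qed

text \<open>Transcendence of \<open>x v\<close> over the values of \<open>pover C P\<close>, put
  infinitesimally. The derivative of a relation is again a relation, so all iterated derivatives
  vanish at \<open>x\<close>, and for \<open>v\<close> outside \<open>P\<close> so do all
  coefficients. The negation directly supplies a relation with a simple root.\<close>

definition free_at :: "real set \<Rightarrow> ('v \<Rightarrow> real) \<Rightarrow> 'v set \<Rightarrow> 'v \<Rightarrow> bool" where
  "free_at C x P v \<longleftrightarrow> (\<forall>g\<in>pover C (insert v P). peval g x = 0 \<longrightarrow> peval (pd v g) x = 0)"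

text \<open>The coefficients of any relation in \<open>v\<close> vanish at \<open>x\<close> and are
  thus already consequences of the system for \<open>P\<close>; a free variable brings no new
  equation.\<close>

lemma triangular_free:
  assumes T: "triangular C x P A f" and C: "0 \<in> C" "1 \<in> C" and v: "v \<notin> P" and F: "free_at C x P v"
  shows "triangular C x (insert v P) A f"
proof -
  have "good A f x g" if g: "g \<in> pover C (insert v P)" "peval g x = 0" for g
  proof -
    obtain cs where cs: "set cs \<subseteq> pover C P" "\<And>x. peval g x = peval (plist v cs) x"
      using plist_exists[OF C g(1)] by auto
    have "(pd v ^^ m) (plist v cs) \<in> pover C (insert v P) \<and> peval ((pd v ^^ m) (plist v cs)) x = 0" for m
      by (induction m) (use g cs C F plist_over in \<open>auto simp: pover_pd free_at_def\<close>)
    then have "\<forall>c\<in>set cs. peval c x = 0"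
      using plist_coeffs_vanish[OF v cs(1)] by blast
    then have "good A f x (plist v cs)"
      using cs T by (intro good_plist) (unfold triangular_def, blast)
    then show ?thesis by (rule good_semantic) (simp add: cs)
  qed
  then show ?thesis
    using T pover_mono[of P "insert v P"] unfolding triangular_def by blast
qed

text \<open>A shortest relation with nonzero \<open>v\<close>-derivative acts as a minimal
  polynomial \<open>h\<close>. Pseudo-division by it shortens every longer relation, at the cost of
  a factor \<open>e\<close> that is nonzero at \<open>x\<close> and can be cancelled; relations
  shorter than \<open>h\<close> have all coefficients zero at \<open>x\<close>.\<close>

lemma triangular_alg:
  assumes T: "triangular C x P A f" and C: "0 \<in> C" "1 \<in> C" "-1 \<in> C" and v: "v \<notin> P" and F: "\<not> free_at C x P v"
  shows "\<exists>h. triangular C x (insert v P) (insert v A) (f(v := h))"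
proof -
  \<comment> \<open>\<open>Q k\<close> asks for a relation with \<open>k\<close> coefficients of
    which \<open>x v\<close> is a simple root; the least such \<open>k\<close> is used
    below.\<close>
  define Q where "Q k \<longleftrightarrow> (\<exists>cs. length cs = k \<and> set cs \<subseteq> pover C P \<and> peval (plist v cs) x = 0 \<and>
      peval (pd v (plist v cs)) x \<noteq> 0)" for k
  from F obtain g where g: "g \<in> pover C (insert v P)" "peval g x = 0" "peval (pd v g) x \<noteq> 0"
    by (auto simp: free_at_def)
  obtain cs where "set cs \<subseteq> pover C P" "\<And>x. peval g x = peval (plist v cs) x"
    using plist_exists[OF C(1,2) g(1)] by auto
  then have "Q (length cs)" unfolding Q_def using g pd_semantic[of g "plist v cs" v x] by auto
  then obtain k where k: "Q k" and kmin: "\<And>j. j < k \<Longrightarrow> \<not> Q j"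
    using exists_least_iff[of Q] by auto
  from k obtain fs where fs: "length fs = k" "set fs \<subseteq> pover C P" "peval (plist v fs) x = 0"
      "peval (pd v (plist v fs)) x \<noteq> 0"
    unfolding Q_def by auto
  define h where "h = plist v fs"
  define f' where "f' = f(v := h)"
  define A' where "A' = insert v A"
  have vA: "v \<notin> A" and fA: "finite A" "A \<subseteq> P" using T v by (auto simp: triangular_def)
  have goodP: "good A' f' x c" if "c \<in> pover C P" "peval c x = 0" for c
  proof (rule good_extend[of A f])
    show "good A f x c" using T that unfolding triangular_def by blast
  qed (use vA fA in \<open>auto simp: A'_def f'_def\<close>)
  have goodh: "good A' f' x h"
    using good_self[of A' v f' x] fA fs by (simp add: A'_def f'_def h_def)
  have "fs \<noteq> []" using fs(4) by auto
  then obtain fs' e where fs': "fs = fs' @ [e]" by (metis rev_exhaust)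
  have eP: "e \<in> pover C P" "set fs' \<subseteq> pover C P" using fs fs' by auto
  \<comment> \<open>If the top coefficient vanished at \<open>x\<close>, dropping its term would
    change neither the value nor the \<open>v\<close>-derivative there, since \<open>e\<close> does
    not contain \<open>v\<close>; the shorter relation would contradict minimality.\<close>
  have e0: "peval e x \<noteq> 0"
  proof
    assume e: "peval e x = 0"
    have sem: "peval (plist v fs) y = peval (Add (plist v fs') (Mul e (plist v (replicate (length fs') (Cst 0) @ [Cst 1])))) y" for y
      by (simp add: fs' plist_append_one plist_shift)
    have "v \<notin> pvars e" using eP v by (auto simp: pover_def)
    then have "peval (pd v (plist v fs')) x = peval (pd v (plist v fs)) x"
      using pd_semantic[OF sem, of v x] e by simp
    moreover have "peval (plist v fs') x = 0" using fs(3) e by (simp add: fs' plist_append_one)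
    ultimately have "Q (length fs')" unfolding Q_def using fs eP by auto
    then show False using kmin fs fs' by auto
  qed
  have main: "good A' f' x (plist v cs)" if "set cs \<subseteq> pover C P" "peval (plist v cs) x = 0" for cs
    using that
  proof (induction "length cs" arbitrary: cs rule: less_induct)
    case less
    show ?case
    proof (cases "length cs < k")
      case True
      have low: "\<And>g. g \<in> pover C (insert v P) \<Longrightarrow> (\<exists>ds. length ds \<le> length cs \<and> set ds \<subseteq> pover C P \<and> (\<forall>y. peval g y = peval (plist v ds) y))
        \<Longrightarrow> peval g x = 0 \<Longrightarrow> peval (pd v g) x = 0"
      proof -
        fix g assume "g \<in> pover C (insert v P)" "peval g x = 0"
          and "\<exists>ds. length ds \<le> length cs \<and> set ds \<subseteq> pover C P \<and> (\<forall>y. peval g y = peval (plist v ds) y)"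
        then obtain ds where ds: "length ds \<le> length cs" "set ds \<subseteq> pover C P" "\<And>y. peval g y = peval (plist v ds) y" "peval g x = 0"
          by auto
        then have "\<not> Q (length ds)" using kmin True by auto
        then have "peval (pd v (plist v ds)) x = 0" unfolding Q_def using ds by auto
        then show "peval (pd v g) x = 0" using pd_semantic[of g "plist v ds" v x] ds by auto
      qed
      \<comment> \<open>Differentiation must not lengthen the list, so that minimality of
        \<open>k\<close> applies again to every iterated derivative.\<close>
      have der: "\<exists>ds'. length ds' \<le> length ds \<and> set ds' \<subseteq> pover C P \<and> (\<forall>y. peval (pd v (plist v ds)) y = peval (plist v ds') y)"
        if "set ds \<subseteq> pover C P" for ds
        using that
      proof (induction ds)
        case Nil
        then show ?case by (intro exI[of _ "[]"]) auto
      next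
        case (Cons d ds)
        then obtain ds' where ds': "length ds' \<le> length ds" "set ds' \<subseteq> pover C P"
          "\<And>y. peval (pd v (plist v ds)) y = peval (plist v ds') y" by auto
        have "v \<notin> pvars d" using Cons.prems v by (auto simp: pover_def)
        then have "peval (pd v (plist v (d # ds))) y = peval (plist v (ladd ds (Cst 0 # ds'))) y" for y
          using ds' by (simp add: peval_ladd)
        moreover have "length (ladd as bs) = max (length as) (length bs)" for as bs :: "(real,'a) pex list"
          by (induction as bs rule: ladd.induct) auto
        moreover have "set (ladd ds (Cst 0 # ds')) \<subseteq> pover C P"
          using Cons.prems ds' C by (intro ladd_over) auto
        ultimately show ?case using ds' by (intro exI[of _ "ladd ds (Cst 0 # ds')"]) auto
      qed
      have iter: "peval ((pd v ^^ m) (plist v cs)) x = 0 \<and> (pd v ^^ m) (plist v cs) \<in> pover C (insert v P) \<and>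
        (\<exists>ds. length ds \<le> length cs \<and> set ds \<subseteq> pover C P \<and> (\<forall>y. peval ((pd v ^^ m) (plist v cs)) y = peval (plist v ds) y))" for m
      proof (induction m)
        case 0
        then show ?case using less.prems plist_over[OF C(1), of cs P v] by auto
      next
        case (Suc m)
        then obtain ds where ds: "length ds \<le> length cs" "set ds \<subseteq> pover C P"
          "\<And>y. peval ((pd v ^^ m) (plist v cs)) y = peval (plist v ds) y" by auto
        obtain ds' where ds': "length ds' \<le> length ds" "set ds' \<subseteq> pover C P"
          "\<And>y. peval (pd v (plist v ds)) y = peval (plist v ds') y" using der[OF ds(2)] by auto
        have "peval ((pd v ^^ Suc m) (plist v cs)) y = peval (plist v ds') y" for y
          using pd_semantic[OF ds(3), of v y] ds' by simp
        then show ?case using Suc low[of "(pd v ^^ m) (plist v cs)"] pover_pd[of "(pd v ^^ m) (plist v cs)" C "insert v P" v] C ds ds'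
          by (auto intro!: exI[of _ ds'])
      qed
      then have "\<forall>c\<in>set cs. peval c x = 0"
        using plist_coeffs_vanish[OF v less.prems(1)] by blast
      then show ?thesis using less.prems by (intro good_plist goodP) auto
    next
      case False
      have "cs \<noteq> []" using False fs fs' by auto
      then obtain cs' d where cs': "cs = cs' @ [d]" by (metis rev_exhaust)
      define j where "j = length cs - k"
      \<comment> \<open>One step of pseudo-division: \<open>e\<close> times the relation minus
        \<open>d\<close> times \<open>v ^ j\<close> times \<open>h\<close>. The top terms cancel, so
        both lists enter without their last entries and \<open>bs\<close> is one shorter than
        \<open>cs\<close>.\<close>
      define bs where "bs = ladd (map (Mul e) cs') (replicate j (Cst 0) @ map (Mul (Mul (Cst (-1)) d)) fs')"
      have lens: "length cs' = j + length fs'" using False fs fs' cs' by (simp add: j_def)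
      have lbs: "length bs = length cs'"
      proof -
        have "length (ladd as bs) = max (length as) (length bs)" for as bs :: "(real,'a) pex list"
          by (induction as bs rule: ladd.induct) auto
        then show ?thesis using lens by (simp add: bs_def)
      qed
      have bsP: "set bs \<subseteq> pover C P" unfolding bs_def using less.prems(1) eP C
        by (intro ladd_over) (auto simp: cs')
      have sem: "peval (Mul e (plist v cs)) y = peval (Add (plist v bs) (Mul (Mul d (plist v (replicate j (Cst 0) @ [Cst 1]))) h)) y" for y
        by (simp add: bs_def peval_ladd peval_map_Mul plist_shift h_def fs' cs' plist_append_one lens power_add algebra_simps)
      have "peval (plist v bs) x = 0"
        using sem[of x] less.prems(2) fs(3) by (simp add: h_def)
      then have "good A' f' x (plist v bs)"
        using less.hyps[of bs] lbs bsP cs' by auto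
      then have "good A' f' x (Add (plist v bs) (Mul (Mul d (plist v (replicate j (Cst 0) @ [Cst 1]))) h))"
        by (intro good_add good_mul goodh)
      then have "good A' f' x (Mul e (plist v cs))" by (rule good_semantic) (rule sem)
      then show ?thesis using e0 by (rule good_cancel)
    qed
  qed
  have all: "good A' f' x g" if g: "g \<in> pover C (insert v P)" "peval g x = 0" for g
  proof -
    obtain cs where cs: "set cs \<subseteq> pover C P" "\<And>x. peval g x = peval (plist v cs) x"
      using plist_exists[OF C(1,2) g(1)] by auto
    then have "good A' f' x (plist v cs)" using main g by auto
    then show ?thesis by (rule good_semantic) (simp add: cs)
  qed
  \<comment> \<open>Only \<open>h\<close> involves \<open>v\<close>, so the
    \<open>v\<close>-component of a vanishing combination of gradients isolates \<open>l v\<close>;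
    the triangular shape gives independence.\<close>
  have ind: "\<forall>a\<in>A'. l a = 0" if l: "\<forall>u. (\<Sum>a\<in>A'. l a * peval (pd u (f' a)) x) = 0" for l
  proof -
    have split: "(\<Sum>a\<in>A'. l a * peval (pd u (f' a)) x) = l v * peval (pd u h) x + (\<Sum>a\<in>A. l a * peval (pd u (f a)) x)" for u
      unfolding A'_def f'_def using vA fA by (subst sum.insert) (auto intro!: sum.cong)
    have "peval (pd v (f a)) x = 0" if "a \<in> A" for a
      using T that v by (intro pd_notin) (auto simp: triangular_def pover_def)
    then have "l v = 0" using l split[of v] fs(4) by (simp add: h_def)
    then have "\<forall>u. (\<Sum>a\<in>A. l a * peval (pd u (f a)) x) = 0" using l split by simp
    then have "\<forall>a\<in>A. l a = 0" using T unfolding triangular_def by blast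
    then show ?thesis using \<open>l v = 0\<close> by (simp add: A'_def)
  qed
  have "f' a \<in> pover C (insert v P) \<and> peval (f' a) x = 0" if "a \<in> A'" for a
    using that T fs plist_over[OF C(1) fs(2), of v] vA
    by (auto simp: A'_def f'_def h_def triangular_def intro: pover_mono[OF subset_insertI])
  then have "triangular C x (insert v P) A' f'"
    unfolding triangular_def using all ind fA by (auto simp: A'_def)
  then show ?thesis unfolding A'_def f'_def by blast
qed

section \<open>Total derivatives at a generic point\<close>

definition subring_of :: "real set \<Rightarrow> bool" where
  "subring_of K \<longleftrightarrow> 0 \<in> K \<and> 1 \<in> K \<and> (\<forall>a\<in>K. - a \<in> K) \<and> (\<forall>a\<in>K. \<forall>b\<in>K. a + b \<in> K \<and> a * b \<in> K)"

lemma subring_of_sum: "subring_of K \<Longrightarrow> (\<And>i. i \<in> J \<Longrightarrow> g i \<in> K) \<Longrightarrow> sum g J \<in> K"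
  by (induction J rule: infinite_finite_induct) (auto simp: subring_of_def)

lemma subring_of_closed:
  "subring_of K \<Longrightarrow> a \<in> K \<Longrightarrow> b \<in> K \<Longrightarrow> a * b \<in> K"
  "subring_of K \<Longrightarrow> a \<in> K \<Longrightarrow> b \<in> K \<Longrightarrow> a - b \<in> K"
  "subring_of K \<Longrightarrow> a \<in> K \<Longrightarrow> - a \<in> K"
  unfolding subring_of_def by (auto simp: diff_conv_add_uminus simp del: add_uminus_conv_diff)

text \<open>One elimination step with pivot \<open>B a0 i0\<close>, cross-multiplied so that no
  division leaves the subring: a relation between the reduced rows lifts to one between the original
  rows.\<close>

lemma eliminate_combination:
  fixes B :: "'a \<Rightarrow> 'i \<Rightarrow> real"
  assumes "finite A" "a0 \<in> A"
    and z: "\<And>i. i \<in> J \<Longrightarrow> (\<Sum>a\<in>A - {a0}. x a * (B a i * B a0 i0 - B a i0 * B a0 i)) = 0"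
    and i: "i \<in> J"
  shows "(\<Sum>a\<in>A. (if a = a0 then - (\<Sum>a\<in>A - {a0}. x a * B a i0) else x a * B a0 i0) * B a i) = 0"
proof -
  define y where "y a = (if a = a0 then - (\<Sum>a\<in>A - {a0}. x a * B a i0) else x a * B a0 i0)" for a
  have "(\<Sum>a\<in>A. y a * B a i) = y a0 * B a0 i + (\<Sum>a\<in>A - {a0}. y a * B a i)"
    using assms(1,2) by (rule sum.remove)
  also have "(\<Sum>a\<in>A - {a0}. y a * B a i) = (\<Sum>a\<in>A - {a0}. x a * B a0 i0 * B a i)"
    by (rule sum.cong) (auto simp: y_def)
  also have "y a0 * B a0 i + \<dots> = (\<Sum>a\<in>A - {a0}. x a * (B a i * B a0 i0 - B a i0 * B a0 i))"
    by (simp add: y_def right_diff_distrib sum_subtractf sum_distrib_right sum_distrib_left mult_ac)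
  finally show ?thesis using z[OF i] by (simp add: y_def)
qed

text \<open>Elimination replaces a real kernel vector by one with entries in \<open>K\<close>. For
  \<open>K\<close> the values of expressions at a point, the new coefficients are themselves values
  of expressions and can be differentiated formally.\<close>

lemma left_kernel_in_subring:
  fixes B :: "'a \<Rightarrow> 'i \<Rightarrow> real"
  assumes "subring_of K" "finite A" "\<And>a i. a \<in> A \<Longrightarrow> i \<in> J \<Longrightarrow> B a i \<in> K"
    and "\<exists>a\<in>A. x a \<noteq> 0" "\<And>i. i \<in> J \<Longrightarrow> (\<Sum>a\<in>A. x a * B a i) = 0"
  shows "\<exists>y. (\<forall>a. y a \<in> K) \<and> (\<exists>a\<in>A. y a \<noteq> 0) \<and> (\<forall>i\<in>J. (\<Sum>a\<in>A. y a * B a i) = 0)"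
  using assms(2-)
proof (induction "card A" arbitrary: A B)
  case 0
  then show ?case by auto
next
  case (Suc n)
  then obtain a0 where a0: "a0 \<in> A" by auto
  show ?case
  proof (cases "\<forall>i\<in>J. B a0 i = 0")
    case True
    have "(\<Sum>a\<in>A. (if a = a0 then 1 else 0) * B a i) = 0" if "i \<in> J" for i
      using True that by (intro sum.neutral) auto
    then show ?thesis using a0 assms(1)
      by (intro exI[of _ "\<lambda>a. if a = a0 then 1 else 0"]) (auto simp: subring_of_def)
  next
    case False
    then obtain i0 where i0: "i0 \<in> J" "B a0 i0 \<noteq> 0" by auto
    let ?B = "\<lambda>a i. B a i * B a0 i0 - B a i0 * B a0 i"
    have eq: "(\<Sum>a\<in>A - {a0}. x a * B a i) = - (x a0 * B a0 i)" if "i \<in> J" for i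
      using Suc.prems(4)[OF that] a0 Suc.prems(1) by (simp add: sum.remove)
    have "\<exists>y. (\<forall>a. y a \<in> K) \<and> (\<exists>a\<in>A - {a0}. y a \<noteq> 0) \<and> (\<forall>i\<in>J. (\<Sum>a\<in>A - {a0}. y a * ?B a i) = 0)"
    proof (rule Suc.hyps(1))
      show "n = card (A - {a0})" using Suc.hyps(2) a0 Suc.prems(1) by simp
      show "?B a i \<in> K" if "a \<in> A - {a0}" "i \<in> J" for a i
        using Suc.prems(2) a0 i0 that assms(1) by (intro subring_of_closed) auto
      show "\<exists>a\<in>A - {a0}. x a \<noteq> 0"
      proof (rule ccontr)
        assume N: "\<not> (\<exists>a\<in>A - {a0}. x a \<noteq> 0)"
        then have "x a0 * B a0 i0 = 0" using eq[OF i0(1)] by simp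
        then show False using N Suc.prems(3) i0 by auto
      qed
      show "(\<Sum>a\<in>A - {a0}. x a * ?B a i) = 0" if "i \<in> J" for i
      proof -
        have "(\<Sum>a\<in>A - {a0}. x a * ?B a i) =
            B a0 i0 * (\<Sum>a\<in>A - {a0}. x a * B a i) - B a0 i * (\<Sum>a\<in>A - {a0}. x a * B a i0)"
          by (simp add: sum_distrib_left sum_subtractf[symmetric] algebra_simps)
        also have "\<dots> = 0" using eq[OF that] eq[OF i0(1)] by (simp add: algebra_simps)
        finally show ?thesis .
      qed
    qed (use Suc.prems in auto)
    then obtain y where y: "\<And>a. y a \<in> K" "\<exists>a\<in>A - {a0}. y a \<noteq> 0"
      "\<And>i. i \<in> J \<Longrightarrow> (\<Sum>a\<in>A - {a0}. y a * ?B a i) = 0" by auto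
    define y' where "y' a = (if a = a0 then - (\<Sum>a\<in>A - {a0}. y a * B a i0)
        else if a \<in> A then y a * B a0 i0 else 0)" for a
    have "y' a \<in> K" for a
      unfolding y'_def using assms(1) y(1) Suc.prems(2) a0 i0
      by (auto intro!: subring_of_closed subring_of_sum simp: subring_of_def[of K])
    moreover have "\<exists>a\<in>A. y' a \<noteq> 0" using y(2) i0 by (auto simp: y'_def)
    moreover have "(\<Sum>a\<in>A. y' a * B a i) = 0" if "i \<in> J" for i
    proof -
      have "(\<Sum>a\<in>A. (if a = a0 then - (\<Sum>a\<in>A - {a0}. y a * B a i0) else y a * B a0 i0) * B a i) = 0"
        by (rule eliminate_combination[where J = J]) (use Suc.prems(1) a0 y(3) that in auto)
      then show ?thesis by (simp add: y'_def cong: sum.cong if_cong)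
    qed
    ultimately show ?thesis by blast
  qed
qed

text \<open>Each equation with a nonzero pivot removes one unknown, and there are more unknowns than
  equations. It later provides the coefficients of a vector field as values of expressions.\<close>

lemma underdetermined_in_subring:
  fixes B :: "'a \<Rightarrow> 'i \<Rightarrow> real"
  assumes "subring_of K" "finite E" "finite J" "card E < card J" "\<And>e i. e \<in> E \<Longrightarrow> i \<in> J \<Longrightarrow> B e i \<in> K"
  shows "\<exists>y. (\<forall>i. y i \<in> K) \<and> (\<exists>i\<in>J. y i \<noteq> 0) \<and> (\<forall>e\<in>E. (\<Sum>i\<in>J. y i * B e i) = 0)"
  using assms(2-)
proof (induction "card E" arbitrary: E J B)
  case 0
  then have "J \<noteq> {}" "E = {}" by auto
  then show ?case using assms(1) by (intro exI[of _ "\<lambda>_. 1"]) (auto simp: subring_of_def)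
next
  case (Suc n)
  obtain e0 where e0: "e0 \<in> E" using Suc.hyps(2) by (metis card.empty ex_in_conv nat.distinct(1))
  have E1: "E = insert e0 (E - {e0})" "n = card (E - {e0})" using e0 Suc by auto
  show ?case
  proof (cases "\<forall>i\<in>J. B e0 i = 0")
    case True
    have "\<exists>y. (\<forall>i. y i \<in> K) \<and> (\<exists>i\<in>J. y i \<noteq> 0) \<and> (\<forall>e\<in>E - {e0}. (\<Sum>i\<in>J. y i * B e i) = 0)"
      using Suc.prems E1 Suc.hyps(2) by (intro Suc.hyps(1)) auto
    then obtain y where "\<forall>i. y i \<in> K" "\<exists>i\<in>J. y i \<noteq> 0" "\<forall>e\<in>E - {e0}. (\<Sum>i\<in>J. y i * B e i) = 0" by auto
    moreover have "(\<Sum>i\<in>J. y i * B e0 i) = 0" using True by (intro sum.neutral) auto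
    ultimately show ?thesis using E1(1) by (intro exI[of _ y]) auto
  next
    case False
    then obtain i0 where i0: "i0 \<in> J" "B e0 i0 \<noteq> 0" by auto
    let ?B = "\<lambda>e i. B e i * B e0 i0 - B e0 i * B e i0"
    have "\<exists>y. (\<forall>i. y i \<in> K) \<and> (\<exists>i\<in>J - {i0}. y i \<noteq> 0) \<and> (\<forall>e\<in>E - {e0}. (\<Sum>i\<in>J - {i0}. y i * ?B e i) = 0)"
    proof (rule Suc.hyps(1))
      show "?B e i \<in> K" if "e \<in> E - {e0}" "i \<in> J - {i0}" for e i
        using Suc.prems(4) e0 i0 that assms(1) by (intro subring_of_closed) auto
    qed (use Suc.prems Suc.hyps(2) E1 i0 in auto)
    then obtain y where y: "\<And>i. y i \<in> K" "\<exists>i\<in>J - {i0}. y i \<noteq> 0"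
      "\<And>e. e \<in> E - {e0} \<Longrightarrow> (\<Sum>i\<in>J - {i0}. y i * ?B e i) = 0" by auto
    define y' where "y' i = (if i = i0 then - (\<Sum>i\<in>J - {i0}. y i * B e0 i)
        else if i \<in> J then y i * B e0 i0 else 0)" for i
    have "y' i \<in> K" for i
      unfolding y'_def using assms(1) y(1) Suc.prems(4) e0 i0
      by (auto intro!: subring_of_closed subring_of_sum simp: subring_of_def[of K])
    moreover have "\<exists>i\<in>J. y' i \<noteq> 0" using y(2) i0 by (auto simp: y'_def)
    moreover have "(\<Sum>i\<in>J. y' i * B e i) = 0" if "e \<in> E" for e
    proof -
      have "(\<Sum>i\<in>J. (if i = i0 then - (\<Sum>i\<in>J - {i0}. y i * B e0 i) else y i * B e0 i0) * B e i) = 0"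
      \<comment> \<open>Rows and columns are exchanged: the unknowns are now the summation index and
        the equations play the part of \<open>J\<close>.\<close>
      proof (rule eliminate_combination[where J = E and B = "\<lambda>i e. B e i", OF Suc.prems(2) i0(1) _ that])
        fix e assume "e \<in> E"
        show "(\<Sum>a\<in>J - {i0}. y a * (B e a * B e0 i0 - B e0 a * B e i0)) = 0"
          using y(3)[of e] \<open>e \<in> E\<close> by (cases "e = e0") auto
      qed
      then show ?thesis by (simp add: y'_def cong: sum.cong if_cong)
    qed
    ultimately show ?thesis by blast
  qed
qed

section \<open>Total derivatives as derivations of the ring of jet polynomials\<close>

type_synonym ('n, 'k) jvar = "'n + ('n \<Rightarrow> nat) \<times> 'k"

text \<open>The total derivative in direction \<open>i\<close> on jets of infinite order. Without
  truncation it maps the ring of expressions to itself, and the total derivatives commute.\<close>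

primrec td :: "'n \<Rightarrow> (real, ('n, 'k) jvar) pex \<Rightarrow> (real, ('n, 'k) jvar) pex" where
  "td i (Cst c) = Cst 0"
| "td i (Var v) = (case v of Inl l \<Rightarrow> Cst (if l = i then 1 else 0)
                     | Inr (\<beta>, j) \<Rightarrow> Var (Inr (\<beta>(i := \<beta> i + 1), j)))"
| "td i (Add a b) = Add (td i a) (td i b)"
| "td i (Mul a b) = Add (Mul (td i a) b) (Mul a (td i b))"

lemma td_pover: "e \<in> pover C UNIV \<Longrightarrow> 0 \<in> C \<Longrightarrow> 1 \<in> C \<Longrightarrow> td i e \<in> pover C UNIV"
  by (induction e) (auto split: sum.splits)

lemma td_commute: "peval (td i (td l e)) x = peval (td l (td i e)) x"
  by (induction e) (auto split: sum.splits simp: algebra_simps fun_upd_twist fun_upd_def intro!: arg_cong[of _ _ x])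

text \<open>The commutator of a jet derivative with a total derivative is the jet derivative for the
  multi-index lowered at \<open>i\<close>, read as 0 if there is nothing to lower.\<close>

lemma pd_td:
  "peval (pd (Inr (\<gamma>, j)) (td i e)) x = peval (td i (pd (Inr (\<gamma>, j)) e)) x +
     (if 0 < \<gamma> i then peval (pd (Inr (\<gamma>(i := \<gamma> i - 1), j)) e) x else 0)"
proof (induction e)
  case (Var v)
  have "(\<beta>(i := \<beta> i + 1) = \<gamma>) = (0 < \<gamma> i \<and> \<beta> = \<gamma>(i := \<gamma> i - 1))" for \<beta> :: "'a \<Rightarrow> nat"
    by (auto simp: fun_eq_iff)
  then show ?case by (auto split: sum.splits simp: fun_upd_idem_iff)
qed (auto simp: algebra_simps)

lemma td_sum:
  assumes "finite U" "pvars e \<subseteq> U"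
  shows "peval (td i e) x = (\<Sum>u\<in>U. peval (pd u e) x * peval (td i (Var u)) x)"
  using assms(2)
proof (induction e)
  case (Var v)
  have "(\<Sum>u\<in>U. peval (pd u (Var v)) x * peval (td i (Var u)) x) = 
      (\<Sum>u\<in>U. if u = v then peval (td i (Var u)) x else 0)"
    by (rule sum.cong) auto
  then show ?case using Var assms(1) by simp
qed (simp_all add: sum.distrib[symmetric] sum_distrib_left sum_distrib_right algebra_simps)

definition psum :: "('i \<Rightarrow> (real, 'v) pex) \<Rightarrow> 'i list \<Rightarrow> (real, 'v) pex" where
  "psum F is = foldr (\<lambda>i e. Add (F i) e) is (Cst 0)"

lemma psum_over: "0 \<in> C \<Longrightarrow> (\<And>i. i \<in> set is \<Longrightarrow> F i \<in> pover C P) \<Longrightarrow> psum F is \<in> pover C P"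
  by (induction "is") (auto simp: psum_def)

lemma psum_simps [simp]: "psum F [] = Cst 0" "psum F (i # is) = Add (F i) (psum F is)"
  by (auto simp: psum_def)

lemma peval_psum:
  assumes "distinct is"
  shows "peval (psum F is) x = (\<Sum>i\<in>set is. peval (F i) x)"
    and "peval (pd u (psum F is)) x = (\<Sum>i\<in>set is. peval (pd u (F i)) x)"
  using assms by (induction "is") auto

lemma td_psum:
  assumes "distinct is"
  shows "peval (td l (psum F is)) x = (\<Sum>i\<in>set is. peval (td l (F i)) x)"
  using assms by (induction "is") auto

text \<open>The total derivatives of the equations cutting out a generic point have independent
  gradients. Otherwise there are a nonzero vector field \<open>X = (\<Sum>i. v i * D i)\<close> preserving the ideal
  \<open>p\<close> of the point and a nonzero element of the ideal \<open>q = {f \<in> p. \<forall>i. D i f \<in> p}\<close>; but \<open>X\<close>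
  preserves \<open>q\<close> and raises the order of the partial gradient of its elements, while this order is
  bounded by \<open>r\<close>.\<close>

theorem total_derivatives_independent:
  fixes f :: "('n::finite, 'k::finite) jvar \<Rightarrow> (real, ('n, 'k) jvar) pex"
  assumes C: "0 \<in> C" "1 \<in> C" "-1 \<in> C"
    and T: "triangular C x UNIV A f"
    and ord: "\<And>a \<gamma> j. a \<in> A \<Longrightarrow> r < sum \<gamma> UNIV \<Longrightarrow> Inr (\<gamma>, j) \<notin> pvars (f a)"
    and cardA: "card A \<le> CARD('n)"
    and ker: "\<And>i. (\<Sum>a\<in>A. \<xi> a * peval (td i (f a)) x) = 0"
  shows "\<forall>a\<in>A. \<xi> a = 0"
proof (rule ccontr)
  assume "\<not> ?thesis"
  then obtain a0 where a0: "a0 \<in> A" "\<xi> a0 \<noteq> 0" by auto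
  have finA: "finite A" using T unfolding triangular_def by (elim conjE)
  have fP: "f a \<in> pover C UNIV" "peval (f a) x = 0" if "a \<in> A" for a
  proof -
    have "\<forall>a\<in>A. f a \<in> pover C UNIV \<and> peval (f a) x = 0"
      using T unfolding triangular_def by (elim conjE)
    then show "f a \<in> pover C UNIV" "peval (f a) x = 0" using that by auto
  qed
  have indep: "\<forall>a\<in>A. l a = 0" if "\<And>u. (\<Sum>a\<in>A. l a * peval (pd u (f a)) x) = 0" for l
  proof -
    have "\<forall>l. (\<forall>u. (\<Sum>a\<in>A. l a * peval (pd u (f a)) x) = 0) \<longrightarrow> (\<forall>a\<in>A. l a = 0)"
      using T unfolding triangular_def by (elim conjE)
    then show ?thesis using that by simp
  qed
  have gd: "good A f x g" if "g \<in> pover C UNIV" "peval g x = 0" for g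
  proof -
    have "\<forall>g\<in>pover C UNIV. peval g x = 0 \<longrightarrow> good A f x g"
      using T unfolding triangular_def by (elim conjE)
    then show ?thesis using that by simp
  qed
  define K where "K = (\<lambda>g. peval g x) ` pover C UNIV"
  have KI: "peval g x \<in> K" if "g \<in> pover C UNIV" for g using that by (auto simp: K_def)
  have K: "subring_of K"
    unfolding subring_of_def
  proof (intro conjI ballI)
    show "0 \<in> K" "1 \<in> K" using KI[of "Cst 0"] KI[of "Cst 1"] C by auto
    fix a assume "a \<in> K"
    then obtain g where g: "g \<in> pover C UNIV" "a = peval g x" by (auto simp: K_def)
    then show "- a \<in> K" using KI[of "Mul (Cst (-1)) g"] C by simp
    fix b assume "b \<in> K"
    then obtain h where h: "h \<in> pover C UNIV" "b = peval h x" by (auto simp: K_def)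
    show "a + b \<in> K" "a * b \<in> K" using KI[of "Add g h"] KI[of "Mul g h"] g h by auto
  qed
  let ?B = "\<lambda>a i. peval (td i (f a)) x"
  have BK: "?B a i \<in> K" if "a \<in> A" for a i by (rule KI, rule td_pover[OF fP(1)[OF that] C(1,2)])
  \<comment> \<open>The given \<open>\<xi>\<close> has arbitrary real entries. Entries in
    \<open>K\<close> make the combination of equations an expression over \<open>C\<close>, to which
    the vector field can be applied.\<close>
  obtain \<eta> where \<eta>: "\<And>a. \<eta> a \<in> K" "\<exists>a\<in>A. \<eta> a \<noteq> 0" "\<And>i. (\<Sum>a\<in>A. \<eta> a * ?B a i) = 0"
    using left_kernel_in_subring[OF K finA, of UNIV ?B \<xi>] BK a0 ker by auto
  \<comment> \<open>Dropping one row leaves fewer equations than directions, hence a nonzero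
    solution \<open>v\<close>; the dropped equation follows from the relation \<open>\<xi>\<close>,
    as \<open>\<xi> a0\<close> is nonzero.\<close>
  have "card (A - {a0}) < card (UNIV :: 'n set)"
    using cardA a0 finA by (metis card_Diff1_less order_less_le_trans)
  then have "\<exists>v. (\<forall>i. v i \<in> K) \<and> (\<exists>i\<in>UNIV. v i \<noteq> 0) \<and> (\<forall>a\<in>A - {a0}. (\<Sum>i\<in>UNIV. v i * ?B a i) = 0)"
    using BK finA by (intro underdetermined_in_subring[OF K]) auto
  then obtain v where v: "\<And>i. v i \<in> K" "\<exists>i. v i \<noteq> 0" "\<And>a. a \<in> A - {a0} \<Longrightarrow> (\<Sum>i\<in>UNIV. v i * ?B a i) = 0"
    by blast
  have vA: "(\<Sum>i\<in>UNIV. v i * ?B a i) = 0" if "a \<in> A" for a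
  proof (cases "a = a0")
    case True
    have "\<xi> a0 * (\<Sum>i\<in>UNIV. v i * ?B a0 i) = (\<Sum>a\<in>A. \<xi> a * (\<Sum>i\<in>UNIV. v i * ?B a i))"
      using v(3) a0 finA by (simp add: sum.remove[OF finA a0(1)])
    also have "\<dots> = (\<Sum>i\<in>UNIV. v i * (\<Sum>a\<in>A. \<xi> a * ?B a i))"
      unfolding sum_distrib_left by (subst sum.swap) (simp add: algebra_simps)
    finally show ?thesis using ker True a0 by simp
  next
    case False
    then show ?thesis using v(3) that by simp
  qed
  obtain V where V: "\<And>i. V i \<in> pover C UNIV" "\<And>i. peval (V i) x = v i"
  proof -
    have "\<forall>i. \<exists>g. g \<in> pover C UNIV \<and> peval g x = v i" using v(1)[unfolded K_def image_iff] by metis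
    then show ?thesis using that by metis
  qed
  obtain E where E: "\<And>a. E a \<in> pover C UNIV" "\<And>a. peval (E a) x = \<eta> a"
  proof -
    have "\<forall>a. \<exists>g. g \<in> pover C UNIV \<and> peval g x = \<eta> a" using \<eta>(1)[unfolded K_def image_iff] by metis
    then show ?thesis using that by metis
  qed
  obtain ns :: "'n list" where ns: "distinct ns" "set ns = UNIV"
    using finite_distinct_list[OF finite_class.finite_UNIV] by blast
  obtain as where as: "distinct as" "set as = A"
    using finite_distinct_list[OF finA] by blast
  \<comment> \<open>The vector field with expressions \<open>V i\<close> as coefficients. Only their
    values at \<open>x\<close> matter where it is used, because the remaining terms carry total
    derivatives that vanish at \<open>x\<close>.\<close>
  define X where "X g = psum (\<lambda>i. Mul (V i) (td i g)) ns" for g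
  have Xeval: "peval (X g) x = (\<Sum>i\<in>UNIV. v i * peval (td i g) x)" for g
    unfolding X_def by (simp add: peval_psum[OF ns(1)] ns(2) V)
  have Xover: "X g \<in> pover C UNIV" if "g \<in> pover C UNIV" for g
    unfolding X_def by (rule psum_over) (use V that C td_pover in auto)
  have td_lin: "\<exists>l. (\<forall>u. peval (pd u g) x = (\<Sum>a\<in>A. l a * peval (pd u (f a)) x)) \<and>
      (\<forall>i. peval (td i g) x = (\<Sum>a\<in>A. l a * ?B a i))"
    if g: "g \<in> pover C UNIV" "peval g x = 0" for g
  proof -
    obtain l where l: "\<And>u. peval (pd u g) x = (\<Sum>a\<in>A. l a * peval (pd u (f a)) x)"
      using gd[OF g] unfolding good_def by blast
    define U where "U = pvars g \<union> (\<Union>a\<in>A. pvars (f a))"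
    have U: "finite U" "pvars g \<subseteq> U" "\<And>a. a \<in> A \<Longrightarrow> pvars (f a) \<subseteq> U" using finA by (auto simp: U_def)
    have "peval (td i g) x = (\<Sum>a\<in>A. l a * ?B a i)" for i
    proof -
      have "peval (td i g) x = (\<Sum>u\<in>U. (\<Sum>a\<in>A. l a * peval (pd u (f a)) x) * peval (td i (Var u)) x)"
        unfolding td_sum[OF U(1,2)] l ..
      also have "\<dots> = (\<Sum>a\<in>A. l a * (\<Sum>u\<in>U. peval (pd u (f a)) x * peval (td i (Var u)) x))"
        unfolding sum_distrib_left sum_distrib_right by (subst sum.swap) (simp add: mult.assoc)
      also have "\<dots> = (\<Sum>a\<in>A. l a * ?B a i)"
        using td_sum[OF U(1) U(3)] by (intro sum.cong) auto
      finally show ?thesis .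
    qed
    then show ?thesis using l by blast
  qed
  have Xp: "peval (X g) x = 0" if g: "g \<in> pover C UNIV" "peval g x = 0" for g
  proof -
    obtain l where l: "\<And>i. peval (td i g) x = (\<Sum>a\<in>A. l a * ?B a i)" using td_lin[OF g] by blast
    have "peval (X g) x = (\<Sum>a\<in>A. l a * (\<Sum>i\<in>UNIV. v i * ?B a i))"
      unfolding Xeval l sum_distrib_left by (subst sum.swap) (simp add: algebra_simps)
    then show ?thesis using vA by simp
  qed
  define q where "q = {g \<in> pover C UNIV. peval g x = 0 \<and> (\<forall>i. peval (td i g) x = 0)}"
  have Xq: "X g \<in> q" if g: "g \<in> q" for g
  proof -
    have "peval (td l (X g)) x = 0" for l
    proof -
      have "peval (td l (X g)) x = (\<Sum>i\<in>UNIV. v i * peval (td i (td l g)) x)"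
        using g unfolding X_def by (simp add: td_psum[OF ns(1)] ns(2) V q_def td_commute[of l])
      also have "\<dots> = peval (X (td l g)) x" by (simp add: Xeval)
      also have "\<dots> = 0" using g C td_pover by (intro Xp) (auto simp: q_def)
      finally show ?thesis .
    qed
    then show ?thesis using g Xover Xp by (auto simp: q_def)
  qed
  obtain i0 where i0: "v i0 \<noteq> 0" using v(2) by auto
  \<comment> \<open>Downward induction on the order of the jet derivative. It starts above
    \<open>r\<close>, where the equations have no variables; the truncated subtraction reaches order
    0 at \<open>m = r + 1\<close>.\<close>
  have order: "\<forall>g\<in>q. \<forall>\<gamma> j. r + 1 - m \<le> sum \<gamma> UNIV \<longrightarrow> peval (pd (Inr (\<gamma>, j)) g) x = 0" for m
  proof (induction m)
    case 0
    show ?case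
    proof (intro ballI allI impI)
      fix g and \<gamma> :: "'n \<Rightarrow> nat" and j assume g: "g \<in> q" "r + 1 - 0 \<le> sum \<gamma> UNIV"
      obtain l where l: "\<And>u. peval (pd u g) x = (\<Sum>a\<in>A. l a * peval (pd u (f a)) x)"
        using td_lin[of g] g by (auto simp: q_def)
      have "peval (pd (Inr (\<gamma>, j)) (f a)) x = 0" if "a \<in> A" for a
        using ord[OF that, of \<gamma> j] g by (intro pd_notin) auto
      then show "peval (pd (Inr (\<gamma>, j)) g) x = 0" using l by simp
    qed
  next
    case (Suc m)
    show ?case
    proof (intro ballI allI impI)
      fix g and \<gamma> :: "'n \<Rightarrow> nat" and j assume g: "g \<in> q" and \<gamma>: "r + 1 - Suc m \<le> sum \<gamma> UNIV"
      let ?s = "r + 1 - Suc m"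
      show "peval (pd (Inr (\<gamma>, j)) g) x = 0"
      proof (cases "r + 1 - m \<le> sum \<gamma> UNIV")
        case True
        then show ?thesis using Suc g by blast
      next
        case False
        then have "sum \<gamma> UNIV = ?s" "r + 1 - m = Suc ?s" using \<gamma> by auto
        then show ?thesis
        \<comment> \<open>Within one order, multi-indices with a larger entry at \<open>i0\<close>
          come first. Raising \<open>\<beta>\<close> at \<open>i0\<close> and lowering it at another
          \<open>i\<close> gives such an index, so in the sum below only the term for
          \<open>i0\<close> survives, and \<open>v i0\<close> is nonzero.\<close>
        proof (induction "?s - \<gamma> i0" arbitrary: \<gamma> rule: less_induct)
          case (less \<beta>)
          define \<delta> where "\<delta> = \<beta>(i0 := \<beta> i0 + 1)"
          have sum_upd: "sum (\<beta>(i := c)) UNIV + \<beta> i = sum \<beta> UNIV + c" for i c and \<beta> :: "'n \<Rightarrow> nat"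
            by (simp add: sum.remove[of UNIV i])
          have s\<delta>: "sum \<delta> UNIV = Suc ?s" using sum_upd[of \<beta> i0 "\<beta> i0 + 1"] less.prems by (simp add: \<delta>_def)
          let ?t = "\<lambda>i. if 0 < \<delta> i then peval (pd (Inr (\<delta>(i := \<delta> i - 1), j)) g) x else 0"
          \<comment> \<open>The product rule also yields derivatives of \<open>V i\<close> times
            \<open>td i g\<close>; these vanish because \<open>g\<close> is in
            \<open>q\<close>.\<close>
          have pX: "peval (pd (Inr (\<delta>, j)) (X g)) x = (\<Sum>i\<in>UNIV. v i * peval (td i (pd (Inr (\<delta>, j)) g)) x) + (\<Sum>i\<in>UNIV. v i * ?t i)"
            using g unfolding X_def
            by (simp add: peval_psum[OF ns(1)] ns(2) V q_def pd_td sum.distrib[symmetric] algebra_simps)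
          have "peval (pd (Inr (\<delta>, j)) g) x = 0" using Suc g s\<delta> less.prems by auto
          then have "peval (X (pd (Inr (\<delta>, j)) g)) x = 0" using g C by (intro Xp pover_pd) (auto simp: q_def)
          moreover have "peval (pd (Inr (\<delta>, j)) (X g)) x = 0" using Suc Xq[OF g] s\<delta> less.prems by auto
          ultimately have "(\<Sum>i\<in>UNIV. v i * ?t i) = 0" using pX by (simp add: Xeval)
          moreover have "v i * ?t i = 0" if "i \<noteq> i0" for i
          proof (cases "0 < \<delta> i")
            case True
            let ?\<epsilon> = "\<delta>(i := \<delta> i - 1)"
            have s: "sum ?\<epsilon> UNIV = ?s" using sum_upd[of \<delta> i "\<delta> i - 1"] s\<delta> True by simp
            have e0: "?\<epsilon> i0 = \<beta> i0 + 1" using that by (simp add: \<delta>_def)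
            have "?\<epsilon> i0 \<le> ?s" using member_le_sum[of i0 UNIV ?\<epsilon>] s by simp
            then have "peval (pd (Inr (?\<epsilon>, j)) g) x = 0"
              using e0 s less.prems(2) by (intro less.hyps) auto
            then show ?thesis by simp
          qed simp
          ultimately have "v i0 * ?t i0 = 0"
            by (subst (asm) sum.remove[of _ i0]) auto
          moreover have "\<delta>(i0 := \<delta> i0 - 1) = \<beta>" "0 < \<delta> i0" by (auto simp: \<delta>_def)
          ultimately show ?case using i0 by simp
        qed
      qed
    qed
  qed
  define g where "g = psum (\<lambda>a. Mul (E a) (f a)) as"
  have gq: "g \<in> q" and gpd: "\<And>u. peval (pd u g) x = (\<Sum>a\<in>A. \<eta> a * peval (pd u (f a)) x)"
  proof -
    have "g \<in> pover C UNIV" unfolding g_def using C E fP as by (intro psum_over) auto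
    then show "g \<in> q" unfolding q_def g_def using \<eta>(3) fP
      by (auto simp: peval_psum[OF as(1)] td_psum[OF as(1)] as(2) E)
    show "peval (pd u g) x = (\<Sum>a\<in>A. \<eta> a * peval (pd u (f a)) x)" for u
      unfolding g_def using fP by (simp add: peval_psum[OF as(1)] as(2) E)
  qed
  have z: "peval (pd (Inr \<gamma>j) g) x = 0" for \<gamma>j
    using order[of "r + 1"] gq by (cases \<gamma>j) auto
  have "peval (pd u g) x = 0" for u
  proof (cases u)
    case (Inl l)
    define U where "U = insert (Inl l) (pvars g)"
    \<comment> \<open>Once all jet derivatives are zero, the total derivative in direction
      \<open>l\<close> reduces to the derivative in the base coordinate, and it vanishes since
      \<open>g\<close> is in \<open>q\<close>.\<close>
    have "peval (td l g) x = (\<Sum>u\<in>U. peval (pd u g) x * peval (td l (Var u)) x)"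
      by (rule td_sum) (auto simp: U_def)
    also have "\<dots> = (\<Sum>u\<in>U. if u = Inl l then peval (pd (Inl l) g) x else 0)"
      by (intro sum.cong) (auto simp: z split: sum.splits)
    also have "\<dots> = peval (pd (Inl l) g) x" by (simp add: U_def)
    finally show ?thesis using gq Inl by (simp add: q_def)
  qed (use z in auto)
  then have "\<forall>a\<in>A. \<eta> a = 0" using gpd by (intro indep) auto
  then show False using \<eta>(2) by auto
qed

section \<open>Semialgebraic sets at a generic point\<close>

text \<open>Each expression that is not identically zero in \<open>v\<close> excludes finitely many
  values, there are countably many expressions, and an interval is uncountable.\<close>

lemma generic_exists:
  fixes P :: "'v::countable set"
  assumes C: "countable C" "0 \<in> C" "1 \<in> C" and v: "v \<notin> P" and ab: "a < b"
  shows "\<exists>z. a < z \<and> z < b \<and> (\<forall>g\<in>pover C (insert v P). peval g (x(v := z)) = 0 \<longrightarrow> (\<forall>z'. peval g (x(v := z')) = 0))"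
proof -
  define G where "G = {g \<in> pover C (insert v P). \<exists>z'. peval g (x(v := z')) \<noteq> 0}"
  have "countable (pover C (insert v P))"
    using countable_pex_over[OF C(1)] by (rule countable_subset[rotated]) (auto simp: pover_def)
  then have "countable G" by (rule countable_subset[rotated]) (auto simp: G_def)
  have "countable {z. peval g (x(v := z)) = 0}" if g: "g \<in> G" for g
  proof -
    obtain cs where cs: "set cs \<subseteq> pover C P" "\<And>x. peval g x = peval (plist v cs) x"
      using plist_exists[of C g v P] C g by (auto simp: G_def)
    define p where "p = Poly (map (\<lambda>c. peval c x) cs)"
    have p: "peval g (x(v := z)) = poly p z" for z
      unfolding p_def cs(2) by (rule peval_plist_Poly[OF v cs(1)])
    then have "p \<noteq> 0" using g by (auto simp: G_def)
    then show ?thesis unfolding p using poly_roots_finite countable_finite by blast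
  qed
  then have "countable (\<Union>g\<in>G. {z. peval g (x(v := z)) = 0})"
    using \<open>countable G\<close> by (intro countable_UN) auto
  then have "\<not> {a<..<b} \<subseteq> (\<Union>g\<in>G. {z. peval g (x(v := z)) = 0})"
    using uncountable_open_interval[of a b] ab countable_subset by blast
  then obtain z where z: "z \<in> {a<..<b}" "z \<notin> (\<Union>g\<in>G. {z. peval g (x(v := z)) = 0})"
    by (meson subsetI)
  from z(1) have "a < z" "z < b" by simp_all
  moreover have "\<forall>g\<in>G. peval g (x(v := z)) \<noteq> 0" using z(2) by blast
  ultimately show ?thesis unfolding G_def by (intro exI[of _ z]) blast
qed

lemma free_at_generic:
  assumes "\<forall>g\<in>pover C (insert v P). peval g (x(v := z)) = 0 \<longrightarrow> (\<forall>z'. peval g (x(v := z')) = 0)"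
  shows "free_at C (x(v := z)) P v"
  unfolding free_at_def
proof (intro ballI impI)
  fix g assume g: "g \<in> pover C (insert v P)" "peval g (x(v := z)) = 0"
  then have 0: "(\<lambda>z'. peval g (x(v := z'))) = (\<lambda>_. 0)" using assms by auto
  then show "peval (pd v g) (x(v := z)) = 0"
    using DERIV_unique[OF pd_has_derivative[of g x v z]] by (simp add: DERIV_const)
qed

lemma free_at_cong:
  assumes "\<And>u. u \<in> insert v P \<Longrightarrow> x u = y u"
  shows "free_at C x P v \<longleftrightarrow> free_at C y P v"
proof -
  have "peval g x = peval g y \<and> peval (pd v g) x = peval (pd v g) y" if "g \<in> pover C (insert v P)" for g
    using that pvars_pd[of v g] assms by (intro conjI peval_cong) (auto simp: pover_def)
  then show ?thesis unfolding free_at_def by auto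
qed

text \<open>The coordinates are moved one after the other inside the box. A later move does not
  disturb earlier freeness, which concerns only the coordinates up to that position.\<close>

lemma generic_on_list:
  fixes vs :: "'v::countable list"
  assumes C: "countable C" "0 \<in> C" "1 \<in> C" and "distinct vs" "e > 0"
  shows "\<exists>y. (\<forall>v\<in>set vs. \<bar>y v - x v\<bar> < e) \<and> (\<forall>k<length vs. free_at C y (set (take k vs)) (vs ! k))"
  using assms(4)
proof (induction vs rule: rev_induct)
  case Nil
  then show ?case by auto
next
  case (snoc v vs)
  then obtain y where y: "\<forall>v\<in>set vs. \<bar>y v - x v\<bar> < e" "\<forall>k<length vs. free_at C y (set (take k vs)) (vs ! k)"
    by auto
  have v: "v \<notin> set vs" using snoc.prems by auto
  obtain z where z: "x v - e < z" "z < x v + e"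
    "\<forall>g\<in>pover C (insert v (set vs)). peval g (y(v := z)) = 0 \<longrightarrow> (\<forall>z'. peval g (y(v := z')) = 0)"
    using generic_exists[OF C v, of "x v - e" "x v + e" y] assms(5) by auto
  have "free_at C (y(v := z)) (set (take k (vs @ [v]))) ((vs @ [v]) ! k)" if "k < length (vs @ [v])" for k
  proof (cases "k = length vs")
    case True
    then show ?thesis using free_at_generic[OF z(3)] by simp
  next
    case False
    then have k: "k < length vs" using that by simp
    then have "free_at C y (set (take k vs)) (vs ! k)" using y by auto
    moreover have "y u = (y(v := z)) u" if "u \<in> insert (vs ! k) (set (take k vs))" for u
    proof -
      have "u \<in> set vs" using that k in_set_takeD by fastforce
      then show ?thesis using v by auto
    qed
    ultimately have "free_at C (y(v := z)) (set (take k vs)) (vs ! k)"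
      using free_at_cong[of "vs ! k" "set (take k vs)" y "y(v := z)" C] by blast
    then show ?thesis using k by (simp add: nth_append)
  qed
  moreover have "\<forall>w\<in>set (vs @ [v]). \<bar>(y(v := z)) w - x w\<bar> < e" using y(1) z v by auto
  ultimately show ?case by blast
qed

text \<open>Fills all coordinates outside \<open>V\<close> generically along the enumeration of the
  variables; for jets these are the derivatives of order above \<open>r\<close>. Variables met
  before, or lying in \<open>V\<close>, are left alone.\<close>

lemma generic_extension:
  fixes V :: "'v::countable set"
  assumes C: "countable C" "0 \<in> C" "1 \<in> C"
  obtains y where "\<And>v. v \<in> V \<Longrightarrow> y v = x v"
    "\<And>k. from_nat k \<notin> V \<union> from_nat ` {..<k} \<Longrightarrow> free_at C y (V \<union> from_nat ` {..<k}) (from_nat k)"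
proof -
  define P where "P k = V \<union> (from_nat ` {..<k} :: 'v set)" for k
  define good where "good k x z \<longleftrightarrow> (\<forall>g\<in>pover C (insert (from_nat k) (P k)).
      peval g (x(from_nat k := z)) = 0 \<longrightarrow> (\<forall>z'. peval g (x(from_nat k := z')) = 0))" for k x z
  define X where "X = rec_nat x (\<lambda>k y. if from_nat k \<in> P k then y else y(from_nat k := (SOME z. good k y z)))"
  have X0: "X 0 = x" and XS: "X (Suc k) = (if from_nat k \<in> P k then X k else (X k)(from_nat k := (SOME z. good k (X k) z)))" for k
    by (simp_all add: X_def)
  have stab: "X (k + j) u = X k u" if "u \<in> P k" for k j u
  proof (induction j)
    case (Suc j)
    have "P k \<subseteq> P (k + j)" by (auto simp: P_def)
    then have "u \<in> P (k + j)" using that by auto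
    then show ?case using Suc by (auto simp: XS)
  qed simp
  have stab': "X j u = X k u" if "u \<in> P k" "u \<in> P j" for k j u
    using stab[OF that(1), of "j - k"] stab[OF that(2), of "k - j"] by (cases "k \<le> j") auto
  \<comment> \<open>Stage \<open>Suc (to_nat u)\<close> is the first at which \<open>u\<close> is
    certain to have its final value.\<close>
  define y where "y u = X (Suc (to_nat u)) u" for u
  have inP: "u \<in> P (Suc (to_nat u))" for u
    unfolding P_def by (rule UnI2, rule image_eqI[of _ _ "to_nat u"]) auto
  have yX: "y u = X k u" if "u \<in> P k" for u k
    unfolding y_def using stab'[OF that inP] .
  show thesis
  proof (rule that)
    show "y v = x v" if "v \<in> V" for v using yX[of v 0] that by (simp add: P_def X0)
    fix k assume "from_nat k \<notin> V \<union> (from_nat ` {..<k} :: 'v set)"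
    then have n: "from_nat k \<notin> P k" by (simp add: P_def)
    have "\<exists>z. good k (X k) z"
      unfolding good_def using generic_exists[OF C n, of 0 1 "X k"] by auto
    then have "good k (X k) (SOME z. good k (X k) z)" by (rule someI_ex)
    then have "free_at C ((X k)(from_nat k := (SOME z. good k (X k) z))) (P k) (from_nat k)"
      unfolding good_def by (rule free_at_generic)
    then have "free_at C (X (Suc k)) (P k) (from_nat k)"
      using n by (simp add: XS del: fun_upd_apply)
    moreover have "X (Suc k) u = y u" if "u \<in> insert (from_nat k) (P k)" for u
      using that by (intro yX[symmetric]) (auto simp: P_def)
    ultimately have "free_at C y (P k) (from_nat k)"
      using free_at_cong[of "from_nat k" "P k" "X (Suc k)" y C] by blast
    then show "free_at C y (V \<union> from_nat ` {..<k}) (from_nat k)" by (simp add: P_def)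
  qed
qed

lemma mpoly_eval_pex:
  assumes "finite V"
  shows "\<exists>C e. finite C \<and> e \<in> pover (C \<union> {0, 1}) V \<and> (\<forall>x. peval e x = mpoly_eval V ps x)"
proof (induction ps)
  case Nil
  show ?case by (intro exI[of _ "{}"] exI[of _ "Cst 0"]) (auto simp: mpoly_eval_def)
next
  case (Cons m ps)
  then obtain C e where e: "finite C" "e \<in> pover (C \<union> {0, 1}) V" "\<And>x. peval e x = mpoly_eval V ps x" by auto
  obtain a \<alpha> where m: "m = (a, \<alpha>)" by (cases m)
  have pw: "\<exists>e. e \<in> pover {0, 1} V \<and> (\<forall>x. peval e x = x v ^ k)" if "v \<in> V" for v k
  proof (induction k)
    case 0
    show ?case by (intro exI[of _ "Cst 1"]) auto
  next
    case (Suc k)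
    then obtain e where "e \<in> pover {0, 1} V" "\<forall>x. peval e x = x v ^ k" by auto
    then show ?case using that by (intro exI[of _ "Mul (Var v) e"]) auto
  qed
  have "\<exists>e. e \<in> pover {0, 1} V \<and> (\<forall>x. peval e x = (\<Prod>v\<in>V'. x v ^ \<alpha> v))" if "V' \<subseteq> V" for V'
    using finite_subset[OF that assms] that
  proof (induction V' rule: finite_induct)
    case empty
    show ?case by (intro exI[of _ "Cst 1"]) auto
  next
    case (insert v V')
    then obtain e e' where "e \<in> pover {0, 1} V" "\<forall>x. peval e x = (\<Prod>v\<in>V'. x v ^ \<alpha> v)"
      "e' \<in> pover {0, 1} V" "\<forall>x. peval e' x = x v ^ \<alpha> v" using pw[of v "\<alpha> v"] by auto
    then show ?case using insert by (intro exI[of _ "Mul e' e"]) auto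
  qed
  from this[of V] obtain e' where e': "e' \<in> pover {0, 1} V" "\<And>x. peval e' x = (\<Prod>v\<in>V. x v ^ \<alpha> v)" by auto
  show ?case
  proof (intro exI conjI allI)
    show "finite (insert a C)" using e by simp
    show "Add (Mul (Cst a) e') e \<in> pover (insert a C \<union> {0, 1}) V"
      using e e' by (auto simp: pover_def)
    show "peval (Add (Mul (Cst a) e') e) x = mpoly_eval V (m # ps) x" for x
      using e e' by (simp add: mpoly_eval_def m)
  qed
qed

section \<open>Semialgebraic conditions near a generic point\<close>

definition proj_to :: "'v set \<Rightarrow> ('v \<Rightarrow> real) \<Rightarrow> 'v \<Rightarrow> real" where
  "proj_to V x = (\<lambda>u. if u \<in> V then x u else 0)"

lemma proj_to_coord_space [simp]: "proj_to V x \<in> coord_space V"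
  by (auto simp: proj_to_def coord_space_def)

lemma peval_proj_to: "e \<in> pover C V \<Longrightarrow> peval e (proj_to V x) = peval e x"
  by (rule peval_cong) (auto simp: pover_def proj_to_def)

definition near_on :: "'v set \<Rightarrow> 'v set \<Rightarrow> ('v \<Rightarrow> (real, 'v) pex) \<Rightarrow> ('v \<Rightarrow> real) \<Rightarrow> (('v \<Rightarrow> real) \<Rightarrow> bool) \<Rightarrow> bool" where
  "near_on V A f x R \<longleftrightarrow> (\<exists>\<epsilon>>0. \<forall>y\<in>coord_space V. (\<forall>u\<in>V. \<bar>y u - x u\<bar> < \<epsilon>) \<longrightarrow> (\<forall>a\<in>A. peval (f a) y = 0) \<longrightarrow> R y)"

lemma near_on_mono: "near_on V A f x R \<Longrightarrow> (\<And>y. y \<in> coord_space V \<Longrightarrow> R y \<Longrightarrow> R' y) \<Longrightarrow> near_on V A f x R'"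
  unfolding near_on_def by meson

lemma near_on_conj:
  assumes "near_on V A f x R" "near_on V A f x R'"
  shows "near_on V A f x (\<lambda>y. R y \<and> R' y)"
proof -
  obtain e1 where e1: "e1 > 0" "\<forall>y\<in>coord_space V. (\<forall>u\<in>V. \<bar>y u - x u\<bar> < e1) \<longrightarrow> (\<forall>a\<in>A. peval (f a) y = 0) \<longrightarrow> R y"
    using assms(1) unfolding near_on_def by blast
  obtain e2 where e2: "e2 > 0" "\<forall>y\<in>coord_space V. (\<forall>u\<in>V. \<bar>y u - x u\<bar> < e2) \<longrightarrow> (\<forall>a\<in>A. peval (f a) y = 0) \<longrightarrow> R' y"
    using assms(2) unfolding near_on_def by blast
  show ?thesis unfolding near_on_def using e1 e2 by (intro exI[of _ "min e1 e2"]) auto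
qed

text \<open>Stated as an equivalence of memberships rather than an inclusion, so that complements
  come for free in the induction over semialgebraic sets.\<close>

definition locally_decided :: "real set \<Rightarrow> 'v set \<Rightarrow> ('v \<Rightarrow> real) set \<Rightarrow> bool" where
  "locally_decided C V S \<longleftrightarrow> (\<forall>A x f. triangular C x UNIV A f \<longrightarrow> (\<forall>a\<in>A. pvars (f a) \<subseteq> V) \<longrightarrow>
     near_on V A f x (\<lambda>y. y \<in> S \<longleftrightarrow> proj_to V x \<in> S))"

lemma semialgebraic_subset: "semialgebraic V S \<Longrightarrow> S \<subseteq> coord_space V"
  by (induction rule: semialgebraic.induct) auto

text \<open>A polynomial that is nonzero at \<open>x\<close> keeps its sign by continuity; one that
  vanishes there is a consequence of the triangular system and vanishes on its zero set
  nearby.\<close>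

lemma sign_locally_decided:
  assumes T: "triangular C x UNIV A f" and f: "\<forall>a\<in>A. pvars (f a) \<subseteq> V" and e: "e \<in> pover C V"
  shows "near_on V A f x (\<lambda>y. sgn (peval e y) = sgn (peval e (proj_to V x)))"
proof (cases "peval e x = 0")
  case True
  then have "good A f x e" using T pover_mono[OF subset_UNIV e] unfolding triangular_def by blast
  then obtain \<epsilon> where \<epsilon>: "\<epsilon> > 0" "\<And>y. (\<forall>u. \<bar>y u - x u\<bar> < \<epsilon>) \<Longrightarrow> (\<forall>a\<in>A. peval (f a) y = 0) \<Longrightarrow> peval e y = 0"
    unfolding good_def by blast
  have "peval e y = 0" if y: "\<forall>u\<in>V. \<bar>y u - x u\<bar> < \<epsilon>" "\<forall>a\<in>A. peval (f a) y = 0" for y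
  proof -
    \<comment> \<open>\<open>good\<close> demands closeness in all coordinates, but only those in
      \<open>V\<close> are controlled; the others are reset to \<open>x\<close>, which no expression
      over \<open>V\<close> notices.\<close>
    define y' where "y' u = (if u \<in> V then y u else x u)" for u
    have "peval g y' = peval g y" if "pvars g \<subseteq> V" for g
      using that by (intro peval_cong) (auto simp: y'_def)
    then have "peval (f a) y' = 0" if "a \<in> A" for a using that f y by auto
    moreover have "\<bar>y' u - x u\<bar> < \<epsilon>" for u using y \<epsilon>(1) by (auto simp: y'_def)
    ultimately have "peval e y' = 0" using \<epsilon>(2)[of y'] by auto
    then show ?thesis using \<open>\<And>g. pvars g \<subseteq> V \<Longrightarrow> peval g y' = peval g y\<close>[of e] e by (auto simp: pover_def)
  qed
  then show ?thesis unfolding near_on_def using \<epsilon>(1) True by (intro exI[of _ \<epsilon>]) (auto simp: peval_proj_to[OF e])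
next
  case False
  then obtain \<delta> where \<delta>: "\<delta> > 0" "\<And>y. (\<forall>u\<in>pvars e. \<bar>y u - x u\<bar> < \<delta>) \<Longrightarrow> \<bar>peval e y - peval e x\<bar> < \<bar>peval e x\<bar>"
    using peval_near[of "\<bar>peval e x\<bar>" e x] by auto
  have "sgn (peval e y) = sgn (peval e x)" if "\<forall>u\<in>V. \<bar>y u - x u\<bar> < \<delta>" for y
  proof -
    have "\<bar>peval e y - peval e x\<bar> < \<bar>peval e x\<bar>" using \<delta>(2)[of y] that e by (auto simp: pover_def)
    then show ?thesis by (auto simp: sgn_if split: if_splits)
  qed
  then show ?thesis unfolding near_on_def peval_proj_to[OF e] using \<delta>(1) by blast
qed

lemma semialgebraic_locally_decided:
  assumes "semialgebraic V S" "finite V"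
  shows "\<exists>C0. finite C0 \<and> (\<forall>C. C0 \<union> {0, 1} \<subseteq> C \<longrightarrow> locally_decided C V S)"
proof -
  have basic: "\<exists>C0. finite C0 \<and> (\<forall>C. C0 \<union> {0, 1} \<subseteq> C \<longrightarrow> locally_decided C V {x \<in> coord_space V. R (sgn (mpoly_eval V P x))})"
    for P and R :: "real \<Rightarrow> bool"
  proof -
    obtain C e where e: "finite C" "e \<in> pover (C \<union> {0, 1}) V" "\<And>x. peval e x = mpoly_eval V P x"
      using mpoly_eval_pex[OF assms(2), of P] by blast
    have "locally_decided C' V {x \<in> coord_space V. R (sgn (mpoly_eval V P x))}" if "C \<union> {0, 1} \<subseteq> C'" for C'
      unfolding locally_decided_def
    proof (intro allI impI)
      fix A x f assume T: "triangular C' x UNIV A f" "\<forall>a\<in>A. pvars (f a) \<subseteq> V"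
      have "e \<in> pover C' V" using e that by (auto simp: pover_def)
      from sign_locally_decided[OF T this]
      show "near_on V A f x (\<lambda>y. (y \<in> {x \<in> coord_space V. R (sgn (mpoly_eval V P x))}) =
          (proj_to V x \<in> {x \<in> coord_space V. R (sgn (mpoly_eval V P x))}))"
        unfolding e(3) by (rule near_on_mono) simp
    qed
    then show ?thesis using e(1) by blast
  qed
  show ?thesis
    using assms(1)
  proof (induction rule: semialgebraic.induct)
    case (pos P)
    show ?case using basic[of "\<lambda>s. 0 < s" P] by (simp add: sgn_greater)
  next
    case (zero P)
    show ?case using basic[of "\<lambda>s. s = 0" P] by (simp add: sgn_0_0)
  next
    case (union S1 S2)
    then obtain C1 C2 where c: "finite C1" "\<And>C. C1 \<union> {0, 1} \<subseteq> C \<Longrightarrow> locally_decided C V S1"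
        "finite C2" "\<And>C. C2 \<union> {0, 1} \<subseteq> C \<Longrightarrow> locally_decided C V S2" by blast
    have "locally_decided C V (S1 \<union> S2)" if "C1 \<union> C2 \<union> {0, 1} \<subseteq> C" for C
      unfolding locally_decided_def
    proof (intro allI impI)
      fix A x f assume T: "triangular C x UNIV A f" "\<forall>a\<in>A. pvars (f a) \<subseteq> V"
      have "locally_decided C V S1" "locally_decided C V S2" using c that by auto
      then have "near_on V A f x (\<lambda>y. (y \<in> S1 \<longleftrightarrow> proj_to V x \<in> S1) \<and> (y \<in> S2 \<longleftrightarrow> proj_to V x \<in> S2))"
        using T unfolding locally_decided_def by (intro near_on_conj) blast+
      then show "near_on V A f x (\<lambda>y. (y \<in> S1 \<union> S2) = (proj_to V x \<in> S1 \<union> S2))"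
        by (rule near_on_mono) auto
    qed
    then show ?case using c by (intro exI[of _ "C1 \<union> C2"]) auto
  next
    case (compl S)
    then obtain C0 where c: "finite C0" "\<And>C. C0 \<union> {0, 1} \<subseteq> C \<Longrightarrow> locally_decided C V S" by blast
    have "locally_decided C V (coord_space V - S)" if "C0 \<union> {0, 1} \<subseteq> C" for C
      using c(2)[OF that] unfolding locally_decided_def near_on_def by (simp add: Ball_def)
    then show ?case using c by blast
  qed
qed

text \<open>The coordinates in \<open>I\<close> can be moved freely and are made generic; each
  further coordinate in \<open>V\<close> costs at most one equation, which bounds the system by the
  codimension. Coordinates outside \<open>V\<close> are generic again and cost nothing, so the
  system controls all expressions over \<open>C\<close>.\<close>

theorem generic_point_equations:
  fixes V :: "'v::countable set"
  assumes fin: "finite V" and S: "semialgebraic V S" and I: "I \<subseteq> V" and proj: "proj_has_interior I S"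
  obtains C x A f \<epsilon> where "0 \<in> C" "1 \<in> C" "-1 \<in> C" "triangular C x UNIV A f" "A \<subseteq> V - I"
    "\<And>a. a \<in> A \<Longrightarrow> pvars (f a) \<subseteq> V" "\<epsilon> > 0"
    "\<And>y. y \<in> coord_space V \<Longrightarrow> (\<forall>u\<in>V. \<bar>y u - x u\<bar> < \<epsilon>) \<Longrightarrow> (\<forall>a\<in>A. peval (f a) y = 0) \<Longrightarrow> y \<in> S"
proof -
  obtain C0 where C0: "finite C0" "\<And>C. C0 \<union> {0, 1} \<subseteq> C \<Longrightarrow> locally_decided C V S"
    using semialgebraic_locally_decided[OF S fin] by blast
  define C where "C = C0 \<union> {0, 1, -1}"
  have C: "countable C" "0 \<in> C" "1 \<in> C" "-1 \<in> C" using C0 by (auto simp: C_def countable_finite)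
  obtain ivs where ivs': "distinct ivs" "set ivs = I"
    using finite_distinct_list[OF finite_subset[OF I fin]] by blast
  obtain x0 e where x0: "e > 0" "\<And>y. (\<forall>i\<in>I. \<bar>y i - x0 i\<bar> < e) \<Longrightarrow> \<exists>z\<in>S. \<forall>i\<in>I. z i = y i"
    using proj unfolding proj_has_interior_def by blast
  obtain y where y: "\<forall>v\<in>set ivs. \<bar>y v - x0 v\<bar> < e" "\<forall>k<length ivs. free_at C y (set (take k ivs)) (ivs ! k)"
    using generic_on_list[OF C(1-3) ivs'(1) x0(1), of x0] by blast
  \<comment> \<open>The coordinates in \<open>V - I\<close> come with this point of \<open>S\<close>
    and cannot be chosen; relations among them are what the equations record.\<close>
  obtain z where z: "z \<in> S" "\<forall>i\<in>I. z i = y i" using x0(2)[of y] y ivs' by auto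
  obtain x where x: "\<And>v. v \<in> V \<Longrightarrow> x v = z v"
    "\<And>k. from_nat k \<notin> V \<union> from_nat ` {..<k} \<Longrightarrow> free_at C x (V \<union> from_nat ` {..<k}) (from_nat k)"
    using generic_extension[OF C(1-3), of V z] by blast
  have "triangular C x (set (take k ivs)) {} undefined" if "k \<le> length ivs" for k
    using that
  proof (induction k)
    case 0
    then show ?case by (simp add: triangular_empty)
  next
    case (Suc k)
    have k: "k < length ivs" using Suc by simp
    have "free_at C y (set (take k ivs)) (ivs ! k)" using y k by auto
    moreover have "y u = x u" if "u \<in> insert (ivs ! k) (set (take k ivs))" for u
    proof -
      have "u \<in> I" using that k ivs' in_set_takeD by fastforce
      then show ?thesis using z x(1) I by auto
    qed
    ultimately have "free_at C x (set (take k ivs)) (ivs ! k)"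
      using free_at_cong[of "ivs ! k" "set (take k ivs)" y x C] by blast
    moreover have "ivs ! k \<notin> set (take k ivs)" using ivs'(1) k
      by (metis distinct_take id_take_nth_drop not_distinct_conv_prefix take_Suc_conv_app_nth)
    ultimately have "triangular C x (insert (ivs ! k) (set (take k ivs))) {} undefined"
      using Suc C by (intro triangular_free) auto
    then show ?case using k by (simp add: take_Suc_conv_app_nth)
  qed
  from this[of "length ivs"] have TI: "triangular C x I {} undefined" using ivs' by simp
  have "\<exists>A f. A \<subseteq> B \<and> triangular C x (I \<union> B) A f" if "B \<subseteq> V - I" for B
    using finite_subset[OF that finite_Diff[OF fin]] that
  proof (induction B rule: finite_induct)
    case empty
    then show ?case using TI by auto
  next
    case (insert v B)
    then obtain A f where A: "A \<subseteq> B" "triangular C x (I \<union> B) A f" by auto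
    have v: "v \<notin> I \<union> B" using insert by auto
    show ?case
    proof (cases "free_at C x (I \<union> B) v")
      case True
      then show ?thesis using triangular_free[OF A(2) C(2,3) v] A(1) by auto
    next
      case False
      then obtain h where "triangular C x (insert v (I \<union> B)) (insert v A) (f(v := h))"
        using triangular_alg[OF A(2) C(2-4) v] by blast
      then show ?thesis using A(1) by (intro exI[of _ "insert v A"]) auto
    qed
  qed
  from this[of "V - I"] obtain A f where A: "A \<subseteq> V - I" "triangular C x V A f"
    using I by (auto simp: Un_absorb1)
  have Tk: "triangular C x (V \<union> from_nat ` {..<k}) A f" for k
  proof (induction k)
    case 0
    then show ?case using A by simp
  next
    case (Suc k)
    have eq: "V \<union> from_nat ` {..<Suc k} = insert (from_nat k) (V \<union> (from_nat ` {..<k} :: 'v set))"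
      by (auto simp: lessThan_Suc)
    show ?case
    proof (cases "from_nat k \<in> V \<union> (from_nat ` {..<k} :: 'v set)")
      case True
      then show ?thesis using Suc eq by (simp add: insert_absorb)
    next
      case False
      then show ?thesis unfolding eq using Suc C x(2) by (intro triangular_free) auto
    qed
  qed
  have fA: "pvars (f a) \<subseteq> V" if "a \<in> A" for a
    using A(2) that unfolding triangular_def pover_def by blast
  have gd: "good A f x g" if g: "g \<in> pover C UNIV" "peval g x = 0" for g
  proof -
    \<comment> \<open>An expression has finitely many variables, so some finite stage of the
      enumeration already covers it.\<close>
    obtain k where "to_nat ` pvars g \<subseteq> {..<k}"
      using finite_nat_iff_bounded[of "to_nat ` pvars g"] by auto
    then have "pvars g \<subseteq> from_nat ` {..<k}"
      by (metis (no_types, lifting) from_nat_to_nat image_subset_iff image_iff subset_iff)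
    then have "g \<in> pover C (V \<union> from_nat ` {..<k})" using g by (auto simp: pover_def)
    then show ?thesis using Tk[of k] g(2) unfolding triangular_def by blast
  qed
  have T: "triangular C x UNIV A f"
    using A(2) gd pover_mono[OF subset_UNIV] unfolding triangular_def by blast
  have pz: "proj_to V x = z"
    using semialgebraic_subset[OF S] z x(1) by (auto simp: proj_to_def coord_space_def fun_eq_iff)
  have "locally_decided C V S" by (rule C0(2)) (auto simp: C_def)
  then have "\<exists>\<epsilon>>0. \<forall>y\<in>coord_space V. (\<forall>u\<in>V. \<bar>y u - x u\<bar> < \<epsilon>) \<longrightarrow> (\<forall>a\<in>A. peval (f a) y = 0) \<longrightarrow>
      (y \<in> S \<longleftrightarrow> proj_to V x \<in> S)"
    using T fA unfolding locally_decided_def near_on_def by (elim allE[of _ A] allE[of _ x] allE[of _ f]) simp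
  then obtain \<epsilon> where \<epsilon>: "\<epsilon> > 0" "\<forall>y\<in>coord_space V. (\<forall>u\<in>V. \<bar>y u - x u\<bar> < \<epsilon>) \<longrightarrow> (\<forall>a\<in>A. peval (f a) y = 0) \<longrightarrow>
      (y \<in> S \<longleftrightarrow> proj_to V x \<in> S)" by (elim exE conjE)
  show thesis
  proof (rule that[OF C(2-4) T A(1) fA \<epsilon>(1)])
    show "y \<in> S" if "y \<in> coord_space V" "\<forall>u\<in>V. \<bar>y u - x u\<bar> < \<epsilon>" "\<forall>a\<in>A. peval (f a) y = 0" for y
      using \<epsilon>(2) that z(1) pz by simp
  qed
qed

section \<open>Boxes that avoid the set, and dimension\<close>

definition box_around :: "'v set \<Rightarrow> ('v \<Rightarrow> real) \<Rightarrow> real \<Rightarrow> ('v \<Rightarrow> real) set" where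
  "box_around V b e = {y \<in> coord_space V. \<forall>v\<in>V. \<bar>y v - b v\<bar> < e}"

lemma box_around_sub:
  assumes "y \<in> box_around V b e" "finite V" "e' > 0"
  shows "\<exists>d>0. d \<le> e' \<and> box_around V y d \<subseteq> box_around V b e"
proof -
  have "\<exists>d>0. d \<le> e' \<and> (\<forall>v\<in>V. \<bar>y v - b v\<bar> + d \<le> e)"
  proof -
    have *: "\<And>v. v \<in> V \<Longrightarrow> \<bar>y v - b v\<bar> < e" using assms(1) by (auto simp: box_around_def)
    define d where "d = Min (insert e' ((\<lambda>v. e - \<bar>y v - b v\<bar>) ` V))"
    have "d > 0" unfolding d_def using assms(2,3) * by (subst Min_gr_iff) auto
    moreover have "d \<le> e'" unfolding d_def using assms(2) by (intro Min_le) auto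
    moreover have "d \<le> e - \<bar>y v - b v\<bar>" if "v \<in> V" for v unfolding d_def using assms(2) that by (intro Min_le) auto
    ultimately show ?thesis by (intro exI[of _ d]) fastforce
  qed
  then obtain d where d: "d > 0" "d \<le> e'" "\<And>v. v \<in> V \<Longrightarrow> \<bar>y v - b v\<bar> + d \<le> e" by auto
  have "box_around V y d \<subseteq> box_around V b e"
    using d(3) by (fastforce simp: box_around_def)
  then show ?thesis using d by blast
qed

lemma polynomial_sign_box:
  assumes V: "finite V" and y: "y \<in> box_around V b e" "mpoly_eval V P y \<noteq> 0"
  shows "\<exists>d>0. box_around V y d \<subseteq> box_around V b e \<and>
     (\<forall>z\<in>box_around V y d. sgn (mpoly_eval V P z) = sgn (mpoly_eval V P y))"
proof -
  obtain C p where p: "p \<in> pover (C \<union> {0, 1}) V" "\<And>x. peval p x = mpoly_eval V P x"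
    using mpoly_eval_pex[OF V, of P] by blast
  obtain \<delta> where \<delta>: "\<delta> > 0" "\<And>z. (\<forall>u\<in>pvars p. \<bar>z u - y u\<bar> < \<delta>) \<Longrightarrow> \<bar>peval p z - peval p y\<bar> < \<bar>peval p y\<bar>"
    using peval_near[of "\<bar>peval p y\<bar>" p y] y p by auto
  obtain d where d: "d > 0" "d \<le> \<delta>" "box_around V y d \<subseteq> box_around V b e"
    using box_around_sub[OF y(1) V \<delta>(1)] by auto
  have "sgn (mpoly_eval V P z) = sgn (mpoly_eval V P y)" if "z \<in> box_around V y d" for z
  proof -
    have "\<forall>u\<in>pvars p. \<bar>z u - y u\<bar> < \<delta>" using that d p by (fastforce simp: box_around_def pover_def)
    then have "\<bar>peval p z - peval p y\<bar> < \<bar>peval p y\<bar>" by (rule \<delta>(2))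
    then show ?thesis unfolding p(2) by (auto simp: sgn_if split: if_splits)
  qed
  then show ?thesis using d by blast
qed

text \<open>A strict sign holding at one point persists on a smaller box; if it holds nowhere, the
  given box already decides membership. Unions shrink twice, and the alternative is symmetric under
  complement.\<close>

lemma semialgebraic_box:
  assumes "semialgebraic V S" "finite V" "b \<in> coord_space V" "e > 0"
  shows "\<exists>b' e'. e' > 0 \<and> b' \<in> coord_space V \<and> box_around V b' e' \<subseteq> box_around V b e \<and>
           (box_around V b' e' \<subseteq> S \<or> box_around V b' e' \<inter> S = {})"
  using assms(1,3,4)
proof (induction arbitrary: b e rule: semialgebraic.induct)
  case (pos P)
  show ?case
  proof (cases "\<exists>y\<in>box_around V b e. 0 < mpoly_eval V P y")
    case True
    then obtain y where y: "y \<in> box_around V b e" "0 < mpoly_eval V P y" by auto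
    then obtain d where d: "d > 0" "box_around V y d \<subseteq> box_around V b e"
      "\<forall>z\<in>box_around V y d. sgn (mpoly_eval V P z) = sgn (mpoly_eval V P y)"
      using polynomial_sign_box[OF assms(2) y(1), of P] by auto
    then have "0 < mpoly_eval V P z" if "z \<in> box_around V y d" for z
      using that y(2) by (metis sgn_greater)
    then show ?thesis using d y by (intro exI[of _ y] exI[of _ d]) (auto simp: box_around_def)
  next
    case False
    then show ?thesis using pos by (intro exI[of _ b] exI[of _ e]) auto
  qed
next
  case (zero P)
  show ?case
  proof (cases "\<exists>y\<in>box_around V b e. mpoly_eval V P y \<noteq> 0")
    case True
    then obtain y where y: "y \<in> box_around V b e" "mpoly_eval V P y \<noteq> 0" by auto
    then obtain d where d: "d > 0" "box_around V y d \<subseteq> box_around V b e"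
      "\<forall>z\<in>box_around V y d. sgn (mpoly_eval V P z) = sgn (mpoly_eval V P y)"
      using polynomial_sign_box[OF assms(2) y] by auto
    then have "mpoly_eval V P z \<noteq> 0" if "z \<in> box_around V y d" for z
      using that y(2) by (metis sgn_0_0)
    then show ?thesis using d y by (intro exI[of _ y] exI[of _ d]) (auto simp: box_around_def)
  next
    case False
    then show ?thesis using zero by (intro exI[of _ b] exI[of _ e]) (auto simp: box_around_def)
  qed
next
  case (union S1 S2)
  obtain b1 e1 where 1: "e1 > 0" "b1 \<in> coord_space V" "box_around V b1 e1 \<subseteq> box_around V b e"
    "box_around V b1 e1 \<subseteq> S1 \<or> box_around V b1 e1 \<inter> S1 = {}"
    using union.IH(1)[OF union.prems] by blast
  obtain b2 e2 where 2: "e2 > 0" "b2 \<in> coord_space V" "box_around V b2 e2 \<subseteq> box_around V b1 e1"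
    "box_around V b2 e2 \<subseteq> S2 \<or> box_around V b2 e2 \<inter> S2 = {}"
    using union.IH(2)[OF 1(2,1)] by blast
  show ?case using 1 2 by (intro exI[of _ b2] exI[of _ e2]) blast
next
  case (compl S)
  obtain b1 e1 where 1: "e1 > 0" "b1 \<in> coord_space V" "box_around V b1 e1 \<subseteq> box_around V b e"
    "box_around V b1 e1 \<subseteq> S \<or> box_around V b1 e1 \<inter> S = {}"
    using compl.IH[OF compl.prems] by blast
  have "box_around V b1 e1 \<subseteq> coord_space V" by (auto simp: box_around_def)
  then show ?case using 1 by (intro exI[of _ b1] exI[of _ e1]) blast
qed

lemma finite_sa_dims: "finite V \<Longrightarrow> finite {card I | I. I \<subseteq> V \<and> proj_has_interior I S}"
  by (rule finite_subset[of _ "card ` Pow V"]) auto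

lemma sa_dim_ge: "finite V \<Longrightarrow> I \<subseteq> V \<Longrightarrow> proj_has_interior I S \<Longrightarrow> card I \<le> sa_dim V S"
  unfolding sa_dim_def by (intro Max_ge[OF finite_sa_dims]) auto

lemma sa_dim_witness:
  assumes "finite V" "S \<noteq> {}"
  shows "\<exists>I. I \<subseteq> V \<and> proj_has_interior I S \<and> sa_dim V S = card I"
proof -
  let ?M = "{card I | I. I \<subseteq> V \<and> proj_has_interior I S}"
  have "proj_has_interior {} S" using assms(2) by (auto simp: proj_has_interior_def intro!: exI[of _ 1])
  then have "card ({} :: 'a set) \<in> ?M" by blast
  then have "?M \<noteq> {}" by blast
  then have "sa_dim V S \<in> ?M" unfolding sa_dim_def by (rule Max_in[OF finite_sa_dims[OF assms(1)]])
  then show ?thesis by blast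
qed

text \<open>A box inside \<open>S\<close> would give \<open>S\<close> full dimension, so
  \<open>semialgebraic_box\<close> must return a disjoint one. Its centre becomes the jet near which
  the map stays on the boundary of \<open>K\<close>.\<close>

lemma positive_codim_box:
  assumes "finite V" "semialgebraic V S" "S \<noteq> {}" "sa_dim V S < card V"
  shows "\<exists>b\<in>coord_space V. \<exists>e>0. box_around V b e \<inter> S = {}"
proof -
  obtain b e where b: "e > 0" "b \<in> coord_space V" "box_around V b e \<subseteq> S \<or> box_around V b e \<inter> S = {}"
    using semialgebraic_box[OF assms(2,1), of "\<lambda>_. 0" 1] by (auto simp: coord_space_def)
  have "\<not> box_around V b e \<subseteq> S"
  proof (rule notI)
    assume sub: "box_around V b e \<subseteq> S"
    have "proj_has_interior V S"
      unfolding proj_has_interior_def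
    proof (rule bexI[of _ b], rule exI[of _ e], intro conjI allI impI)
      show "b \<in> S" using sub b by (auto simp: box_around_def)
      fix y assume "\<forall>i\<in>V. \<bar>y i - b i\<bar> < e"
      then have "\<forall>i\<in>V. proj_to V y i = y i" "proj_to V y \<in> S"
        using sub by (auto simp: box_around_def proj_to_def coord_space_def)
      then show "\<exists>z\<in>S. \<forall>i\<in>V. z i = y i" by blast
    qed (use b in auto)
    then show False using sa_dim_ge[OF assms(1), of V S] assms(4) by simp
  qed
  then show ?thesis using b by blast
qed

section \<open>Jets of smooth functions\<close>

text \<open>All functions that get differentiated lie in an algebra with explicit generators.
  Smoothness, continuity and commuting derivatives are checked on the generators and propagate by
  the product rule.\<close>

inductive_set alg :: "('a \<Rightarrow> real) set \<Rightarrow> ('a \<Rightarrow> real) set" for B where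
  gen: "b \<in> B \<Longrightarrow> b \<in> alg B"
| const: "(\<lambda>_. c) \<in> alg B"
| add: "f \<in> alg B \<Longrightarrow> g \<in> alg B \<Longrightarrow> (\<lambda>y. f y + g y) \<in> alg B"
| mul: "f \<in> alg B \<Longrightarrow> g \<in> alg B \<Longrightarrow> (\<lambda>y. f y * g y) \<in> alg B"

lemma alg_uminus: "f \<in> alg B \<Longrightarrow> (\<lambda>y. - f y) \<in> alg B"
  using alg.mul[OF alg.const[of "-1"], of f B] by simp

lemma alg_diff: "f \<in> alg B \<Longrightarrow> g \<in> alg B \<Longrightarrow> (\<lambda>y. f y - g y) \<in> alg B"
  using alg.add[OF _ alg_uminus, of f B g] by simp

lemma alg_power: "f \<in> alg B \<Longrightarrow> (\<lambda>y. f y ^ k) \<in> alg B"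
  by (induction k) (auto intro: alg.intros)

lemma alg_sum: "(\<And>i. i \<in> I \<Longrightarrow> f i \<in> alg B) \<Longrightarrow> (\<lambda>y. \<Sum>i\<in>I. f i y) \<in> alg B"
  by (induction I rule: infinite_finite_induct) (auto intro: alg.intros)

lemma alg_prod: "(\<And>i. i \<in> I \<Longrightarrow> f i \<in> alg B) \<Longrightarrow> (\<lambda>y. \<Prod>i\<in>I. f i y) \<in> alg B"
  by (induction I rule: infinite_finite_induct) (auto intro: alg.intros)

lemma alg_mono: "f \<in> alg B \<Longrightarrow> B \<subseteq> B' \<Longrightarrow> f \<in> alg B'"
  by (induction rule: alg.induct) (auto intro: alg.intros)

lemmas alg_intros = alg.intros(2-) alg_uminus alg_diff alg_power alg_sum alg_prod

section \<open>Partial derivatives inside such an algebra\<close>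

lemma partial_at_eq:
  assumes "(f has_derivative f') (at y)"
  shows "partial_at i f y = f' (axis i 1)"
proof -
  interpret bounded_linear f' using assms by (rule has_derivative_bounded_linear)
  have "((\<lambda>t. y + t *\<^sub>R axis i 1) has_derivative (\<lambda>t. t *\<^sub>R axis i 1)) (at 0)"
    by (auto intro!: derivative_eq_intros)
  moreover have "(f has_derivative f') (at (y + 0 *\<^sub>R axis i 1))" using assms by simp
  ultimately have "((\<lambda>t. f (y + t *\<^sub>R axis i 1)) has_derivative (\<lambda>t. f' (t *\<^sub>R axis i 1))) (at 0)"
    by (rule has_derivative_compose)
  then have "((\<lambda>t. f (y + t *\<^sub>R axis i 1)) has_real_derivative f' (axis i 1)) (at 0)"
    by (simp add: has_field_derivative_def scaleR mult_commute_abs)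
  then show ?thesis unfolding partial_at_def by (rule DERIV_imp_deriv)
qed

lemma partial_at_const [simp]: "partial_at i (\<lambda>_. c) = (\<lambda>_. 0)"
  by (rule ext) (simp add: partial_at_eq[OF has_derivative_const])

lemma partial_at_add:
  assumes "f differentiable (at y)" "g differentiable (at y)"
  shows "partial_at i (\<lambda>y. f y + g y) y = partial_at i f y + partial_at i g y"
  using assms unfolding differentiable_def
  by (auto simp: partial_at_eq partial_at_eq[OF has_derivative_add])

lemma partial_at_mult:
  assumes "f differentiable (at y)" "g differentiable (at y)"
  shows "partial_at i (\<lambda>y. f y * g y) y = partial_at i f y * g y + f y * partial_at i g y"
  using assms unfolding differentiable_def
  by (auto simp: partial_at_eq partial_at_eq[OF has_derivative_mult])

lemma partial_at_gradient:
  assumes "f differentiable (at y)"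
  shows "(f has_derivative (\<lambda>h. \<Sum>i\<in>UNIV. h $ i * partial_at i f y)) (at y)"
proof -
  obtain f' where f': "(f has_derivative f') (at y)" using assms by (auto simp: differentiable_def)
  interpret bounded_linear f' using f' by (rule has_derivative_bounded_linear)
  have "f' h = (\<Sum>i\<in>UNIV. h $ i * partial_at i f y)" for h
  proof -
    have "f' h = f' (\<Sum>i\<in>UNIV. h $ i *\<^sub>R axis i 1)" by (simp add: basis_expansion scalar_mult_eq_scaleR[symmetric])
    also have "\<dots> = (\<Sum>i\<in>UNIV. h $ i * partial_at i f y)" by (simp add: sum scaleR partial_at_eq[OF f'])
    finally show ?thesis .
  qed
  then have "f' = (\<lambda>h. \<Sum>i\<in>UNIV. h $ i * partial_at i f y)" by (rule ext)
  then show ?thesis using f' by simp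
qed

definition smooth_gens :: "(real^'n::finite \<Rightarrow> real) set \<Rightarrow> bool" where
  "smooth_gens B \<longleftrightarrow> (\<forall>b\<in>B. (\<forall>y. b differentiable (at y)) \<and> (\<forall>i. partial_at i b \<in> alg B))"

text \<open>Symmetry of second derivatives for the generators only;
  \<open>partial_at_commute\<close> extends it to the whole algebra.\<close>

definition commuting_gens :: "(real^'n::finite \<Rightarrow> real) set \<Rightarrow> bool" where
  "commuting_gens B \<longleftrightarrow> (\<forall>b\<in>B. \<forall>i j. partial_at i (partial_at j b) = partial_at j (partial_at i b))"

context
  fixes B :: "(real^'n::finite \<Rightarrow> real) set"
  assumes B: "smooth_gens B"
begin

lemma alg_differentiable: "f \<in> alg B \<Longrightarrow> f differentiable (at y)"
  by (induction rule: alg.induct) (use B in \<open>auto simp: smooth_gens_def\<close>)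

lemma alg_continuous: "f \<in> alg B \<Longrightarrow> continuous_on S f"
  by (intro continuous_at_imp_continuous_on ballI differentiable_imp_continuous_within alg_differentiable)

lemma partial_at_alg_add:
  "f \<in> alg B \<Longrightarrow> g \<in> alg B \<Longrightarrow> partial_at i (\<lambda>y. f y + g y) = (\<lambda>y. partial_at i f y + partial_at i g y)"
  by (rule ext) (simp add: partial_at_add alg_differentiable)

lemma partial_at_alg_mult:
  "f \<in> alg B \<Longrightarrow> g \<in> alg B \<Longrightarrow>
    partial_at i (\<lambda>y. f y * g y) = (\<lambda>y. partial_at i f y * g y + f y * partial_at i g y)"
  by (rule ext) (simp add: partial_at_mult alg_differentiable)

lemma partial_at_alg: "f \<in> alg B \<Longrightarrow> partial_at i f \<in> alg B"
proof (induction rule: alg.induct)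
  case (gen b)
  then show ?case using B by (auto simp: smooth_gens_def)
qed (auto simp: partial_at_alg_add partial_at_alg_mult intro: alg.intros)

lemma pderivs_alg: "f \<in> alg B \<Longrightarrow> pderivs is f \<in> alg B"
  by (induction "is") (auto intro: partial_at_alg)

lemma mpartial_alg: "f \<in> alg B \<Longrightarrow> mpartial \<beta> f \<in> alg B"
  unfolding mpartial_def by (rule pderivs_alg)

lemma pderivs_const_zero: "pderivs is (\<lambda>_. 0) = (\<lambda>_. 0)"
  by (induction "is") auto

lemma pderivs_add:
  "f \<in> alg B \<Longrightarrow> g \<in> alg B \<Longrightarrow> pderivs is (\<lambda>y. f y + g y) = (\<lambda>y. pderivs is f y + pderivs is g y)"
  by (induction "is") (auto simp: partial_at_alg_add pderivs_alg)

lemma pderivs_cmult: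
  "f \<in> alg B \<Longrightarrow> pderivs is (\<lambda>y. c * f y) = (\<lambda>y. c * pderivs is f y)"
proof (induction "is")
  case (Cons i "is")
  then show ?case
    using partial_at_alg_mult[OF alg.const[of c] pderivs_alg[OF Cons.prems], of i "is"] by simp
qed auto

lemma pderivs_sum:
  "(\<And>i. i \<in> I \<Longrightarrow> f i \<in> alg B) \<Longrightarrow> pderivs is (\<lambda>y. \<Sum>i\<in>I. f i y) = (\<lambda>y. \<Sum>i\<in>I. pderivs is (f i) y)"
proof (induction I rule: infinite_finite_induct)
  case (insert x F)
  then show ?case using pderivs_add[of "f x" "\<lambda>y. \<Sum>i\<in>F. f i y" "is"] by (simp add: alg_sum)
qed (simp_all add: pderivs_const_zero)

lemma pderivs_append: "pderivs (is @ js) f = pderivs is (pderivs js f)"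
  by (induction "is") auto

lemma partial_at_alg_power:
  assumes "f \<in> alg B"
  shows "partial_at i (\<lambda>y. f y ^ k) = (\<lambda>y. real k * f y ^ (k - 1) * partial_at i f y)"
proof (induction k)
  case (Suc k)
  have "partial_at i (\<lambda>y. f y * f y ^ k) = (\<lambda>y. partial_at i f y * f y ^ k + f y * partial_at i (\<lambda>y. f y ^ k) y)"
    by (rule partial_at_alg_mult[OF assms alg_power[OF assms]])
  then show ?case unfolding Suc by (cases k) (auto simp: algebra_simps)
qed simp

text \<open>Each derivative lowers the power of \<open>a\<close> by at most one and moves the rest
  into the cofactor; induction peels off the innermost derivative first.\<close>

lemma pderivs_power_mult_vanish:
  assumes "a \<in> alg B" "f \<in> alg B" "length is < m" "a y = 0"
  shows "pderivs is (\<lambda>y. a y ^ m * f y) y = 0"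
  using assms(2,3)
proof (induction "is" arbitrary: f m rule: rev_induct)
  case Nil
  then show ?case using assms(4) by simp
next
  case (snoc i "is")
  have "partial_at i (\<lambda>y. a y ^ m * f y) =
      (\<lambda>y. real m * a y ^ (m - 1) * partial_at i a y * f y + a y ^ m * partial_at i f y)"
    unfolding partial_at_alg_mult[OF alg_power[OF assms(1)] snoc.prems(1)]
      partial_at_alg_power[OF assms(1)] ..
  also have "\<dots> = (\<lambda>y. a y ^ (m - 1) * (real m * partial_at i a y * f y + a y * partial_at i f y))"
  proof
    have "a y ^ m = a y ^ (m - 1) * a y" for y using snoc.prems(2) by (cases m) auto
    then show "real m * a y ^ (m - 1) * partial_at i a y * f y + a y ^ m * partial_at i f y =
      a y ^ (m - 1) * (real m * partial_at i a y * f y + a y * partial_at i f y)" for y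
      by (simp add: algebra_simps)
  qed
  finally have eq: "partial_at i (\<lambda>y. a y ^ m * f y) = \<dots>" .
  have "(\<lambda>y. real m * partial_at i a y * f y + a y * partial_at i f y) \<in> alg B"
    using assms(1) snoc.prems(1) by (intro alg_intros partial_at_alg)
  then show ?case
    unfolding pderivs_append using snoc.IH[of _ "m - 1"] snoc.prems(2) by (simp add: eq)
qed

end

section \<open>Multi-indices and jets\<close>

lemma finite_multiindices: "finite {\<gamma> :: 'n::finite \<Rightarrow> nat. sum \<gamma> UNIV = k}"
proof (rule finite_subset)
  show "{\<gamma> :: 'n \<Rightarrow> nat. sum \<gamma> UNIV = k} \<subseteq> PiE UNIV (\<lambda>_. {..k})"
    by (auto simp: PiE_def Pi_def intro!: member_le_sum)
  show "finite (PiE (UNIV :: 'n set) (\<lambda>_. {..k}))" by (intro finite_PiE) auto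
qed

lemma idx_list: "distinct (idx_list :: 'n::finite list)" "set (idx_list :: 'n list) = UNIV"
proof -
  have "\<exists>xs :: 'n list. distinct xs \<and> set xs = UNIV"
    using finite_distinct_list[OF finite_class.finite_UNIV] by blast
  then show "distinct (idx_list :: 'n list)" "set (idx_list :: 'n list) = UNIV"
    unfolding idx_list_def by (metis (mono_tags, lifting) someI_ex)+
qed

lemma count_mpartial_list:
  "count (mset (concat (map (\<lambda>i. replicate (\<beta> i) i) idx_list))) (i :: 'n::finite) = \<beta> i"
proof -
  have "count (mset (concat (map (\<lambda>i. replicate (\<beta> i) i) xs))) i = (if i \<in> set xs then \<beta> i else 0)"
    if "distinct xs" for xs
    using that by (induction xs) auto
  from this[OF idx_list(1)] show ?thesis by (simp add: idx_list(2))
qed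

lemma length_mpartial_list:
  "length (concat (map (\<lambda>i. replicate (\<beta> i) i) (idx_list :: 'n::finite list))) = sum \<beta> UNIV"
proof -
  have "length (concat (map (\<lambda>i. replicate (\<beta> i) i) xs)) = sum \<beta> (set xs)" if "distinct xs" for xs :: "'n list"
    using that by (induction xs) auto
  from this[OF idx_list(1)] show ?thesis by (simp add: idx_list(2))
qed

text \<open>The jet of infinite order, a point at which expressions in jet variables can be
  evaluated; unlike \<open>jet\<close> there is no cut at order \<open>r\<close>, so total
  derivatives can be evaluated too.\<close>

definition jinf :: "('k \<Rightarrow> real^'n::finite \<Rightarrow> real) \<Rightarrow> real^'n \<Rightarrow> ('n, 'k) jvar \<Rightarrow> real" where
  "jinf H y = (\<lambda>v. case v of Inl i \<Rightarrow> y $ i | Inr (\<beta>, j) \<Rightarrow> mpartial \<beta> (H j) y)"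

context
  fixes B :: "(real^'n::finite \<Rightarrow> real) set"
  assumes B: "smooth_gens B" and comm: "commuting_gens B"
begin

lemma partial_at_commute: "f \<in> alg B \<Longrightarrow> partial_at i (partial_at j f) = partial_at j (partial_at i f)"
proof (induction rule: alg.induct)
  case (gen b)
  then show ?case using comm by (auto simp: commuting_gens_def)
next
  case (add f g)
  then show ?case by (simp add: partial_at_alg_add[OF B] partial_at_alg[OF B])
next
  case (mul f g)
  then show ?case
    by (simp add: partial_at_alg_add[OF B] partial_at_alg_mult[OF B] partial_at_alg[OF B] alg.intros algebra_simps)
qed simp

lemma pderivs_insert: "f \<in> alg B \<Longrightarrow> pderivs (as @ i # bs) f = partial_at i (pderivs (as @ bs) f)"
proof (induction as)
  case (Cons a as)
  then show ?case using partial_at_commute[OF pderivs_alg[OF B Cons.prems]] by simp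
qed simp

lemma pderivs_mset: "f \<in> alg B \<Longrightarrow> mset is = mset js \<Longrightarrow> pderivs is f = pderivs js f"
proof (induction "is" arbitrary: js)
  case (Cons i "is")
  then have "i \<in> set js" by (metis list.set_intros(1) set_mset_mset)
  then obtain as bs where js: "js = as @ i # bs" by (meson split_list)
  then have "mset is = mset (as @ bs)" using Cons.prems by simp
  from Cons.IH[OF Cons.prems(1) this] show ?case
    by (simp add: js pderivs_insert[OF Cons.prems(1)])
qed auto

text \<open>\<open>mpartial\<close> differentiates in the fixed order of \<open>idx_list\<close>; by
  commutation only the multiset of directions counts.\<close>

lemma partial_at_mpartial:
  assumes "f \<in> alg B"
  shows "partial_at i (mpartial \<beta> f) = mpartial (\<beta>(i := \<beta> i + 1)) f"
proof -
  have "mset (i # concat (map (\<lambda>i. replicate (\<beta> i) i) idx_list)) =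
      mset (concat (map (\<lambda>k. replicate ((\<beta>(i := \<beta> i + 1)) k) k) idx_list))"
  proof (rule multiset_eqI)
    show "count (mset (i # concat (map (\<lambda>i. replicate (\<beta> i) i) idx_list))) k =
      count (mset (concat (map (\<lambda>k. replicate ((\<beta>(i := \<beta> i + 1)) k) k) idx_list))) k" for k
      unfolding count_mpartial_list by (simp add: count_mpartial_list)
  qed
  from pderivs_mset[OF assms this] show ?thesis unfolding mpartial_def by simp
qed

text \<open>The link between algebra and analysis: along the jet of an actual map, formal total
  derivatives are the partial derivatives of the composite. Transversality thus becomes independence
  of total derivatives.\<close>

lemma peval_jinf_has_derivative:
  assumes "\<And>j. H j \<in> alg B"
  shows "((\<lambda>y. peval e (jinf H y)) has_derivative (\<lambda>h. \<Sum>i\<in>UNIV. h $ i * peval (td i e) (jinf H y))) (at y)"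
proof (induction e)
  case (Cst c)
  then show ?case by simp
next
  case (Var v)
  show ?case
  proof (cases v)
    case (Inl l)
    have "((\<lambda>y. y $ l) has_derivative (\<lambda>h. h $ l)) (at y)"
      by (rule bounded_linear.has_derivative[OF bounded_linear_vec_nth]) (rule has_derivative_ident)
    moreover have "(\<Sum>i\<in>UNIV. h $ i * peval (td i (Var v)) (jinf H y)) = h $ l" for h :: "real^'n"
    proof -
      have "(\<Sum>i\<in>UNIV. h $ i * peval (td i (Var v)) (jinf H y)) = (\<Sum>i\<in>UNIV. if i = l then h $ i else 0)"
        by (rule sum.cong) (auto simp: Inl)
      then show ?thesis by simp
    qed
    moreover have "peval (Var v) (jinf H y) = y $ l" for y by (simp add: Inl jinf_def)
    ultimately show ?thesis by simp
  next
    case (Inr \<beta>j)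
    obtain \<beta> j where b: "\<beta>j = (\<beta>, j)" by (cases \<beta>j)
    have "(mpartial \<beta> (H j) has_derivative (\<lambda>h. \<Sum>i\<in>UNIV. h $ i * partial_at i (mpartial \<beta> (H j)) y)) (at y)"
      by (intro partial_at_gradient alg_differentiable[OF B] mpartial_alg[OF B] assms)
    then show ?thesis by (simp add: Inr b jinf_def partial_at_mpartial[OF assms])
  qed
next
  case (Add a b)
  then show ?case using has_derivative_add[OF Add] by (simp add: sum.distrib[symmetric] algebra_simps)
next
  case (Mul a b)
  then show ?case using has_derivative_mult[OF Mul]
    by (simp add: sum.distrib[symmetric] sum_distrib_left sum_distrib_right algebra_simps)
qed

text \<open>The \<open>\<tau> i\<close> are local coordinates at \<open>z\<close>, each a function
  of one variable; their monomials replace Taylor monomials.\<close>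

context
  fixes \<tau> :: "'n \<Rightarrow> real^'n \<Rightarrow> real" and z :: "real^'n"
  assumes \<tau>: "\<And>i. \<tau> i \<in> alg B" "\<And>i. \<tau> i z = 0" "\<And>i l. l \<noteq> i \<Longrightarrow> partial_at l (\<tau> i) = (\<lambda>_. 0)"
      "\<And>i. partial_at i (\<tau> i) z \<noteq> 0"
begin

abbreviation tpow :: "('n \<Rightarrow> nat) \<Rightarrow> real^'n \<Rightarrow> real" where
  "tpow \<gamma> y \<equiv> \<Prod>i\<in>UNIV. \<tau> i y ^ \<gamma> i"

text \<open>The prefactor \<open>\<sigma>\<close> absorbs what differentiation produces, so that a
  prefactor times a monomial keeps this shape and induction is possible.\<close>

lemma partial_at_tpow:
  assumes "\<sigma> \<in> alg B"
  shows "partial_at i (\<lambda>y. \<sigma> y * tpow \<gamma> y) = (if \<gamma> i = 0 then (\<lambda>y. partial_at i \<sigma> y * tpow \<gamma> y)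
     else (\<lambda>y. (real (\<gamma> i) * \<sigma> y * partial_at i (\<tau> i) y + \<tau> i y * partial_at i \<sigma> y) * tpow (\<gamma>(i := \<gamma> i - 1)) y))"
proof -
  define R where "R y = (\<Prod>l\<in>UNIV - {i}. \<tau> l y ^ \<gamma> l)" for y
  have split: "tpow \<gamma>' y = \<tau> i y ^ \<gamma>' i * R y" if "\<And>l. l \<noteq> i \<Longrightarrow> \<gamma>' l = \<gamma> l" for \<gamma>' y
  proof -
    have "tpow \<gamma>' y = \<tau> i y ^ \<gamma>' i * (\<Prod>l\<in>UNIV - {i}. \<tau> l y ^ \<gamma>' l)" by (rule prod.remove) auto
    moreover have "(\<Prod>l\<in>UNIV - {i}. \<tau> l y ^ \<gamma>' l) = R y" unfolding R_def by (rule prod.cong) (use that in auto)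
    ultimately show ?thesis by simp
  qed
  have Ra: "R \<in> alg B" and R0: "partial_at i R = (\<lambda>_. 0)"
  proof -
    have "(\<lambda>y. \<Prod>l\<in>L. \<tau> l y ^ \<gamma> l) \<in> alg B \<and> partial_at i (\<lambda>y. \<Prod>l\<in>L. \<tau> l y ^ \<gamma> l) = (\<lambda>_. 0)"
      if "i \<notin> L" for L
      using that
    proof (induction L rule: infinite_finite_induct)
      case (insert l L)
      then have "partial_at i (\<lambda>y. \<tau> l y ^ \<gamma> l) = (\<lambda>_. 0)"
        using \<tau>(3)[of i l] by (auto simp: partial_at_alg_power[OF B \<tau>(1)])
      then show ?case using insert \<tau>(1)
        by (simp add: partial_at_alg_mult[OF B] alg_intros)
    qed (simp_all add: alg.intros)
    then show "R \<in> alg B" "partial_at i R = (\<lambda>_. 0)" unfolding R_def[abs_def] by auto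
  qed
  have pw: "(\<lambda>y. \<tau> i y ^ \<gamma> i) \<in> alg B" using \<tau>(1) by (rule alg_power)
  have 1: "(\<lambda>y. \<sigma> y * tpow \<gamma> y) = (\<lambda>y. (\<sigma> y * \<tau> i y ^ \<gamma> i) * R y)"
    by (simp add: split mult.assoc)
  have "partial_at i (\<lambda>y. \<sigma> y * tpow \<gamma> y) = 
      (\<lambda>y. (partial_at i \<sigma> y * \<tau> i y ^ \<gamma> i + \<sigma> y * (real (\<gamma> i) * \<tau> i y ^ (\<gamma> i - 1) * partial_at i (\<tau> i) y)) * R y)"
    unfolding 1 partial_at_alg_mult[OF B alg.mul[OF assms pw] Ra] R0 partial_at_alg_mult[OF B assms pw]
      partial_at_alg_power[OF B \<tau>(1)] by simp
  moreover have "\<tau> i y ^ \<gamma> i = \<tau> i y * \<tau> i y ^ (\<gamma> i - 1)" if "\<gamma> i \<noteq> 0" for y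
    using that by (cases "\<gamma> i") auto
  moreover have "tpow \<gamma> y = \<tau> i y ^ \<gamma> i * R y" "tpow (\<gamma>(i := \<gamma> i - 1)) y = \<tau> i y ^ (\<gamma> i - 1) * R y" for y
    by (simp_all only: split fun_upd_apply if_False if_True refl)
  ultimately show ?thesis
    by (cases "\<gamma> i = 0") (simp_all only: if_True if_False power_0 of_nat_0, simp_all add: algebra_simps)
qed

text \<open>As for ordinary monomials: every derivative in direction \<open>i\<close> removes at
  most one factor \<open>\<tau> i\<close>, the rest vanishes at \<open>z\<close>, and an exact match
  leaves a nonzero multiple of the prefactor.\<close>

lemma pderivs_tpow:
  assumes "\<sigma> \<in> alg B"
  shows "(\<exists>i. count (mset is) i < \<gamma> i) \<Longrightarrow> pderivs is (\<lambda>y. \<sigma> y * tpow \<gamma> y) z = 0"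
    and "(\<And>i. count (mset is) i = \<gamma> i) \<Longrightarrow> \<sigma> z \<noteq> 0 \<Longrightarrow> pderivs is (\<lambda>y. \<sigma> y * tpow \<gamma> y) z \<noteq> 0"
proof -
  have "((\<exists>i. count (mset is) i < \<gamma> i) \<longrightarrow> pderivs is (\<lambda>y. \<sigma> y * tpow \<gamma> y) z = 0) \<and>
    ((\<forall>i. count (mset is) i = \<gamma> i) \<longrightarrow> \<sigma> z \<noteq> 0 \<longrightarrow> pderivs is (\<lambda>y. \<sigma> y * tpow \<gamma> y) z \<noteq> 0)"
    using assms
  proof (induction "is" arbitrary: \<sigma> \<gamma> rule: rev_induct)
    case Nil
    have "tpow \<gamma> z = 0" if "\<gamma> i > 0" for i
      using that \<tau>(2) by (subst prod_zero_iff) auto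
    then show ?case by auto
  next
    case (snoc i "is")
    have pa: "partial_at i \<sigma> \<in> alg B" using snoc.prems by (rule partial_at_alg[OF B])
    show ?case
    proof (cases "\<gamma> i = 0")
      case True
      have eq: "pderivs (is @ [i]) (\<lambda>y. \<sigma> y * tpow \<gamma> y) z = pderivs is (\<lambda>y. partial_at i \<sigma> y * tpow \<gamma> y) z"
        using True snoc.prems by (simp add: pderivs_append[OF B] partial_at_tpow)
      have "\<exists>k. count (mset is) k < \<gamma> k" if "\<exists>k. count (mset (is @ [i])) k < \<gamma> k"
        using that by (auto split: if_splits intro: Suc_lessD)
      moreover have "\<not> (\<forall>k. count (mset (is @ [i])) k = \<gamma> k)"
        using True by (auto intro!: exI[of _ i])
      ultimately show ?thesis using snoc.IH[OF pa, of \<gamma>] unfolding eq by blast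
    next
      case False
      define \<sigma>' where "\<sigma>' y = real (\<gamma> i) * \<sigma> y * partial_at i (\<tau> i) y + \<tau> i y * partial_at i \<sigma> y" for y
      have a: "\<sigma>' \<in> alg B" unfolding \<sigma>'_def[abs_def]
        using snoc.prems pa \<tau>(1) by (intro alg_intros partial_at_alg[OF B])
      have eq: "pderivs (is @ [i]) (\<lambda>y. \<sigma> y * tpow \<gamma> y) z = pderivs is (\<lambda>y. \<sigma>' y * tpow (\<gamma>(i := \<gamma> i - 1)) y) z"
        using False snoc.prems by (simp add: pderivs_append[OF B] partial_at_tpow \<sigma>'_def)
      have s: "\<sigma>' z \<noteq> 0" if "\<sigma> z \<noteq> 0" using that False \<tau>(2,4) by (simp add: \<sigma>'_def)
      have "(\<exists>k. count (mset is) k < (\<gamma>(i := \<gamma> i - 1)) k)" if "\<exists>k. count (mset (is @ [i])) k < \<gamma> k"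
      proof -
        obtain k where "count (mset (is @ [i])) k < \<gamma> k" using \<open>\<exists>k. count (mset (is @ [i])) k < \<gamma> k\<close> by blast
        then have "count (mset is) k < (\<gamma>(i := \<gamma> i - 1)) k" by (auto split: if_splits)
        then show ?thesis by blast
      qed
      moreover have "\<forall>k. count (mset is) k = (\<gamma>(i := \<gamma> i - 1)) k" if "\<forall>k. count (mset (is @ [i])) k = \<gamma> k"
        using that by (auto split: if_splits)
      ultimately show ?thesis using snoc.IH[OF a, of "\<gamma>(i := \<gamma> i - 1)"] s unfolding eq by blast
    qed
  qed
  then show "(\<exists>i. count (mset is) i < \<gamma> i) \<Longrightarrow> pderivs is (\<lambda>y. \<sigma> y * tpow \<gamma> y) z = 0"
    and "(\<And>i. count (mset is) i = \<gamma> i) \<Longrightarrow> \<sigma> z \<noteq> 0 \<Longrightarrow> pderivs is (\<lambda>y. \<sigma> y * tpow \<gamma> y) z \<noteq> 0"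
    by blast+
qed

text \<open>The matrix of derivatives of monomials at \<open>z\<close> is triangular with respect to
  order, with nonzero diagonal. \<open>S\<close> is kept abstract so that the interpolating function
  may be confined to multiples of a given factor and to one parity.\<close>

theorem jets_surjective:
  assumes \<sigma>: "\<sigma> \<in> alg B" "\<sigma> z \<noteq> 0"
    and S: "S \<subseteq> alg B" "(\<lambda>_. 0) \<in> S" "\<And>f g. f \<in> S \<Longrightarrow> g \<in> S \<Longrightarrow> (\<lambda>y. f y + g y) \<in> S"
       "\<And>c \<gamma>. (\<lambda>y. c * (\<sigma> y * tpow \<gamma> y)) \<in> S"
  shows "\<exists>h\<in>S. \<forall>\<beta>. sum \<beta> UNIV \<le> L \<longrightarrow> mpartial \<beta> h z = t \<beta>"
proof -
  have "\<exists>h\<in>S. \<forall>\<beta>. (L + 1 - d \<le> sum \<beta> UNIV \<and> sum \<beta> UNIV \<le> L \<longrightarrow> mpartial \<beta> h z = t \<beta>) \<and>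
     (sum \<beta> UNIV < L + 1 - d \<longrightarrow> mpartial \<beta> h z = 0)" for d
  proof (induction d arbitrary: t)
    case 0
    show ?case using S(2) by (intro bexI[of _ "\<lambda>_. 0"]) (auto simp: mpartial_def pderivs_const_zero[OF B])
  next
    case (Suc d)
    show ?case
    proof (cases "d \<le> L")
      case False
      then have "L + 1 - Suc d = 0" "L + 1 - d = 0" by auto
      then show ?thesis using Suc[of t] by simp
    next
      case True
      \<comment> \<open>The lowest order still to be prescribed. \<open>h1\<close> settles it and
        spoils only higher orders.\<close>
      define k where "k = L - d"
      define M where "M = {\<gamma> :: 'n \<Rightarrow> nat. sum \<gamma> UNIV = k}"
      define \<kappa> where "\<kappa> \<gamma> = mpartial \<gamma> (\<lambda>y. \<sigma> y * tpow \<gamma> y) z" for \<gamma>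
      have fM: "finite M" unfolding M_def by (rule finite_multiindices)
      have \<kappa>: "\<kappa> \<gamma> \<noteq> 0" for \<gamma>
        unfolding \<kappa>_def mpartial_def by (rule pderivs_tpow(2)[OF \<sigma>(1) count_mpartial_list \<sigma>(2)])
      define c where "c \<gamma> = t \<gamma> / \<kappa> \<gamma>" for \<gamma>
      define h1 where "h1 y = (\<Sum>\<gamma>\<in>M. c \<gamma> * (\<sigma> y * tpow \<gamma> y))" for y
      have "h1 \<in> S" unfolding h1_def[abs_def] using fM
        by (induction M rule: finite_induct) (simp_all only: sum.empty sum.insert S(2) S(3)[OF S(4)] not_False_eq_True)
      have tp: "(\<lambda>y. \<sigma> y * tpow \<gamma> y) \<in> alg B" for \<gamma> using \<sigma>(1) \<tau>(1) by (intro alg_intros)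
      have mh1: "mpartial \<beta> h1 z = (\<Sum>\<gamma>\<in>M. c \<gamma> * mpartial \<beta> (\<lambda>y. \<sigma> y * tpow \<gamma> y) z)" for \<beta>
        unfolding h1_def[abs_def] mpartial_def
        by (subst pderivs_sum[OF B]) (simp_all only: alg.mul[OF alg.const tp] pderivs_cmult[OF B tp])
      have van: "mpartial \<beta> (\<lambda>y. \<sigma> y * tpow \<gamma> y) z = 0" if vh: "\<gamma> \<in> M" "sum \<beta> UNIV \<le> k" "\<beta> \<noteq> \<gamma>" for \<beta> \<gamma>
      proof -
        have "\<exists>i. \<beta> i < \<gamma> i"
        proof (rule ccontr)
          assume "\<not> ?thesis"
          then have le: "\<gamma> i \<le> \<beta> i" for i by (auto simp: not_less)
          obtain i where "\<gamma> i \<noteq> \<beta> i" using vh(3) by (metis ext)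
          then have "\<gamma> i < \<beta> i" using le[of i] by simp
          then have "sum \<gamma> UNIV < sum \<beta> UNIV" using le by (intro sum_strict_mono_ex1) auto
          then show False using vh by (simp add: M_def)
        qed
        then show ?thesis unfolding mpartial_def
          by (intro pderivs_tpow(1)[OF \<sigma>(1)]) (simp only: count_mpartial_list)
      qed
      have h1k: "mpartial \<beta> h1 z = t \<beta>" if "sum \<beta> UNIV = k" for \<beta>
      proof -
        have "mpartial \<beta> h1 z = (\<Sum>\<gamma>\<in>M. if \<gamma> = \<beta> then t \<beta> else 0)"
          unfolding mh1 using van \<kappa>[of \<beta>] that by (intro sum.cong) (auto simp: \<kappa>_def c_def)
        then show ?thesis using fM that by (simp add: M_def)
      qed
      have h1l: "mpartial \<beta> h1 z = 0" if "sum \<beta> UNIV < k" for \<beta>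
      proof -
        have "c \<gamma> * mpartial \<beta> (\<lambda>y. \<sigma> y * tpow \<gamma> y) z = 0" if "\<gamma> \<in> M" for \<gamma>
        proof -
          have "\<beta> \<noteq> \<gamma>" using that \<open>sum \<beta> UNIV < k\<close> by (auto simp: M_def)
          then show ?thesis using van[OF that] \<open>sum \<beta> UNIV < k\<close> by simp
        qed
        then show ?thesis unfolding mh1 by (intro sum.neutral) blast
      qed
      \<comment> \<open>Corrects the orders above \<open>k\<close> for the contribution of
        \<open>h1\<close>, while vanishing to order \<open>k\<close> at \<open>z\<close>.\<close>
      obtain h2 where h2: "h2 \<in> S" "\<And>\<beta>. L + 1 - d \<le> sum \<beta> UNIV \<Longrightarrow> sum \<beta> UNIV \<le> L \<Longrightarrow> mpartial \<beta> h2 z = t \<beta> - mpartial \<beta> h1 z"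
        "\<And>\<beta>. sum \<beta> UNIV < L + 1 - d \<Longrightarrow> mpartial \<beta> h2 z = 0"
        using Suc[of "\<lambda>\<beta>. t \<beta> - mpartial \<beta> h1 z"] by blast
      have mh: "mpartial \<beta> (\<lambda>y. h1 y + h2 y) z = mpartial \<beta> h1 z + mpartial \<beta> h2 z" for \<beta>
        unfolding mpartial_def using \<open>h1 \<in> S\<close> h2(1) S(1) by (subst pderivs_add[OF B]) auto
      have kd: "L + 1 - d = Suc k" "L + 1 - Suc d = k" using True by (auto simp: k_def)
      show ?thesis
      proof (intro bexI[of _ "\<lambda>y. h1 y + h2 y"] allI conjI impI)
        fix \<beta> :: "'n \<Rightarrow> nat"
        assume b: "L + 1 - Suc d \<le> sum \<beta> UNIV \<and> sum \<beta> UNIV \<le> L"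
        show "mpartial \<beta> (\<lambda>y. h1 y + h2 y) z = t \<beta>"
          using b h1k[of \<beta>] h2(2,3)[of \<beta>] unfolding mh kd by (cases "sum \<beta> UNIV = k") auto
      next
        fix \<beta> :: "'n \<Rightarrow> nat"
        assume b: "sum \<beta> UNIV < L + 1 - Suc d"
        then show "mpartial \<beta> (\<lambda>y. h1 y + h2 y) z = 0"
          using h1l[of \<beta>] h2(3)[of \<beta>] unfolding mh kd by auto
      qed (use \<open>h1 \<in> S\<close> h2(1) S(3) in auto)
    qed
  qed
  from this[of "L + 1"] show ?thesis by auto
qed

end

end

section \<open>Stable intersections\<close>

lemma span_image_combination:
  fixes b :: "'a \<Rightarrow> 'v::real_vector"
  assumes "finite A" "x \<in> span (b ` A)"
  shows "\<exists>c. x = (\<Sum>a\<in>A. c a *\<^sub>R b a)"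
proof -
  let ?T = "range (\<lambda>c. \<Sum>a\<in>A. c a *\<^sub>R b a)"
  have "subspace ?T"
    unfolding subspace_def
  proof (intro conjI ballI allI)
    show "0 \<in> ?T" by (rule range_eqI[of _ _ "\<lambda>_. 0"]) simp
    fix x y assume "x \<in> ?T" "y \<in> ?T"
    then obtain c d where cd: "x = (\<Sum>a\<in>A. c a *\<^sub>R b a)" "y = (\<Sum>a\<in>A. d a *\<^sub>R b a)" by auto
    show "x + y \<in> ?T" by (rule range_eqI[of _ _ "\<lambda>a. c a + d a"]) (simp add: cd sum.distrib scaleR_add_left)
  next
    fix k x assume "x \<in> ?T"
    then obtain c where c: "x = (\<Sum>a\<in>A. c a *\<^sub>R b a)" by auto
    show "k *\<^sub>R x \<in> ?T" by (rule range_eqI[of _ _ "\<lambda>a. k * c a"]) (simp add: c scaleR_sum_right)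
  qed
  moreover have "b ` A \<subseteq> ?T"
  proof
    fix y assume "y \<in> b ` A"
    then obtain a0 where a0: "a0 \<in> A" "y = b a0" by auto
    have "(\<Sum>a\<in>A. (if a = a0 then 1 else 0) *\<^sub>R b a) = (\<Sum>a\<in>A. if a = a0 then b a else 0)"
      by (rule sum.cong) auto
    also have "\<dots> = y" using a0 assms(1) by simp
    finally show "y \<in> ?T" by (intro range_eqI[of _ _ "\<lambda>a. if a = a0 then 1 else 0"]) simp
  qed
  ultimately have "span (b ` A) \<subseteq> ?T" by (rule span_minimal[rotated])
  then show ?thesis using assms(2) by auto
qed

text \<open>The part of \<open>b a'\<close> orthogonal to the span of the other vectors is nonzero
  by independence; dividing by its squared norm gives the dual vector.\<close>

lemma dual_vectors:
  fixes b :: "'a \<Rightarrow> 'v::euclidean_space"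
  assumes fin: "finite A" and ind: "\<And>c. (\<Sum>a\<in>A. c a *\<^sub>R b a) = 0 \<Longrightarrow> \<forall>a\<in>A. c a = 0"
  shows "\<exists>r. \<forall>a\<in>A. \<forall>a'\<in>A. b a \<bullet> r a' = (if a = a' then 1 else 0)"
proof -
  have "\<exists>r. \<forall>a\<in>A. b a \<bullet> r = (if a = a' then 1 else 0)" if a': "a' \<in> A" for a'
  proof -
    obtain p q where pq: "p \<in> span (b ` (A - {a'}))" "\<And>w. w \<in> span (b ` (A - {a'})) \<Longrightarrow> orthogonal q w" "b a' = p + q"
      using orthogonal_subspace_decomp_exists[of "b ` (A - {a'})" "b a'"] by blast
    have "q \<noteq> 0"
    proof
      assume "q = 0"
      then have "b a' \<in> span (b ` (A - {a'}))" using pq by simp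
      then obtain c where c: "b a' = (\<Sum>a\<in>A - {a'}. c a *\<^sub>R b a)"
        using span_image_combination[of "A - {a'}"] fin by auto
      have "(\<Sum>a\<in>A. (if a = a' then -1 else c a) *\<^sub>R b a) = - b a' + (\<Sum>a\<in>A - {a'}. (if a = a' then -1 else c a) *\<^sub>R b a)"
        using sum.remove[OF fin a', of "\<lambda>a. (if a = a' then -1 else c a) *\<^sub>R b a"] by simp
      also have "(\<Sum>a\<in>A - {a'}. (if a = a' then -1 else c a) *\<^sub>R b a) = b a'"
        unfolding c by (rule sum.cong) auto
      finally have "\<forall>a\<in>A. (if a = a' then -1 else c a) = 0" by (intro ind) simp
      then show False using a' by fastforce
    qed
    have "b a \<bullet> q = (if a = a' then q \<bullet> q else 0)" if "a \<in> A" for a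
    proof (cases "a = a'")
      case True
      have "p \<bullet> q = 0" using pq(2)[OF pq(1)] by (simp add: orthogonal_def inner_commute)
      then show ?thesis using True pq(3) by (simp add: inner_add_left)
    next
      case False
      then have "b a \<in> span (b ` (A - {a'}))" using that by (intro span_base) auto
      then have "q \<bullet> b a = 0" using pq(2) by (simp add: orthogonal_def)
      then show ?thesis using False by (simp add: inner_commute)
    qed
    then show ?thesis using \<open>q \<noteq> 0\<close> by (intro exI[of _ "q /\<^sub>R (q \<bullet> q)"]) auto
  qed
  then show ?thesis by metis
qed

text \<open>Brouwer's theorem on the affine subspace spanned by dual vectors of the gradients.\<close>

lemma robust_zero:
  fixes F :: "'a \<Rightarrow> 'v::euclidean_space \<Rightarrow> real"
  assumes fin: "finite A" and F0: "\<And>a. a \<in> A \<Longrightarrow> F a z = 0"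
    and F': "\<And>a. a \<in> A \<Longrightarrow> (F a has_derivative (\<lambda>h. b a \<bullet> h)) (at z)"
    and ind: "\<And>c. (\<Sum>a\<in>A. c a *\<^sub>R b a) = 0 \<Longrightarrow> \<forall>a\<in>A. c a = 0"
    and \<delta>: "\<delta> > 0"
  shows "\<exists>\<eta>>0. \<forall>G. (\<forall>a\<in>A. continuous_on (cball z \<delta>) (G a) \<and> (\<forall>y\<in>cball z \<delta>. \<bar>G a y - F a y\<bar> < \<eta>)) \<longrightarrow>
     (\<exists>y\<in>cball z \<delta>. \<forall>a\<in>A. G a y = 0)"
proof -
  obtain r where r: "\<And>a a'. a \<in> A \<Longrightarrow> a' \<in> A \<Longrightarrow> b a \<bullet> r a' = (if a = a' then 1 else 0)"
    using dual_vectors[OF fin ind] by blast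
  define K where "K = (\<Sum>a\<in>A. norm (r a)) + 1"
  have K: "K > 0" "(\<Sum>a\<in>A. norm (r a)) \<le> K" unfolding K_def by (auto intro!: add_nonneg_pos sum_nonneg)
  \<comment> \<open>The linearisation error and the perturbation are each at most
    \<open>\<epsilon> * \<delta>1\<close> per equation; summed with weights
    \<open>norm (r a)\<close> this stays below
    \<open>2 * \<epsilon> * K * \<delta>1 = \<delta>1\<close>, so the ball is mapped into
    itself.\<close>
  define \<epsilon> where "\<epsilon> = 1 / (2 * K)"
  have \<epsilon>: "\<epsilon> > 0" using K by (simp add: \<epsilon>_def)
  have "\<exists>d>0. \<forall>y. norm (y - z) < d \<longrightarrow> \<bar>F a y - b a \<bullet> (y - z)\<bar> \<le> \<epsilon> * norm (y - z)" if "a \<in> A" for a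
    using F'[OF that] \<epsilon> F0[OF that] unfolding has_derivative_at_alt by fastforce
  then obtain d where d: "\<And>a. a \<in> A \<Longrightarrow> d a > 0"
     "\<And>a y. a \<in> A \<Longrightarrow> norm (y - z) < d a \<Longrightarrow> \<bar>F a y - b a \<bullet> (y - z)\<bar> \<le> \<epsilon> * norm (y - z)" by metis
  define \<delta>1 where "\<delta>1 = Min (insert \<delta> ((\<lambda>a. d a / 2) ` A))"
  have "\<delta>1 > 0" unfolding \<delta>1_def using fin d(1) \<delta> by (subst Min_gr_iff) auto
  have "\<delta>1 \<le> \<delta>" unfolding \<delta>1_def using fin by (intro Min_le) auto
  have \<delta>1d: "\<delta>1 < d a" if "a \<in> A" for a
  proof -
    have "\<delta>1 \<le> d a / 2" unfolding \<delta>1_def using fin that by (intro Min_le) auto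
    then show ?thesis using d(1)[OF that] by simp
  qed
  define \<eta> where "\<eta> = \<epsilon> * \<delta>1"
  have "\<eta> > 0" using \<epsilon> \<open>\<delta>1 > 0\<close> by (simp add: \<eta>_def)
  show ?thesis
  proof (intro exI[of _ \<eta>] conjI allI impI \<open>\<eta> > 0\<close>)
    fix G assume G: "\<forall>a\<in>A. continuous_on (cball z \<delta>) (G a) \<and> (\<forall>y\<in>cball z \<delta>. \<bar>G a y - F a y\<bar> < \<eta>)"
    \<comment> \<open>There may be fewer equations than dimensions. On \<open>T\<close> the linear
      part \<open>v\<close> to the sum of \<open>(b a \<bullet> v) *\<^sub>R r a\<close> is the
      identity, which leaves only error terms in the displacement of \<open>\<Theta> y\<close> from
      \<open>z\<close>.\<close>
    define T where "T = span (r ` A)"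
    define D where "D = cball z \<delta>1 \<inter> (+) z ` T"
    \<comment> \<open>A simplified Newton step; at a fixed point the correction vanishes, and
      pairing it with \<open>b a\<close> isolates \<open>G a y\<close>.\<close>
    define \<Theta> where "\<Theta> y = y - (\<Sum>a\<in>A. G a y *\<^sub>R r a)" for y
    have Tr: "v = (\<Sum>a\<in>A. (b a \<bullet> v) *\<^sub>R r a)" if v: "v \<in> T" for v
    proof -
      obtain c where c: "v = (\<Sum>a\<in>A. c a *\<^sub>R r a)" using span_image_combination[OF fin, of v r] v by (auto simp: T_def)
      have "b a \<bullet> v = c a" if a: "a \<in> A" for a
      proof -
        have "b a \<bullet> v = (\<Sum>a'\<in>A. if a' = a then c a' else 0)"
          unfolding c inner_sum_right using r a by (intro sum.cong) auto
        then show ?thesis using fin a by simp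
      qed
      then show ?thesis by (subst c) (rule sum.cong, auto)
    qed
    have "closed ((+) z ` T)" by (simp add: T_def closed_translation)
    then have "compact D" unfolding D_def by (intro compact_Int_closed) auto
    moreover have "convex D" unfolding D_def T_def
      by (intro convex_Int convex_cball convex_translation subspace_imp_convex subspace_span)
    moreover have "z \<in> D" unfolding D_def T_def using \<open>\<delta>1 > 0\<close> by (auto intro!: image_eqI[of _ _ 0] span_zero)
    moreover have "continuous_on D \<Theta>"
      unfolding \<Theta>_def using G \<open>\<delta>1 \<le> \<delta>\<close>
      by (intro continuous_intros) (auto simp: D_def intro: continuous_on_subset)
    moreover have "\<Theta> \<in> D \<rightarrow> D"
    proof
      fix y assume y: "y \<in> D"
      then obtain v where v: "v \<in> T" "y = z + v" "norm v \<le> \<delta>1" by (auto simp: D_def dist_norm)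
      have yd: "y \<in> cball z \<delta>" using v \<open>\<delta>1 \<le> \<delta>\<close> by (simp add: dist_norm)
      have eq: "\<Theta> y - z = (\<Sum>a\<in>A. (b a \<bullet> v - G a y) *\<^sub>R r a)"
      proof -
        have "\<Theta> y - z = v - (\<Sum>a\<in>A. G a y *\<^sub>R r a)" by (simp add: \<Theta>_def v)
        also have "\<dots> = (\<Sum>a\<in>A. (b a \<bullet> v) *\<^sub>R r a) - (\<Sum>a\<in>A. G a y *\<^sub>R r a)" using Tr[OF v(1)] by simp
        finally show ?thesis by (simp add: sum_subtractf scaleR_diff_left)
      qed
      have small: "\<bar>b a \<bullet> v - G a y\<bar> \<le> 2 * \<epsilon> * \<delta>1" if "a \<in> A" for a
      proof -
        have "\<bar>F a y - b a \<bullet> v\<bar> \<le> \<epsilon> * norm v"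
          using d(2)[OF that, of y] \<delta>1d[OF that] v by simp
        also have "\<dots> \<le> \<epsilon> * \<delta>1" using v \<epsilon> by simp
        finally show ?thesis using G that yd by (force simp: \<eta>_def)
      qed
      have "norm (\<Theta> y - z) \<le> (\<Sum>a\<in>A. 2 * \<epsilon> * \<delta>1 * norm (r a))"
        unfolding eq by (rule sum_norm_le) (auto intro: mult_right_mono small)
      also have "\<dots> \<le> 2 * \<epsilon> * \<delta>1 * K"
        unfolding sum_distrib_left[symmetric] using K \<epsilon> \<open>\<delta>1 > 0\<close> by (intro mult_left_mono) auto
      also have "\<dots> = \<delta>1" using K by (simp add: \<epsilon>_def)
      finally have "\<Theta> y \<in> cball z \<delta>1" by (simp add: dist_norm norm_minus_commute)
      moreover have "\<Theta> y - z \<in> T" unfolding eq T_def by (intro span_sum span_scale span_base) auto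
      then have "\<Theta> y \<in> (+) z ` T" by (intro image_eqI[of _ _ "\<Theta> y - z"]) auto
      ultimately show "\<Theta> y \<in> D" by (simp add: D_def)
    qed
    ultimately obtain y where y: "y \<in> D" "\<Theta> y = y" using brouwer[of D \<Theta>] by blast
    have 0: "(\<Sum>a\<in>A. G a y *\<^sub>R r a) = 0" using y(2) by (simp add: \<Theta>_def)
    have "G a y = 0" if a: "a \<in> A" for a
    proof -
      have "b a \<bullet> (\<Sum>a\<in>A. G a y *\<^sub>R r a) = (\<Sum>a'\<in>A. if a' = a then G a' y else 0)"
        unfolding inner_sum_right using r a by (intro sum.cong) auto
      then show ?thesis using fin a 0 by simp
    qed
    then show "\<exists>y\<in>cball z \<delta>. \<forall>a\<in>A. G a y = 0"
      using y(1) \<open>\<delta>1 \<le> \<delta>\<close> by (intro bexI[of _ y]) (auto simp: D_def)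
  qed
qed

text \<open>One number bounds both the values and the Lipschitz constant on the cube of radius
  \<open>R\<close>, because the product case of the induction needs the two together.\<close>

definition lipschitz_bound :: "(real, 'v) pex \<Rightarrow> real \<Rightarrow> real \<Rightarrow> bool" where
  "lipschitz_bound e R K \<longleftrightarrow> K \<ge> 0 \<and> (\<forall>x y t. (\<forall>u\<in>pvars e. \<bar>x u\<bar> \<le> R \<and> \<bar>y u\<bar> \<le> R \<and> \<bar>x u - y u\<bar> \<le> t) \<longrightarrow> 0 \<le> t \<longrightarrow>
      \<bar>peval e x\<bar> \<le> K \<and> \<bar>peval e y\<bar> \<le> K \<and> \<bar>peval e x - peval e y\<bar> \<le> K * t)"

lemma lipschitz_boundD:
  assumes "lipschitz_bound e R K" "\<forall>u\<in>pvars e. \<bar>x u\<bar> \<le> R \<and> \<bar>y u\<bar> \<le> R \<and> \<bar>x u - y u\<bar> \<le> t" "0 \<le> t"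
  shows "\<bar>peval e x\<bar> \<le> K" "\<bar>peval e y\<bar> \<le> K" "\<bar>peval e x - peval e y\<bar> \<le> K * t"
  using assms unfolding lipschitz_bound_def by blast+

lemma peval_lipschitz: "\<exists>K. lipschitz_bound e R K"
proof (induction e)
  case (Cst c)
  show ?case by (intro exI[of _ "\<bar>c\<bar>"]) (auto simp: lipschitz_bound_def)
next
  case (Var v)
  have "t \<le> max 1 \<bar>R\<bar> * t" if "0 \<le> t" for t using mult_right_mono[of 1 "max 1 \<bar>R\<bar>" t] that by simp
  then show ?case unfolding lipschitz_bound_def by (intro exI[of _ "max 1 \<bar>R\<bar>"]) (fastforce intro: order_trans)
next
  case (Add a b)
  then obtain K L where KL: "lipschitz_bound a R K" "lipschitz_bound b R L" by blast
  then have K: "K \<ge> 0" and L: "L \<ge> 0" by (auto simp: lipschitz_bound_def)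
  show ?case
    unfolding lipschitz_bound_def
  proof (intro exI[of _ "K + L"] conjI allI impI)
    fix x y :: "'a \<Rightarrow> real" and t :: real
    assume h: "\<forall>u\<in>pvars (Add a b). \<bar>x u\<bar> \<le> R \<and> \<bar>y u\<bar> \<le> R \<and> \<bar>x u - y u\<bar> \<le> t" "0 \<le> t"
    have 1: "\<bar>peval a x\<bar> \<le> K" "\<bar>peval a y\<bar> \<le> K" "\<bar>peval a x - peval a y\<bar> \<le> K * t" using lipschitz_boundD[OF KL(1), of x y t] h by auto
    have 2: "\<bar>peval b x\<bar> \<le> L" "\<bar>peval b y\<bar> \<le> L" "\<bar>peval b x - peval b y\<bar> \<le> L * t" using lipschitz_boundD[OF KL(2), of x y t] h by auto
    show "\<bar>peval (Add a b) x\<bar> \<le> K + L" "\<bar>peval (Add a b) y\<bar> \<le> K + L" using 1 2 by auto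
    show "\<bar>peval (Add a b) x - peval (Add a b) y\<bar> \<le> (K + L) * t" using 1(3) 2(3) by (simp add: algebra_simps abs_le_iff)
  qed (use K L in auto)
next
  case (Mul a b)
  then obtain K L where KL: "lipschitz_bound a R K" "lipschitz_bound b R L" by blast
  then have K: "K \<ge> 0" and L: "L \<ge> 0" by (auto simp: lipschitz_bound_def)
  show ?case
    unfolding lipschitz_bound_def
  proof (intro exI[of _ "2 * K * L"] conjI allI impI)
    fix x y :: "'a \<Rightarrow> real" and t :: real
    assume h: "\<forall>u\<in>pvars (Mul a b). \<bar>x u\<bar> \<le> R \<and> \<bar>y u\<bar> \<le> R \<and> \<bar>x u - y u\<bar> \<le> t" "0 \<le> t"
    have 1: "\<bar>peval a x\<bar> \<le> K" "\<bar>peval a y\<bar> \<le> K" "\<bar>peval a x - peval a y\<bar> \<le> K * t" using lipschitz_boundD[OF KL(1), of x y t] h by auto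
    have 2: "\<bar>peval b x\<bar> \<le> L" "\<bar>peval b y\<bar> \<le> L" "\<bar>peval b x - peval b y\<bar> \<le> L * t" using lipschitz_boundD[OF KL(2), of x y t] h by auto
    have "\<bar>peval a x * peval b x\<bar> \<le> K * L" "\<bar>peval a y * peval b y\<bar> \<le> K * L"
      unfolding abs_mult using 1 2 K L by (auto intro!: mult_mono)
    moreover have "0 \<le> K * L" using K L by simp
    ultimately show "\<bar>peval (Mul a b) x\<bar> \<le> 2 * K * L" "\<bar>peval (Mul a b) y\<bar> \<le> 2 * K * L" by auto
    have "peval (Mul a b) x - peval (Mul a b) y = (peval a x - peval a y) * peval b x + peval a y * (peval b x - peval b y)"
      by (simp add: algebra_simps)
    also have "\<bar>\<dots>\<bar> \<le> \<bar>(peval a x - peval a y) * peval b x\<bar> + \<bar>peval a y * (peval b x - peval b y)\<bar>" by (rule abs_triangle_ineq)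
    also have "\<dots> \<le> (K * t) * L + K * (L * t)"
      unfolding abs_mult using 1 2 K L h(2) by (intro add_mono mult_mono) auto
    finally show "\<bar>peval (Mul a b) x - peval (Mul a b) y\<bar> \<le> 2 * K * L * t" by (simp add: algebra_simps)
  qed (use K L in auto)
qed

lemma continuous_on_peval:
  "(\<And>u. u \<in> pvars e \<Longrightarrow> continuous_on S (\<lambda>y. G y u)) \<Longrightarrow> continuous_on S (\<lambda>y. peval e (G y))"
  by (induction e) (auto intro!: continuous_intros)

text \<open>A small change of the jet \<open>J\<close> changes the equations little, so
  \<open>robust_zero\<close> finds a common zero for \<open>G\<close>; there \<open>G\<close> is
  still close to \<open>x\<close>, where the equations force membership in \<open>S\<close>.\<close>

theorem robust_intersection:
  fixes J :: "real^'n \<Rightarrow> 'v \<Rightarrow> real"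
  assumes finV: "finite V" and finA: "finite A" and fV: "\<And>a. a \<in> A \<Longrightarrow> pvars (f a) \<subseteq> V"
    and Jx: "\<And>u. u \<in> V \<Longrightarrow> J z u = x u" and Jc: "\<And>u. u \<in> V \<Longrightarrow> continuous_on UNIV (\<lambda>y. J y u)"
    and f0: "\<And>a. a \<in> A \<Longrightarrow> peval (f a) x = 0"
    and f': "\<And>a. a \<in> A \<Longrightarrow> ((\<lambda>y. peval (f a) (J y)) has_derivative (\<lambda>h. b a \<bullet> h)) (at z)"
    and ind: "\<And>c. (\<Sum>a\<in>A. c a *\<^sub>R b a) = 0 \<Longrightarrow> \<forall>a\<in>A. c a = 0"
    and \<epsilon>: "\<epsilon> > 0"
    and S: "\<And>y. y \<in> coord_space V \<Longrightarrow> (\<forall>u\<in>V. \<bar>y u - x u\<bar> < \<epsilon>) \<Longrightarrow> (\<forall>a\<in>A. peval (f a) y = 0) \<Longrightarrow> y \<in> S"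
    and \<delta>: "\<delta> > 0"
  shows "\<exists>\<eta>>0. \<forall>G. (\<forall>y. G y \<in> coord_space V) \<longrightarrow> (\<forall>u\<in>V. continuous_on (cball z \<delta>) (\<lambda>y. G y u)) \<longrightarrow>
     (\<forall>y\<in>cball z \<delta>. \<forall>u\<in>V. \<bar>G y u - J y u\<bar> < \<eta>) \<longrightarrow> (\<exists>y\<in>cball z \<delta>. G y \<in> S)"
proof -
  have "\<exists>d>0. \<forall>y. dist y z < d \<longrightarrow> \<bar>J y u - x u\<bar> < \<epsilon> / 2" if "u \<in> V" for u
    using Jc[OF that] \<epsilon> Jx[OF that] unfolding continuous_on_iff dist_real_def by (metis UNIV_I half_gt_zero)
  then obtain d where d: "\<And>u. u \<in> V \<Longrightarrow> d u > 0" "\<And>u y. u \<in> V \<Longrightarrow> dist y z < d u \<Longrightarrow> \<bar>J y u - x u\<bar> < \<epsilon> / 2" by metis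
  define \<delta>0 where "\<delta>0 = Min (insert \<delta> ((\<lambda>u. d u / 2) ` V))"
  have "\<delta>0 > 0" unfolding \<delta>0_def using finV d(1) \<delta> by (subst Min_gr_iff) auto
  have "\<delta>0 \<le> \<delta>" unfolding \<delta>0_def using finV by (intro Min_le) auto
  have Jnear: "\<bar>J y u - x u\<bar> < \<epsilon> / 2" if "u \<in> V" "y \<in> cball z \<delta>0" for u y
  proof -
    have "\<delta>0 \<le> d u / 2" unfolding \<delta>0_def using finV that by (intro Min_le) auto
    then show ?thesis using d[OF that(1)] that(2) by (auto simp: dist_commute)
  qed
  have "peval (f a) (J z) = 0" if "a \<in> A" for a
    using peval_cong[of "f a" "J z" x] Jx fV[OF that] f0[OF that] by auto
  then have "\<exists>\<eta>1>0. \<forall>G. (\<forall>a\<in>A. continuous_on (cball z \<delta>0) (G a) \<and> (\<forall>y\<in>cball z \<delta>0. \<bar>G a y - peval (f a) (J y)\<bar> < \<eta>1)) \<longrightarrow>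
      (\<exists>y\<in>cball z \<delta>0. \<forall>a\<in>A. G a y = 0)"
    by (intro robust_zero[where b = b] finA f' ind \<open>\<delta>0 > 0\<close>)
  then obtain \<eta>1 where "\<eta>1 > 0"
    and \<eta>1a: "\<forall>G. (\<forall>a\<in>A. continuous_on (cball z \<delta>0) (G a) \<and> (\<forall>y\<in>cball z \<delta>0. \<bar>G a y - peval (f a) (J y)\<bar> < \<eta>1)) \<longrightarrow>
      (\<exists>y\<in>cball z \<delta>0. \<forall>a\<in>A. G a y = 0)" by blast
  then have \<eta>1: "\<eta>1 > 0" "\<And>G. (\<forall>a\<in>A. continuous_on (cball z \<delta>0) (G a) \<and>
      (\<forall>y\<in>cball z \<delta>0. \<bar>G a y - peval (f a) (J y)\<bar> < \<eta>1)) \<Longrightarrow> (\<exists>y\<in>cball z \<delta>0. \<forall>a\<in>A. G a y = 0)"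
    by simp_all
  define R where "R = (\<Sum>u\<in>V. \<bar>x u\<bar>) + \<epsilon>"
  have xR: "\<bar>x u\<bar> + \<epsilon> \<le> R" if "u \<in> V" for u
    using member_le_sum[of u V "\<lambda>u. \<bar>x u\<bar>"] finV that by (auto simp: R_def)
  obtain K where K0: "\<And>a. lipschitz_bound (f a) R (K a)"
    using peval_lipschitz[of "f _" R] by metis
  then have K: "\<And>a. K a \<ge> 0" by (auto simp: lipschitz_bound_def)
  \<comment> \<open>The summand 1 keeps \<open>L\<close> positive and makes the final estimate
    strict even if all Lipschitz constants vanish.\<close>
  define L where "L = (\<Sum>a\<in>A. K a) + 1"
  have L: "L > 0" "\<And>a. a \<in> A \<Longrightarrow> K a \<le> L - 1"
    unfolding L_def using K finA by (auto intro!: add_nonneg_pos sum_nonneg member_le_sum)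
  \<comment> \<open>Half of \<open>\<epsilon>\<close> leaves room for the variation of
    \<open>J\<close> itself on the ball; \<open>\<eta>1 / L\<close> is what the equations
    tolerate.\<close>
  define \<eta> where "\<eta> = min (\<epsilon> / 2) (\<eta>1 / L)"
  have "\<eta> > 0" using \<epsilon> \<eta>1(1) L by (simp add: \<eta>_def)
  have \<eta>le: "\<eta> \<le> \<epsilon> / 2" unfolding \<eta>_def by (rule min.cobounded1)
  show ?thesis
  proof (intro exI[of _ \<eta>] conjI allI impI \<open>\<eta> > 0\<close>)
    fix G assume G: "\<forall>y. G y \<in> coord_space V" "\<forall>u\<in>V. continuous_on (cball z \<delta>) (\<lambda>y. G y u)"
      "\<forall>y\<in>cball z \<delta>. \<forall>u\<in>V. \<bar>G y u - J y u\<bar> < \<eta>"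
    have sub: "cball z \<delta>0 \<subseteq> cball z \<delta>" using \<open>\<delta>0 \<le> \<delta>\<close> by auto
    have GJ: "\<bar>G y u - J y u\<bar> < \<eta>" if "y \<in> cball z \<delta>0" "u \<in> V" for y u using G(3) that sub by blast
    have "\<exists>y\<in>cball z \<delta>0. \<forall>a\<in>A. peval (f a) (G y) = 0"
    proof (rule \<eta>1(2), intro ballI conjI)
      fix a assume a: "a \<in> A"
      show "continuous_on (cball z \<delta>0) (\<lambda>y. peval (f a) (G y))"
        using G(2) fV[OF a] sub by (intro continuous_on_peval) (blast intro: continuous_on_subset)
      fix y assume y: "y \<in> cball z \<delta>0"
      have "\<bar>peval (f a) (G y) - peval (f a) (J y)\<bar> \<le> K a * \<eta>"
      proof (rule lipschitz_boundD(3)[OF K0], rule ballI)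
        fix u assume "u \<in> pvars (f a)"
        then have u: "u \<in> V" using fV[OF a] by auto
        have "\<bar>J y u - x u\<bar> < \<epsilon> / 2" "\<bar>G y u - J y u\<bar> < \<eta>" "\<eta> \<le> \<epsilon> / 2"
          using Jnear[OF u y] GJ[OF y u] \<eta>le by simp_all
        moreover have "\<bar>J y u\<bar> \<le> \<bar>x u\<bar> + \<bar>J y u - x u\<bar>" "\<bar>G y u\<bar> \<le> \<bar>J y u\<bar> + \<bar>G y u - J y u\<bar>" by auto
        ultimately show "\<bar>G y u\<bar> \<le> R \<and> \<bar>J y u\<bar> \<le> R \<and> \<bar>G y u - J y u\<bar> \<le> \<eta>" using xR[OF u] \<epsilon>
          by (intro conjI) linarith+
      qed (use \<open>\<eta> > 0\<close> in auto)
      also have "K a * \<eta> \<le> (L - 1) * \<eta>" using L(2)[OF a] \<open>\<eta> > 0\<close> by simp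
      also have "\<dots> < L * \<eta>" using \<open>\<eta> > 0\<close> by (simp add: algebra_simps)
      also have "\<dots> \<le> L * (\<eta>1 / L)" using L by (intro mult_left_mono) (auto simp: \<eta>_def)
      also have "\<dots> = \<eta>1" using L by simp
      finally show "\<bar>peval (f a) (G y) - peval (f a) (J y)\<bar> < \<eta>1" .
    qed
    then obtain y where y: "y \<in> cball z \<delta>0" "\<forall>a\<in>A. peval (f a) (G y) = 0" by blast
    have "\<bar>G y u - x u\<bar> < \<epsilon>" if u: "u \<in> V" for u
    proof -
      have "\<bar>J y u - x u\<bar> < \<epsilon> / 2" "\<bar>G y u - J y u\<bar> < \<eta>" "\<eta> \<le> \<epsilon> / 2"
        using Jnear[OF u y(1)] GJ[OF y(1) u] \<eta>le by simp_all
      then show ?thesis by linarith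
    qed
    then have "G y \<in> S" using y G(1) by (intro S) auto
    then show "\<exists>y\<in>cball z \<delta>. G y \<in> S" using y(1) sub by blast
  qed
qed

section \<open>Homogeneous polynomials on the sphere\<close>

text \<open>The odd-multiple analogue of Chebyshev polynomials: \<open>csin k\<close> expresses the
  sine of \<open>2 * k + 1\<close> times an angle through its sine. The recurrence is a
  sum-to-product formula, with \<open>1 - 2 * x\<^sup>2\<close> the cosine of the double
  angle.\<close>

fun csin :: "nat \<Rightarrow> real \<Rightarrow> real" where
  "csin 0 x = x"
| "csin (Suc 0) x = 3 * x - 4 * x ^ 3"
| "csin (Suc (Suc k)) x = 2 * (1 - 2 * x\<^sup>2) * csin (Suc k) x - csin k x"

lemma csin_sin: "csin k (sin a) = sin (real (2 * k + 1) * a)"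
proof (induction k "sin a" rule: csin.induct)
  case 1
  show ?case by simp
next
  case 2
  have "sin (3 * a) = sin (2 * a + a)" by (simp add: algebra_simps)
  also have "\<dots> = 2 * sin a * (cos a * cos a) + (1 - 2 * (sin a)\<^sup>2) * sin a"
    by (subst sin_add) (simp add: sin_double cos_double_sin)
  also have "cos a * cos a = 1 - (sin a)\<^sup>2" using sin_cos_squared_add[of a] by (simp add: power2_eq_square)
  also have "2 * sin a * (1 - (sin a)\<^sup>2) + (1 - 2 * (sin a)\<^sup>2) * sin a = 3 * sin a - 4 * sin a ^ 3"
    by (simp add: algebra_simps power2_eq_square power3_eq_cube)
  finally show ?case by simp
next
  case (3 k)
  let ?b = "real (2 * Suc k + 1) * a"
  have "sin (?b + 2 * a) + sin (?b - 2 * a) = 2 * cos (2 * a) * sin ?b"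
    by (simp add: sin_add sin_diff)
  moreover have "?b + 2 * a = real (2 * Suc (Suc k) + 1) * a" "?b - 2 * a = real (2 * k + 1) * a"
    by (simp_all add: algebra_simps)
  ultimately have "sin (real (2 * Suc (Suc k) + 1) * a) = 2 * cos (2 * a) * sin ?b - sin (real (2 * k + 1) * a)"
    by simp
  then show ?case using 3 by (simp add: cos_double_sin)
qed

section \<open>Homogeneous forms and parity of degrees\<close>

definition xpow :: "('m::finite \<Rightarrow> nat) \<Rightarrow> real^'m \<Rightarrow> real" where
  "xpow \<alpha> x = (\<Prod>i\<in>UNIV. (x $ i) ^ \<alpha> i)"

inductive hom_fn :: "nat \<Rightarrow> (real^'m::finite \<Rightarrow> real) \<Rightarrow> bool" for d where
  zero: "hom_fn d (\<lambda>_. 0)"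
| plus: "hom_fn d f \<Longrightarrow> \<alpha> \<in> monomials d \<Longrightarrow> hom_fn d (\<lambda>x. f x + a * xpow \<alpha> x)"

lemma finite_monomials: "finite (monomials d :: ('m::finite \<Rightarrow> nat) set)"
  unfolding monomials_def by (rule finite_multiindices)

lemma hom_fn_coeffs:
  assumes "hom_fn d f"
  shows "\<exists>c. (\<forall>\<alpha>. \<alpha> \<notin> monomials d \<longrightarrow> c \<alpha> = 0) \<and> (\<forall>x. f x = (\<Sum>\<alpha>\<in>monomials d. c \<alpha> * xpow \<alpha> x))"
  using assms
proof induction
  case zero
  show ?case by (intro exI[of _ "\<lambda>_. 0"]) auto
next
  case (plus f \<alpha> a)
  then obtain c where c: "\<And>\<alpha>. \<alpha> \<notin> monomials d \<Longrightarrow> c \<alpha> = 0" "\<And>x. f x = (\<Sum>\<alpha>\<in>monomials d. c \<alpha> * xpow \<alpha> x)"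
    by auto
  have "(\<Sum>\<beta>\<in>monomials d. (c(\<alpha> := c \<alpha> + a)) \<beta> * xpow \<beta> x) = f x + a * xpow \<alpha> x" for x
  proof -
    have "(\<Sum>\<beta>\<in>monomials d. (c(\<alpha> := c \<alpha> + a)) \<beta> * xpow \<beta> x) =
        (\<Sum>\<beta>\<in>monomials d. c \<beta> * xpow \<beta> x + (if \<beta> = \<alpha> then a * xpow \<alpha> x else 0))"
      by (rule sum.cong) (auto simp: algebra_simps)
    then show ?thesis using plus(2) by (simp add: sum.distrib c finite_monomials)
  qed
  then show ?case using c plus(2) by (intro exI[of _ "c(\<alpha> := c \<alpha> + a)"]) auto
qed

lemma hom_fn_add: "hom_fn d g \<Longrightarrow> hom_fn d f \<Longrightarrow> hom_fn d (\<lambda>x. f x + g x)"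
proof (induction rule: hom_fn.induct)
  case (plus g \<alpha> a)
  then have "hom_fn d (\<lambda>x. (f x + g x) + a * xpow \<alpha> x)" by (intro hom_fn.plus) auto
  then show ?case by (simp add: add.assoc)
qed simp

lemma xpow_add: "xpow (\<lambda>i. \<alpha> i + \<beta> i) x = xpow \<alpha> x * xpow \<beta> x"
  by (simp add: xpow_def power_add prod.distrib)

lemma hom_fn_xpow_mult:
  assumes "hom_fn e g" "\<alpha> \<in> monomials d"
  shows "hom_fn (d + e) (\<lambda>x. a * xpow \<alpha> x * g x)"
  using assms(1)
proof induction
  case zero
  show ?case by (simp add: hom_fn.zero)
next
  case (plus g \<beta> b)
  have "(\<lambda>i. \<alpha> i + \<beta> i) \<in> monomials (d + e)" using assms(2) plus(2) by (simp add: monomials_def sum.distrib)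
  from hom_fn.plus[OF plus.IH this, of "a * b"] show ?case by (simp add: xpow_add algebra_simps)
qed

lemma hom_fn_mult: "hom_fn d f \<Longrightarrow> hom_fn e g \<Longrightarrow> hom_fn (d + e) (\<lambda>x. f x * g x)"
proof (induction rule: hom_fn.induct)
  case zero
  then show ?case by (simp add: hom_fn.zero)
next
  case (plus f \<alpha> a)
  then show ?case using hom_fn_add[OF hom_fn_xpow_mult[OF plus(4,2), of a] plus(3)[OF plus(4)]]
    by (simp add: algebra_simps)
qed

lemma hom_fn_coord: "hom_fn 1 (\<lambda>x. x $ i)"
proof -
  let ?\<alpha> = "\<lambda>l. if l = i then 1 else 0 :: nat"
  have "?\<alpha> \<in> monomials 1" by (simp add: monomials_def)
  moreover have "xpow ?\<alpha> x = x $ i" for x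
  proof -
    have "xpow ?\<alpha> x = (\<Prod>l\<in>UNIV. if l = i then x $ l else 1)" unfolding xpow_def by (rule prod.cong) auto
    then show ?thesis by simp
  qed
  ultimately show ?thesis using hom_fn.plus[OF hom_fn.zero, of ?\<alpha> 1 1] by simp
qed

lemma hom_fn_const: "hom_fn 0 (\<lambda>_. c)"
proof -
  have "(\<lambda>_. 0) \<in> monomials 0" by (simp add: monomials_def)
  from hom_fn.plus[OF hom_fn.zero this, of c] show ?thesis by (simp add: xpow_def)
qed

lemma hom_fn_sum: "finite I \<Longrightarrow> (\<And>i. i \<in> I \<Longrightarrow> hom_fn d (f i)) \<Longrightarrow> hom_fn d (\<lambda>x. \<Sum>i\<in>I. f i x)"
  by (induction I rule: finite_induct) (auto intro: hom_fn.zero hom_fn_add)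

text \<open>Only the restriction to the sphere matters, so \<open>d\<close> is not determined by
  \<open>f\<close>: multiplying by the squared norm, which is 1 there, raises it by 2.\<close>

definition sph :: "nat \<Rightarrow> (real^'m::finite \<Rightarrow> real) \<Rightarrow> bool" where
  "sph d f \<longleftrightarrow> (\<exists>g. hom_fn d g \<and> (\<forall>x\<in>sphere_set. f x = g x))"

lemma sphI: "hom_fn d f \<Longrightarrow> sph d f"
  by (auto simp: sph_def)

lemma sph_add: "sph d f \<Longrightarrow> sph d g \<Longrightarrow> sph d (\<lambda>x. f x + g x)"
proof -
  assume "sph d f" "sph d g"
  then obtain f' g' where "hom_fn d f'" "hom_fn d g'" "\<And>x. x \<in> sphere_set \<Longrightarrow> f x = f' x" "\<And>x. x \<in> sphere_set \<Longrightarrow> g x = g' x"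
    unfolding sph_def by blast
  then show ?thesis unfolding sph_def by (intro exI[of _ "\<lambda>x. f' x + g' x"]) (simp add: hom_fn_add)
qed

lemma sph_mult: "sph d f \<Longrightarrow> sph e g \<Longrightarrow> sph (d + e) (\<lambda>x. f x * g x)"
proof -
  assume "sph d f" "sph e g"
  then obtain f' g' where "hom_fn d f'" "hom_fn e g'" "\<And>x. x \<in> sphere_set \<Longrightarrow> f x = f' x" "\<And>x. x \<in> sphere_set \<Longrightarrow> g x = g' x"
    unfolding sph_def by blast
  then show ?thesis unfolding sph_def by (intro exI[of _ "\<lambda>x. f' x * g' x"]) (simp add: hom_fn_mult)
qed

lemma sph_cmult: "sph d f \<Longrightarrow> sph d (\<lambda>x. c * f x)"
  using sph_mult[OF sphI[OF hom_fn_const[of c]]] by simp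

lemma sph_one: "sph 2 (\<lambda>_. 1)"
proof -
  have "hom_fn 2 (\<lambda>x::real^'m. \<Sum>i\<in>UNIV. x $ i * x $ i)"
    using hom_fn_mult[OF hom_fn_coord hom_fn_coord] by (intro hom_fn_sum) (auto simp: numeral_2_eq_2)
  moreover have "1 = (\<Sum>i\<in>UNIV. x $ i * x $ i)" if "x \<in> sphere_set" for x :: "real^'m"
    using that by (simp add: sphere_set_def norm_eq_1 inner_vec_def)
  ultimately show ?thesis unfolding sph_def by blast
qed

lemma sph_lift: "sph d f \<Longrightarrow> sph (d + 2) f"
  using sph_mult[OF _ sph_one, of d f] by simp

lemma sph_lift_even: "sph d f \<Longrightarrow> sph (d + 2 * k) f"
  by (induction k) (use sph_lift in \<open>force simp: algebra_simps\<close>)+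

lemma sph_lift_parity:
  assumes "sph d f" "d \<le> d'" "d' mod 2 = d mod 2"
  shows "sph d' f"
proof -
  have "even (d' - d)" using assms(2,3) by (metis dvd_minus_mod even_iff_mod_2_eq_zero mod_eq_dvd_iff_nat)
  then obtain k where "d' = d + 2 * k" using assms(2) by (metis dvdE le_add_diff_inverse)
  then show ?thesis using sph_lift_even[OF assms(1)] by simp
qed

text \<open>The recurrence becomes homogeneous on the sphere: \<open>1 - 2 * x\<^sup>2\<close> is a
  quadratic form there, and the term \<open>csin k\<close>, of degree four less, is lifted by the
  squared norm twice.\<close>

lemma sph_csin: "sph (2 * k + 1) (\<lambda>x. csin k (x $ i))"
proof (induction k "0::real" rule: csin.induct)
  case 1
  show ?case using sphI[OF hom_fn_coord[of i]] by simp
next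
  case 2
  have x: "sph 1 (\<lambda>x. x $ i)" by (rule sphI[OF hom_fn_coord])
  have x3: "sph 3 (\<lambda>x. x $ i * (x $ i * x $ i))"
    using sph_mult[OF x sph_mult[OF x x]] by (simp add: numeral_3_eq_3)
  have "sph 3 (\<lambda>x. 3 * x $ i + (-4) * (x $ i * (x $ i * x $ i)))"
    using sph_lift[OF x] by (intro sph_add sph_cmult x3) (simp add: numeral_3_eq_3)
  then show ?case by (simp add: power3_eq_cube mult.assoc)
next
  case (3 k)
  have x: "sph 1 (\<lambda>x. x $ i)" by (rule sphI[OF hom_fn_coord])
  have "sph 2 (\<lambda>x. x $ i * x $ i)" using sph_mult[OF x x] by (simp add: numeral_2_eq_2)
  then have "sph 2 (\<lambda>x. 1 + (-2) * (x $ i * x $ i))" by (intro sph_add sph_one sph_cmult)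
  from sph_mult[OF this 3(1)]
  have A: "sph (2 * Suc (Suc k) + 1) (\<lambda>x. 2 * ((1 + (-2) * (x $ i * x $ i)) * csin (Suc k) (x $ i)))"
    by (intro sph_cmult) (simp add: algebra_simps)
  have "sph (2 * Suc (Suc k) + 1) (\<lambda>x. csin k (x $ i))"
  proof -
    have "2 * Suc (Suc k) + 1 = 2 * k + 1 + 2 * 2" by simp
    then show ?thesis using sph_lift_even[OF 3(2), of 2] by (simp only:)
  qed
  from sph_add[OF A sph_cmult[OF this, of "-1"]] show ?case
    by (simp add: power2_eq_square algebra_simps)
qed

text \<open>Quantifies over all large degrees of one parity at once, so that sums and products do
  not have to match degrees.\<close>

definition parsph :: "nat \<Rightarrow> nat \<Rightarrow> (real^'m::finite \<Rightarrow> real) \<Rightarrow> bool" where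
  "parsph e N f \<longleftrightarrow> (\<forall>d\<ge>N. d mod 2 = e mod 2 \<longrightarrow> sph d f)"

lemma parsph_mono: "parsph e N f \<Longrightarrow> N \<le> N' \<Longrightarrow> parsph e N' f"
  by (auto simp: parsph_def)

lemma parsph_add: "parsph e N f \<Longrightarrow> parsph e N g \<Longrightarrow> parsph e N (\<lambda>x. f x + g x)"
  by (auto simp: parsph_def sph_add)

lemma parsph_mult:
  assumes "parsph e N f" "parsph e' N' g"
  shows "parsph (e + e') (N + N' + 1) (\<lambda>x. f x * g x)"
  unfolding parsph_def
proof (intro allI impI)
  fix d assume d: "d \<ge> N + N' + 1" "d mod 2 = (e + e') mod 2"
  \<comment> \<open>The least degree from \<open>N\<close> on with the parity of \<open>e\<close>;
    this possible shift by one is the reason for the extra 1 in the threshold.\<close>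
  define d1 where "d1 = (if N mod 2 = e mod 2 then N else N + 1)"
  have d1: "d1 mod 2 = e mod 2" "N \<le> d1" "d1 \<le> N + 1" by (auto simp: d1_def mod_Suc)
  obtain q where q: "d = d1 + q" using le_Suc_ex[of d1 d] d(1) d1(3) by auto
  have par: "a mod 2 = b mod 2 \<longleftrightarrow> (even a \<longleftrightarrow> even b)" for a b :: nat by (simp add: mod2_eq_if)
  have "q mod 2 = e' mod 2" using d(2) d1(1) unfolding q par by auto
  then have "(d - d1) mod 2 = e' mod 2" by (simp add: q)
  then have "sph d1 f" "sph (d - d1) g" using assms d d1 by (auto simp: parsph_def)
  from sph_mult[OF this] show "sph d (\<lambda>x. f x * g x)" using d d1 by simp
qed

text \<open>Polynomials that are even or odd under a change of sign of all variables. The index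
  counts only modulo 2, see rule \<open>par\<close>; it is not a degree.\<close>

inductive parpoly :: "nat \<Rightarrow> (real^'n::finite \<Rightarrow> real) \<Rightarrow> bool" where
  const: "parpoly 0 (\<lambda>_. c)"
| coord: "parpoly 1 (\<lambda>s. s $ i)"
| add: "parpoly e F \<Longrightarrow> parpoly e G \<Longrightarrow> parpoly e (\<lambda>s. F s + G s)"
| mul: "parpoly e F \<Longrightarrow> parpoly e' G \<Longrightarrow> parpoly (e + e') (\<lambda>s. F s * G s)"
| par: "parpoly e F \<Longrightarrow> e mod 2 = e' mod 2 \<Longrightarrow> parpoly e' F"

text \<open>The point is that \<open>N\<close> depends on \<open>F\<close> alone and not on
  \<open>k\<close>: the threshold degree is linear in \<open>2 * k + 1\<close>, which allows a
  number of charts proportional to \<open>d ^ n\<close>.\<close>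

lemma parpoly_sphere:
  fixes \<iota> :: "'n::finite \<Rightarrow> 'm::finite"
  assumes "parpoly e F"
  shows "\<exists>N. \<forall>k. parsph e (N * (2 * k + 1)) (\<lambda>x. F (\<chi> i. csin k (x $ \<iota> i)))"
  using assms
proof induction
  case (const c)
  have "parsph 0 0 (\<lambda>_ :: real^'m. c)"
    unfolding parsph_def by (auto intro: sph_lift_parity[OF sphI[OF hom_fn_const]])
  then show ?case by (intro exI[of _ 0]) simp
next
  case (coord i)
  have "parsph 1 (2 * k + 1) (\<lambda>x :: real^'m. csin k (x $ \<iota> i))" for k
    unfolding parsph_def by (auto intro: sph_lift_parity[OF sph_csin])
  then show ?case by (intro exI[of _ 1]) simp
next
  case (add e F G)
  then obtain N M where *: "\<And>k. parsph e (N * (2 * k + 1)) (\<lambda>x. F (\<chi> i. csin k (x $ \<iota> i)))"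
    "\<And>k. parsph e (M * (2 * k + 1)) (\<lambda>x. G (\<chi> i. csin k (x $ \<iota> i)))" by auto
  show ?case
    by (intro exI[of _ "N + M"] allI parsph_add parsph_mono[OF *(1)] parsph_mono[OF *(2)] mult_le_mono1) simp_all
next
  case (mul e F e' G)
  then obtain N M where *: "\<And>k. parsph e (N * (2 * k + 1)) (\<lambda>x. F (\<chi> i. csin k (x $ \<iota> i)))"
    "\<And>k. parsph e' (M * (2 * k + 1)) (\<lambda>x. G (\<chi> i. csin k (x $ \<iota> i)))" by auto
  show ?case
  proof (intro exI[of _ "N + M + 1"] allI)
    fix k
    show "parsph (e + e') ((N + M + 1) * (2 * k + 1)) (\<lambda>x. F (\<chi> i. csin k (x $ \<iota> i)) * G (\<chi> i. csin k (x $ \<iota> i)))"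
      by (rule parsph_mono[OF parsph_mult[OF *]]) (simp add: algebra_simps)
  qed
next
  case (par e F e')
  then show ?case by (simp add: parsph_def)
qed

theorem parpoly_realised:
  fixes \<iota> :: "'n::finite \<Rightarrow> 'm::finite" and F :: "'k::finite \<Rightarrow> real^'n \<Rightarrow> real"
  assumes "\<And>j. parpoly e (F j)"
  shows "\<exists>N. \<forall>k d. N * (2 * k + 1) \<le> d \<longrightarrow> d mod 2 = e mod 2 \<longrightarrow>
    (\<exists>c\<in>coeff_space d. \<forall>x\<in>sphere_set. \<forall>j. poly_map d c x $ j = F j (\<chi> i. csin k (x $ \<iota> i)))"
proof -
  obtain N where N: "\<And>j k. parsph e (N j * (2 * k + 1)) (\<lambda>x. F j (\<chi> i. csin k (x $ \<iota> i)))"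
    using parpoly_sphere[OF assms] by metis
  define M where "M = (\<Sum>j\<in>UNIV. N j)"
  have "N j \<le> M" for j unfolding M_def by (rule member_le_sum) auto
  then have M: "parsph e (M * (2 * k + 1)) (\<lambda>x. F j (\<chi> i. csin k (x $ \<iota> i)))" for j k
    by (rule parsph_mono[OF N mult_le_mono1])
  show ?thesis
  proof (intro exI[of _ M] allI impI)
    fix k d assume d: "M * (2 * k + 1) \<le> d" "d mod 2 = e mod 2"
    have "\<exists>c. (\<forall>\<alpha>. \<alpha> \<notin> monomials d \<longrightarrow> c \<alpha> = 0) \<and>
       (\<forall>x\<in>sphere_set. F j (\<chi> i. csin k (x $ \<iota> i)) = (\<Sum>\<alpha>\<in>monomials d. c \<alpha> * xpow \<alpha> x))" for j
    proof -
      have "sph d (\<lambda>x. F j (\<chi> i. csin k (x $ \<iota> i)))" using M[of k j] d unfolding parsph_def by blast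
      then obtain g where "hom_fn d g" "\<forall>x\<in>sphere_set. F j (\<chi> i. csin k (x $ \<iota> i)) = g x" unfolding sph_def by blast
      then show ?thesis using hom_fn_coeffs[of d g] by metis
    qed
    then obtain c where c: "\<And>j \<alpha>. \<alpha> \<notin> monomials d \<Longrightarrow> c j \<alpha> = 0"
      "\<And>j x. x \<in> sphere_set \<Longrightarrow> F j (\<chi> i. csin k (x $ \<iota> i)) = (\<Sum>\<alpha>\<in>monomials d. c j \<alpha> * xpow \<alpha> x)" by metis
    then show "\<exists>c\<in>coeff_space d. \<forall>x\<in>sphere_set. \<forall>j. poly_map d c x $ j = F j (\<chi> i. csin k (x $ \<iota> i))"
      by (intro bexI[of _ c]) (auto simp: coeff_space_def poly_map_def xpow_def)
  qed
qed

section \<open>The zeroth Betti number\<close>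

text \<open>Generators of the free group are carried over by the isomorphism; comparing coefficients
  in the free group shows that they stay independent.\<close>

lemma group_rank_free_le:
  assumes G: "comm_group G" and iso: "G \<cong> free_Abelian_group P" and Q: "finite Q" "Q \<subseteq> P"
  shows "of_nat (card Q) \<le> group_rank G"
proof -
  interpret G: comm_group G by (rule G)
  obtain h where h: "h \<in> iso (free_Abelian_group P) G"
    using group.iso_sym[OF G.is_group iso] by (auto simp: is_iso_def)
  have hom: "h \<in> hom (free_Abelian_group P) G" and inj: "inj_on h (carrier (free_Abelian_group P))"
    using h by (auto simp: iso_def bij_betw_def)
  interpret H: group_hom "free_Abelian_group P" G h
    by (simp add: group_hom_def group_hom_axioms_def hom G.is_group)
  define b where "b q = h (frag_of q)" for q
  have b: "b q \<in> carrier G" if "q \<in> P" for q unfolding b_def by (rule H.hom_closed) (simp add: that)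
  have inj_b: "inj_on b Q"
  proof (rule inj_onI)
    fix q q' assume "q \<in> Q" "q' \<in> Q" "b q = b q'"
    then have "frag_of q = frag_of q'" using inj_onD[OF inj, of "frag_of q" "frag_of q'"] Q by (auto simp: b_def)
    then show "q = q'" by (simp add: frag_of_eq)
  qed
  have prod: "finprod G (\<lambda>q. b q [^]\<^bsub>G\<^esub> (e q :: int)) R = h (\<Sum>q\<in>R. frag_cmul (e q) (frag_of q)) \<and>
     (\<Sum>q\<in>R. frag_cmul (e q) (frag_of q)) \<in> carrier (free_Abelian_group P)" if "R \<subseteq> Q" for R e
    using finite_subset[OF that Q(1)] that
  proof (induction R rule: finite_induct)
    case empty
    then show ?case using H.hom_one by simp
  next
    case (insert q R)
    then have q: "q \<in> P" using Q by auto
    have fq: "frag_of q \<in> carrier (free_Abelian_group P)" using q by simp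
    have cq: "frag_cmul (e q) (frag_of q) \<in> carrier (free_Abelian_group P)"
      using q keys_cmul[of "e q" "frag_of q"] by auto
    have R: "(\<lambda>q. b q [^]\<^bsub>G\<^esub> e q) \<in> R \<rightarrow> carrier G" using insert.prems Q b by auto
    have bq: "b q [^]\<^bsub>G\<^esub> e q = h (frag_cmul (e q) (frag_of q))"
      unfolding b_def using H.hom_int_pow[OF fq, of "e q"] int_pow_free_Abelian_group[of "frag_of q" P "e q"] q
      by simp
    have IH: "finprod G (\<lambda>q. b q [^]\<^bsub>G\<^esub> e q) R = h (\<Sum>q\<in>R. frag_cmul (e q) (frag_of q))"
      "(\<Sum>q\<in>R. frag_cmul (e q) (frag_of q)) \<in> carrier (free_Abelian_group P)"
      using insert by auto
    have "finprod G (\<lambda>q. b q [^]\<^bsub>G\<^esub> e q) (insert q R) = (b q [^]\<^bsub>G\<^esub> e q) \<otimes>\<^bsub>G\<^esub> finprod G (\<lambda>q. b q [^]\<^bsub>G\<^esub> e q) R"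
      using insert R b[OF q] by (intro G.finprod_insert) auto
    also have "\<dots> = h (frag_cmul (e q) (frag_of q) + (\<Sum>q\<in>R. frag_cmul (e q) (frag_of q)))"
      unfolding bq IH(1) using H.hom_mult[OF cq IH(2)] by simp
    finally show ?case using insert H.G.m_closed[OF cq IH(2)] by simp
  qed
  define A where "A = b ` Q"
  have "Z_independent G A"
    unfolding Z_independent_def
  proof (intro conjI allI impI)
    show "finite A" using Q by (simp add: A_def)
    show "A \<subseteq> carrier G" using b Q by (auto simp: A_def)
    fix c :: "'a \<Rightarrow> int" assume "finprod G (\<lambda>a. a [^]\<^bsub>G\<^esub> c a) A = \<one>\<^bsub>G\<^esub>"
    moreover have "finprod G (\<lambda>a. a [^]\<^bsub>G\<^esub> c a) A = finprod G (\<lambda>q. b q [^]\<^bsub>G\<^esub> c (b q)) Q"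
      unfolding A_def using b Q by (intro G.finprod_reindex inj_b) auto
    ultimately have "h (\<Sum>q\<in>Q. frag_cmul (c (b q)) (frag_of q)) = h 0"
      using prod[of Q "\<lambda>q. c (b q)"] H.hom_one by simp
    then have s: "(\<Sum>q\<in>Q. frag_cmul (c (b q)) (frag_of q)) = 0"
      using inj_onD[OF inj] prod[of Q "\<lambda>q. c (b q)"] by (auto simp: free_Abelian_group_def)
    have "c (b q) = 0" if q: "q \<in> Q" for q
    proof -
      have "0 = Poly_Mapping.lookup (\<Sum>q\<in>Q. frag_cmul (c (b q)) (frag_of q)) q" by (simp add: s)
      also have "\<dots> = (\<Sum>q'\<in>Q. if q' = q then c (b q) else 0)"
        unfolding lookup_sum by (intro sum.cong) auto
      also have "\<dots> = c (b q)" using Q q by simp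
      finally show ?thesis by simp
    qed
    then show "\<forall>a\<in>A. c a = 0" by (auto simp: A_def)
  qed
  moreover have "card A = card Q" unfolding A_def by (rule card_image[OF inj_b])
  ultimately show ?thesis unfolding group_rank_def by (intro SUP_upper2[of A]) auto
qed

text \<open>A path component is connected, so it cannot leave a clopen piece, and disjoint pieces
  contain different ones. The zeroth homology is free on path components and is one summand of the
  Betti sum.\<close>

theorem betti_sum_ge_pieces:
  fixes S :: "'a::topological_space set"
  assumes fin: "finite I" and x: "\<And>i. i \<in> I \<Longrightarrow> x i \<in> S \<inter> D i"
    and op: "\<And>i. i \<in> I \<Longrightarrow> openin (top_of_set S) (S \<inter> D i)"
    and cl: "\<And>i. i \<in> I \<Longrightarrow> closedin (top_of_set S) (S \<inter> D i)"
    and disj: "\<And>i j. i \<in> I \<Longrightarrow> j \<in> I \<Longrightarrow> i \<noteq> j \<Longrightarrow> D i \<inter> D j = {}"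
  shows "of_nat (card I) \<le> betti_sum S"
proof -
  let ?X = "top_of_set S"
  define q where "q i = Collect (path_component_of ?X (x i))" for i
  have sub: "q i \<subseteq> D i" if i: "i \<in> I" for i
  proof -
    have "connectedin ?X (q i)"
      unfolding q_def by (intro path_connectedin_imp_connectedin path_connectedin_path_component_of)
    then have "q i \<subseteq> S \<inter> D i \<or> disjnt (q i) (S \<inter> D i)"
      by (rule connectedin_clopen_cases[OF _ cl[OF i] op[OF i]])
    moreover have "x i \<in> q i" unfolding q_def using x[OF i] by (simp add: path_component_of_refl)
    ultimately show ?thesis using x[OF i] by (auto simp: disjnt_def)
  qed
  have xq: "x i \<in> q i" if "i \<in> I" for i unfolding q_def using x[OF that] by (simp add: path_component_of_refl)
  have inj: "inj_on q I"
    by (rule inj_onI) (metis IntI disj empty_iff sub subsetD xq)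
  have "q ` I \<subseteq> path_components_of ?X"
    using x by (auto simp: q_def path_components_of_def)
  then have "of_nat (card (q ` I)) \<le> group_rank (homology_group 0 ?X)"
    using fin by (intro group_rank_free_le[OF abelian_homology_group zeroth_homology_group]) auto
  also have "\<dots> = (\<Sum>p\<in>{0}. group_rank (homology_group (int p) ?X))" by simp
  also have "\<dots> \<le> betti_sum S"
    unfolding betti_sum_def by (intro sum_le_suminf) auto
  finally show ?thesis using card_image[OF inj] by simp
qed

section \<open>Charts of the sphere\<close>

lemma partial_at_other_coord: "l \<noteq> i \<Longrightarrow> partial_at l (\<lambda>y. b (y $ i)) = (\<lambda>_. 0)"
  by (rule ext) (simp add: partial_at_def axis_def)

lemma coord_fn_has_derivative:
  fixes b :: "real \<Rightarrow> real"
  assumes "\<And>t. (b has_real_derivative b' t) (at t)"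
  shows "((\<lambda>y. b (y $ i)) has_derivative (\<lambda>h. h $ i * b' (y $ i))) (at y)"
proof -
  have "((\<lambda>y. y $ i) has_derivative (\<lambda>h. h $ i)) (at y)"
    by (rule bounded_linear.has_derivative[OF bounded_linear_vec_nth]) (rule has_derivative_ident)
  then have "((\<lambda>y. b (y $ i)) has_derivative (\<lambda>h. (*) (b' (y $ i)) (h $ i))) (at y)"
    by (rule has_derivative_compose) (use assms in \<open>simp add: has_field_derivative_def\<close>)
  then show ?thesis by (simp add: mult.commute)
qed

lemma partial_at_same_coord:
  fixes b :: "real \<Rightarrow> real"
  assumes "\<And>t. (b has_real_derivative b' t) (at t)"
  shows "partial_at i (\<lambda>y. b (y $ i)) = (\<lambda>y. b' (y $ i))"
  by (rule ext) (simp add: partial_at_eq[OF coord_fn_has_derivative[OF assms]])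

lemma coord_fn_differentiable:
  fixes b :: "real \<Rightarrow> real"
  assumes "\<And>t. (b has_real_derivative b' t) (at t)"
  shows "(\<lambda>y. b (y $ i)) differentiable (at y)"
  using coord_fn_has_derivative[OF assms] by (auto simp: differentiable_def)

text \<open>Parametrises the open interval from 0 to \<open>pi / 2\<close> by the whole line, as
  embeddings have domain \<open>real^'n\<close>. On it sine and cosine are positive and sine is
  injective.\<close>

definition omg :: "real \<Rightarrow> real" where
  "omg t = pi / 4 + arctan t / 2"

lemma omg_bounds: "0 < omg t" "omg t < pi / 2"
  using arctan_bounded[of t] by (auto simp: omg_def)

lemma omg_strict_mono: "t < t' \<Longrightarrow> omg t < omg t'"
  by (simp add: omg_def arctan_less_iff)

lemma omg_derivative: "(omg has_real_derivative (1 / 2) * (1 / (1 + t\<^sup>2))) (at t)"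
proof -
  have "((\<lambda>t. pi / 4 + arctan t / 2) has_real_derivative 0 + inverse (1 + t\<^sup>2) / 2) (at t)"
    by (intro DERIV_add DERIV_const DERIV_cdivide DERIV_arctan)
  moreover have "0 + inverse (1 + t\<^sup>2) / 2 = (1 / 2) * (1 / (1 + t\<^sup>2))" by (simp add: inverse_eq_divide mult.commute)
  ultimately show ?thesis unfolding omg_def[abs_def] by (simp only:)
qed

definition alp :: "real \<Rightarrow> nat \<Rightarrow> real \<Rightarrow> real" where
  "alp m j t = (2 * pi * real j + omg t) / m"

lemma alp_derivative: "(alp m j has_real_derivative (1 / (2 * m)) * (1 / (1 + t\<^sup>2))) (at t)"
proof -
  have "((\<lambda>t. (2 * pi * real j + omg t) / m) has_real_derivative (0 + (1 / 2) * (1 / (1 + t\<^sup>2))) / m) (at t)"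
    by (intro DERIV_add DERIV_const DERIV_cdivide omg_derivative)
  moreover have "(0 + (1 / 2) * (1 / (1 + t\<^sup>2))) / m = (1 / (2 * m)) * (1 / (1 + t\<^sup>2))" by (simp add: mult_ac)
  ultimately show ?thesis unfolding alp_def[abs_def] by (simp only:)
qed

definition sn :: "real \<Rightarrow> ('n::finite \<Rightarrow> nat) \<Rightarrow> 'n \<Rightarrow> real^'n \<Rightarrow> real" where
  "sn m jj i y = sin (alp m (jj i) (y $ i))"

definition cs :: "real \<Rightarrow> ('n::finite \<Rightarrow> nat) \<Rightarrow> 'n \<Rightarrow> real^'n \<Rightarrow> real" where
  "cs m jj i y = cos (alp m (jj i) (y $ i))"

definition wt :: "'n::finite \<Rightarrow> real^'n \<Rightarrow> real" where
  "wt i y = 1 / (1 + (y $ i)\<^sup>2)"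

text \<open>Closed under differentiation up to sums and products: the angle has derivative a
  constant times \<open>wt i\<close>, and \<open>wt i\<close> has derivative a polynomial in itself
  and the coordinate.\<close>

definition coord_gens :: "real \<Rightarrow> ('n::finite \<Rightarrow> nat) \<Rightarrow> (real^'n \<Rightarrow> real) set" where
  "coord_gens m jj = range (\<lambda>i y. y $ i) \<union> range wt \<union> range (sn m jj) \<union> range (cs m jj)"

lemma coord_gens_mem [simp, intro]:
  "(\<lambda>y. y $ i) \<in> alg (coord_gens m jj)" "wt i \<in> alg (coord_gens m jj)"
  "sn m jj i \<in> alg (coord_gens m jj)" "cs m jj i \<in> alg (coord_gens m jj)"
  by (rule alg.gen; simp add: coord_gens_def)+

lemma wt_derivative: "((\<lambda>t. 1 / (1 + t\<^sup>2)) has_real_derivative (-2) * t * (1 / (1 + t\<^sup>2))\<^sup>2) (at t)"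
proof -
  have "1 + t\<^sup>2 \<noteq> 0" by (metis add_pos_nonneg less_numeral_extra(1) less_numeral_extra(3) zero_le_power2)
  then show ?thesis by (auto intro!: derivative_eq_intros simp: power2_eq_square field_simps)
qed

lemma sn_derivative: "((\<lambda>t. sin (alp m j t)) has_real_derivative
    cos (alp m j t) * ((1 / (2 * m)) * (1 / (1 + t\<^sup>2)))) (at t)"
  by (auto intro!: derivative_eq_intros alp_derivative)

lemma cs_derivative: "((\<lambda>t. cos (alp m j t)) has_real_derivative
    - sin (alp m j t) * ((1 / (2 * m)) * (1 / (1 + t\<^sup>2)))) (at t)"
  by (auto intro!: derivative_eq_intros alp_derivative)

lemma coord_gens_cases:
  assumes "b \<in> coord_gens m jj"
  obtains i \<beta> \<beta>' where "b = (\<lambda>y. \<beta> (y $ i))" "\<And>t. (\<beta> has_real_derivative \<beta>' t) (at t)"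
    "(\<lambda>y. \<beta>' (y $ i)) \<in> alg (coord_gens m jj)"
proof -
  consider i where "b = (\<lambda>y. y $ i)" | i where "b = wt i" | i where "b = sn m jj i" | i where "b = cs m jj i"
    using assms by (auto simp: coord_gens_def)
  then show thesis
  proof cases
    case (1 i)
    show thesis by (rule that[of "\<lambda>t. t" i "\<lambda>_. 1"]) (auto simp: 1 intro: alg.const)
  next
    case (2 i)
    show thesis
    proof (rule that)
      show "b = (\<lambda>y. 1 / (1 + (y $ i)\<^sup>2))" by (rule ext) (simp add: 2 wt_def)
      show "((\<lambda>t. 1 / (1 + t\<^sup>2)) has_real_derivative (-2) * t * (1 / (1 + t\<^sup>2))\<^sup>2) (at t)" for t
        by (rule wt_derivative)
      have "(\<lambda>y. (-2) * y $ i * (wt i y)\<^sup>2) \<in> alg (coord_gens m jj)" by (intro alg_intros coord_gens_mem)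
      then show "(\<lambda>y. (-2) * y $ i * (1 / (1 + (y $ i)\<^sup>2))\<^sup>2) \<in> alg (coord_gens m jj)" by (simp only: wt_def)
    qed
  next
    case (3 i)
    show thesis
    proof (rule that)
      show "b = (\<lambda>y. sin (alp m (jj i) (y $ i)))" by (rule ext) (simp add: 3 sn_def)
      show "((\<lambda>t. sin (alp m (jj i) t)) has_real_derivative
        cos (alp m (jj i) t) * ((1 / (2 * m)) * (1 / (1 + t\<^sup>2)))) (at t)" for t by (rule sn_derivative)
      have "(\<lambda>y. cs m jj i y * ((1 / (2 * m)) * wt i y)) \<in> alg (coord_gens m jj)" by (intro alg_intros coord_gens_mem)
      then show "(\<lambda>y. cos (alp m (jj i) (y $ i)) * ((1 / (2 * m)) * (1 / (1 + (y $ i)\<^sup>2)))) \<in> alg (coord_gens m jj)"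
        by (simp only: wt_def cs_def)
    qed
  next
    case (4 i)
    show thesis
    proof (rule that)
      show "b = (\<lambda>y. cos (alp m (jj i) (y $ i)))" by (rule ext) (simp add: 4 cs_def)
      show "((\<lambda>t. cos (alp m (jj i) t)) has_real_derivative
        - sin (alp m (jj i) t) * ((1 / (2 * m)) * (1 / (1 + t\<^sup>2)))) (at t)" for t by (rule cs_derivative)
      have "(\<lambda>y. - sn m jj i y * ((1 / (2 * m)) * wt i y)) \<in> alg (coord_gens m jj)" by (intro alg_intros coord_gens_mem)
      then show "(\<lambda>y. - sin (alp m (jj i) (y $ i)) * ((1 / (2 * m)) * (1 / (1 + (y $ i)\<^sup>2)))) \<in> alg (coord_gens m jj)"
        by (simp only: wt_def sn_def)
    qed
  qed
qed

lemma smooth_coord_gens: "smooth_gens (coord_gens m jj)"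
  unfolding smooth_gens_def
proof (intro ballI conjI allI)
  fix b assume b: "b \<in> coord_gens m jj"
  obtain i \<beta> \<beta>' where *: "b = (\<lambda>y. \<beta> (y $ i))" "\<And>t. (\<beta> has_real_derivative \<beta>' t) (at t)"
    "(\<lambda>y. \<beta>' (y $ i)) \<in> alg (coord_gens m jj)" by (rule coord_gens_cases[OF b]) blast
  show "b differentiable (at y)" for y unfolding *(1) by (rule coord_fn_differentiable[OF *(2)])
  show "partial_at l b \<in> alg (coord_gens m jj)" for l
    using *(3) partial_at_same_coord[OF *(2), of i] partial_at_other_coord[of l i \<beta>] unfolding *(1)
    by (cases "l = i") (auto intro: alg.const)
qed

lemma commuting_coord_gens: "commuting_gens (coord_gens m jj)"
  unfolding commuting_gens_def
proof (intro ballI conjI allI)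
  fix b k l assume b: "b \<in> coord_gens m jj"
  obtain i \<beta> \<beta>' where *: "b = (\<lambda>y. \<beta> (y $ i))" "\<And>t. (\<beta> has_real_derivative \<beta>' t) (at t)"
    "(\<lambda>y. \<beta>' (y $ i)) \<in> alg (coord_gens m jj)" by (rule coord_gens_cases[OF b]) blast
  show "partial_at k (partial_at l b) = partial_at l (partial_at k b)"
    unfolding *(1)
    by (cases "k = i"; cases "l = i") (simp_all add: partial_at_same_coord[OF *(2)] partial_at_other_coord)
qed

definition rt :: "real \<Rightarrow> ('n::finite \<Rightarrow> nat) \<Rightarrow> real^'n \<Rightarrow> real" where
  "rt m jj y = sqrt (1 - (\<Sum>i\<in>UNIV. (sn m jj i y)\<^sup>2))"

text \<open>The inverse is adjoined because differentiating the square root produces it.\<close>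

definition chart_gens :: "real \<Rightarrow> ('n::finite \<Rightarrow> nat) \<Rightarrow> (real^'n \<Rightarrow> real) set" where
  "chart_gens m jj = coord_gens m jj \<union> {rt m jj, \<lambda>y. inverse (rt m jj y)}"

definition chart :: "'m \<Rightarrow> ('n \<Rightarrow> 'm) \<Rightarrow> real \<Rightarrow> ('n::finite \<Rightarrow> nat) \<Rightarrow> real^'n \<Rightarrow> real^'m" where
  "chart i0 \<iota> m jj y = (\<chi> l. if l = i0 then rt m jj y else sn m jj (inv_into UNIV \<iota> l) y)"

text \<open>The bound on \<open>jj\<close> keeps every angle, hence every sine, below
  \<open>1 / (real CARD('n) + 1)\<close>. The squares of the \<open>n\<close> sines then sum to less
  than 1 and the coordinate \<open>i0\<close> is a positive square root.\<close>

locale sphere_chart =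
  fixes i0 :: "'m::finite" and \<iota> :: "'n::finite \<Rightarrow> 'm" and m :: real and jj :: "'n \<Rightarrow> nat"
  assumes inj: "inj \<iota>" and ran: "range \<iota> = UNIV - {i0}" and m: "m > 0"
    and jj: "\<And>i. 2 * pi * (real (jj i) + 1) \<le> m / (real CARD('n) + 1)"
begin

lemma alp_bounds:
  "0 < alp m (jj i) t" "2 * pi * real (jj i) / m < alp m (jj i) t"
  "alp m (jj i) t < (2 * pi * real (jj i) + pi / 2) / m" "(2 * pi * real (jj i) + pi / 2) / m < 1 / (real CARD('n) + 1)"
proof -
  have "0 < 2 * pi * real (jj i) + omg t" using omg_bounds[of t] by (intro add_nonneg_pos) auto
  then show "0 < alp m (jj i) t" using m by (simp add: alp_def)
  show "2 * pi * real (jj i) / m < alp m (jj i) t" using omg_bounds[of t] m by (simp add: alp_def divide_strict_right_mono)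
  show "alp m (jj i) t < (2 * pi * real (jj i) + pi / 2) / m"
    using omg_bounds[of t] m unfolding alp_def by (intro divide_strict_right_mono) auto
  have "2 * pi * real (jj i) + pi / 2 < 2 * pi * (real (jj i) + 1)" using pi_gt_zero by (simp add: algebra_simps)
  also have "\<dots> \<le> m / (real CARD('n) + 1)" by (rule jj)
  finally show "(2 * pi * real (jj i) + pi / 2) / m < 1 / (real CARD('n) + 1)"
    using m by (simp add: field_simps)
qed

lemma small: "1 / (real CARD('n) + 1) \<le> 1 / 2"
proof -
  have "CARD('n) \<ge> 1" by (simp add: Suc_leI)
  then have "real CARD('n) \<ge> 1" by linarith
  then show ?thesis by (simp add: field_simps)
qed

lemma alp_lt: "alp m (jj i) t < 1 / (real CARD('n) + 1)" "alp m (jj i) t < pi / 2"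
proof -
  show 1: "alp m (jj i) t < 1 / (real CARD('n) + 1)" using alp_bounds(3)[of i t] alp_bounds(4)[of i] by linarith
  show "alp m (jj i) t < pi / 2" using 1 small pi_gt3 by linarith
qed

lemma sn_pos: "0 < sn m jj i y" "sn m jj i y < 1 / (real CARD('n) + 1)"
proof -
  show "0 < sn m jj i y" unfolding sn_def using alp_bounds(1) alp_lt(2) by (rule sin_gt_zero2)
  have "sn m jj i y \<le> alp m (jj i) (y $ i)"
    unfolding sn_def using alp_bounds(1)[of i "y $ i"] by (intro sin_x_le_x) simp
  then show "sn m jj i y < 1 / (real CARD('n) + 1)" using alp_lt(1)[of i "y $ i"] by linarith
qed

lemma cs_pos: "0 < cs m jj i y"
  unfolding cs_def using alp_bounds(1)[of i "y $ i"] alp_lt(2)[of i "y $ i"] by (intro cos_gt_zero) auto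

lemma small_squares:
  assumes "\<And>i. \<bar>s i\<bar> < 1 / (real CARD('n) + 1)"
  shows "(\<Sum>i\<in>(UNIV :: 'n set). (s i)\<^sup>2) < 1"
proof -
  let ?n = "real CARD('n)"
  have "(s i)\<^sup>2 \<le> (1 / (?n + 1))\<^sup>2" for i
    using assms[of i] by (simp add: abs_le_square_iff[symmetric])
  then have "(\<Sum>i\<in>(UNIV :: 'n set). (s i)\<^sup>2) \<le> ?n * (1 / (?n + 1))\<^sup>2"
    using sum_bounded_above[of "UNIV :: 'n set" "\<lambda>i. (s i)\<^sup>2"] by simp
  also have "\<dots> < 1"
  proof -
    have "?n < (?n + 1)\<^sup>2" by (simp add: power2_eq_square algebra_simps add_strict_increasing2)
    then show ?thesis by (simp add: power_divide divide_simps) 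
  qed
  finally show ?thesis .
qed

lemma rt_arg: "0 < 1 - (\<Sum>i\<in>UNIV. (sn m jj i y)\<^sup>2)"
proof -
  have "\<bar>sn m jj i y\<bar> < 1 / (real CARD('n) + 1)" for i using sn_pos[of i y] by simp
  from small_squares[OF this] show ?thesis by simp
qed

lemma rt_pos: "0 < rt m jj y"
  unfolding rt_def using rt_arg by simp

lemma coord_in_chart: "f \<in> alg (coord_gens m jj) \<Longrightarrow> f \<in> alg (chart_gens m jj)"
  by (rule alg_mono) (auto simp: chart_gens_def)

lemma rt_mem: "rt m jj \<in> alg (chart_gens m jj)" "(\<lambda>y. inverse (rt m jj y)) \<in> alg (chart_gens m jj)"
  by (rule alg.gen; simp add: chart_gens_def)+

lemma smooth_chart_gens: "smooth_gens (chart_gens m jj)"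
proof -
  define Dn where "Dn y = 1 - (\<Sum>i\<in>UNIV. (sn m jj i y)\<^sup>2)" for y
  have Dn: "Dn \<in> alg (coord_gens m jj)" unfolding Dn_def[abs_def] by (intro alg_intros coord_gens_mem)
  have Dn_pos: "Dn y > 0" for y using rt_arg by (simp add: Dn_def)
  have rtDn: "rt m jj y = sqrt (Dn y)" for y by (simp add: rt_def Dn_def)
  have d: "(rt m jj has_derivative (\<lambda>h. (\<Sum>i\<in>UNIV. h $ i * partial_at i Dn y) * (inverse (rt m jj y) / 2))) (at y)" for y
    unfolding rtDn[abs_def]
    using partial_at_gradient[OF alg_differentiable[OF smooth_coord_gens Dn], of y] Dn_pos[of y]
    by (auto intro!: derivative_eq_intros)
  have "rt m jj y \<noteq> 0" for y using rt_pos[of y] by simp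
  then have d': "((\<lambda>y. inverse (rt m jj y)) has_derivative (\<lambda>h. - (inverse (rt m jj y) * ((\<Sum>i\<in>UNIV. h $ i * partial_at i Dn y) * (inverse (rt m jj y) / 2)) * inverse (rt m jj y)))) (at y)" for y
    by (intro Deriv.has_derivative_inverse d)
  have ax: "(\<Sum>i\<in>UNIV. axis l 1 $ i * partial_at i Dn y) = partial_at l Dn y" for l y
  proof -
    have "(\<Sum>i\<in>UNIV. axis l 1 $ i * partial_at i Dn y) = (\<Sum>i\<in>UNIV. if i = l then partial_at l Dn y else 0)"
      by (rule sum.cong) (auto simp: axis_def)
    then show ?thesis by simp
  qed
  have p: "partial_at l (rt m jj) = (\<lambda>y. partial_at l Dn y * (inverse (rt m jj y) * (1 / 2)))" for l
    by (rule ext) (simp add: partial_at_eq[OF d] ax)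
  have p': "partial_at l (\<lambda>y. inverse (rt m jj y)) = (\<lambda>y. - (inverse (rt m jj y) * (partial_at l Dn y * (inverse (rt m jj y) * (1 / 2))) * inverse (rt m jj y)))" for l
    by (rule ext) (simp add: partial_at_eq[OF d'] ax)
  have pD: "partial_at l Dn \<in> alg (chart_gens m jj)" for l
    by (intro coord_in_chart partial_at_alg[OF smooth_coord_gens] Dn)
  have 1: "partial_at l (rt m jj) \<in> alg (chart_gens m jj)" for l
    unfolding p by (intro alg_intros pD rt_mem)
  have 2: "partial_at l (\<lambda>y. inverse (rt m jj y)) \<in> alg (chart_gens m jj)" for l
    unfolding p' by (intro alg_intros pD rt_mem)
  show ?thesis
    unfolding smooth_gens_def
  proof (intro ballI)
    fix b assume "b \<in> chart_gens m jj"
    then consider "b \<in> coord_gens m jj" | "b = rt m jj" | "b = (\<lambda>y. inverse (rt m jj y))" by (auto simp: chart_gens_def)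
    then show "(\<forall>y. b differentiable at y) \<and> (\<forall>i. partial_at i b \<in> alg (chart_gens m jj))"
    proof cases
      case 1
      then show ?thesis using smooth_coord_gens coord_in_chart unfolding smooth_gens_def by blast
    next
      case 2
      then show ?thesis using d \<open>\<And>l. partial_at l (rt m jj) \<in> alg (chart_gens m jj)\<close> by (auto simp: differentiable_def)
    next
      case 3
      then show ?thesis using d' 2 by (auto simp: differentiable_def)
    qed
  qed
qed

abbreviation phi :: "real^'n \<Rightarrow> real^'m" where "phi \<equiv> chart i0 \<iota> m jj"

lemma inv_iota [simp]: "inv_into UNIV \<iota> (\<iota> i) = i"
  by (simp add: inj)

lemma iota_neq [simp]: "\<iota> i \<noteq> i0"
  using ran by (metis DiffD2 rangeI singletonI)

lemma index_cases: "l = i0 \<or> (\<exists>i. l = \<iota> i)"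
  using ran by blast

lemma phi_nth [simp]: "phi y $ i0 = rt m jj y" "phi y $ \<iota> i = sn m jj i y"
  by (simp_all add: chart_def)

lemma phi_alg: "(\<lambda>y. phi y $ l) \<in> alg (chart_gens m jj)"
  using index_cases[of l] rt_mem(1) coord_in_chart[OF coord_gens_mem(3)] by auto

lemma sum_split: "(\<Sum>l\<in>UNIV. g l) = g i0 + (\<Sum>i\<in>UNIV. g (\<iota> i))" for g :: "'m \<Rightarrow> real"
proof -
  have "(\<Sum>l\<in>UNIV. g l) = g i0 + (\<Sum>l\<in>range \<iota>. g l)" unfolding ran by (rule sum.remove) auto
  then show ?thesis using inj by (simp add: sum.reindex)
qed

lemma sphere_iff: "x \<in> sphere_set \<longleftrightarrow> (x $ i0)\<^sup>2 + (\<Sum>i\<in>UNIV. (x $ \<iota> i)\<^sup>2) = 1"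
proof -
  have "x \<in> sphere_set \<longleftrightarrow> x \<bullet> x = 1" by (simp add: sphere_set_def norm_eq_1)
  also have "x \<bullet> x = (\<Sum>l\<in>UNIV. (x $ l)\<^sup>2)" by (simp add: inner_vec_def power2_eq_square)
  finally show ?thesis by (simp add: sum_split)
qed

lemma phi_sphere: "phi y \<in> sphere_set"
  unfolding sphere_iff using rt_arg[of y] by (simp add: rt_def)

text \<open>Undoes the chart coordinatewise: \<open>arcsin\<close> recovers the angle,
  multiplication by \<open>m\<close> and the shift recover \<open>omg\<close>, and the tangent
  inverts \<open>omg\<close>.\<close>

definition psi :: "real^'m \<Rightarrow> real^'n" where
  "psi x = (\<chi> i. tan (2 * (m * arcsin (x $ \<iota> i) - 2 * pi * real (jj i) - pi / 4)))"

lemma arcsin_sn: "arcsin (sn m jj i y) = alp m (jj i) (y $ i)"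
  unfolding sn_def using alp_bounds(1)[of i "y $ i"] alp_lt(2)[of i "y $ i"] by (intro arcsin_sin) auto

lemma psi_arg: "2 * (m * arcsin (phi y $ \<iota> i) - 2 * pi * real (jj i) - pi / 4) = arctan (y $ i)"
proof -
  have "m * alp m (jj i) (y $ i) = 2 * pi * real (jj i) + omg (y $ i)" using m by (simp add: alp_def)
  then show ?thesis by (simp add: arcsin_sn omg_def)
qed

lemma psi_phi: "psi (phi y) = y"
  unfolding psi_def psi_arg by (simp add: tan_arctan)

lemma continuous_phi: "continuous_on S phi"
proof -
  have "continuous_on S (\<lambda>y. \<chi> l. phi y $ l)"
    by (intro continuous_on_vec_lambda alg_continuous[OF smooth_chart_gens] phi_alg)
  then show ?thesis by simp
qed

lemma homeo: "homeomorphism UNIV (range phi) phi psi"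
proof (rule homeomorphismI)
  show "continuous_on UNIV phi" by (rule continuous_phi)
  have "continuous_on (range phi) (\<lambda>x. tan (2 * (m * arcsin (x $ \<iota> i) - 2 * pi * real (jj i) - pi / 4)))" for i
  proof (rule continuous_on_compose2[where t = "{z. cos z \<noteq> 0}" and g = tan])
    show "continuous_on {z :: real. cos z \<noteq> 0} tan" by (rule continuous_on_tan) simp
    have "\<forall>x\<in>range phi. - 1 \<le> x $ \<iota> i \<and> x $ \<iota> i \<le> 1" by (auto simp: sn_def)
    then show "continuous_on (range phi) (\<lambda>x. 2 * (m * arcsin (x $ \<iota> i) - 2 * pi * real (jj i) - pi / 4))"
      by (intro continuous_intros) assumption
    show "(\<lambda>x. 2 * (m * arcsin (x $ \<iota> i) - 2 * pi * real (jj i) - pi / 4)) ` range phi \<subseteq> {z. cos z \<noteq> 0}"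
      unfolding image_image by (rule image_subsetI) (simp only: psi_arg mem_Collect_eq cos_arctan_not_zero not_False_eq_True)
  qed
  then show "continuous_on (range phi) psi" unfolding psi_def by (intro continuous_on_vec_lambda)
qed (auto simp: psi_phi)

lemma phi_has_derivative:
  "\<exists>Df. (phi has_derivative Df) (at y) \<and> inj Df"
proof -
  define Df where "Df h = (\<chi> l. \<Sum>i\<in>UNIV. h $ i * partial_at i (\<lambda>y. phi y $ l) y)" for h
  have c: "((\<lambda>y. phi y $ l) has_derivative (\<lambda>h. Df h $ l)) (at y)" for l
    unfolding Df_def using partial_at_gradient[OF alg_differentiable[OF smooth_chart_gens phi_alg]] by simp
  have D: "(phi has_derivative Df) (at y)"
  proof (subst has_derivative_componentwise_within, rule ballI)
    fix b :: "real^'m" assume "b \<in> Basis"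
    then obtain l where "b = axis l 1" by (auto simp: Basis_vec_def)
    then show "((\<lambda>x. phi x \<bullet> b) has_derivative (\<lambda>x. Df x \<bullet> b)) (at y)"
      using c[of l] by (simp add: inner_axis)
  qed
  have "inj Df"
  proof (subst linear_injective_0)
    show "linear Df" using D by (rule has_derivative_linear)
    show "\<forall>h. Df h = 0 \<longrightarrow> h = 0"
    proof (intro allI impI)
      fix h assume h: "Df h = 0"
      have "h $ i = 0" for i
      proof -
        have sn_eq: "(\<lambda>y. phi y $ \<iota> i) = (\<lambda>y. sin (alp m (jj i) (y $ i)))"
          by (rule ext) (simp add: sn_def)
        have "((\<lambda>y. phi y $ \<iota> i) has_derivative (\<lambda>h. h $ i * (cos (alp m (jj i) (y $ i)) * ((1 / (2 * m)) * (1 / (1 + (y $ i)\<^sup>2)))))) (at y)"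
          unfolding sn_eq by (rule coord_fn_has_derivative[OF sn_derivative])
        from has_derivative_unique[OF this c] have "h $ i * (cos (alp m (jj i) (y $ i)) * ((1 / (2 * m)) * (1 / (1 + (y $ i)\<^sup>2)))) = 0"
          using h by (metis zero_index)
        moreover have "1 + (y $ i)\<^sup>2 \<noteq> 0" by (metis add_pos_nonneg less_numeral_extra(1) less_numeral_extra(3) zero_le_power2)
        moreover have "cos (alp m (jj i) (y $ i)) \<noteq> 0" using cs_pos[of i y] by (simp add: cs_def)
        ultimately show ?thesis using m by simp
      qed
      then show "h = 0" by (simp add: vec_eq_iff)
    qed
  qed
  then show ?thesis using D by blast
qed

lemma smooth_phi: "smooth_map phi"
  unfolding smooth_map_def differentiable_on_def
  by (intro allI ballI alg_differentiable[OF smooth_chart_gens] pderivs_alg[OF smooth_chart_gens] phi_alg)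

theorem embedding_phi: "embedding_into_sphere phi"
  unfolding embedding_into_sphere_def using smooth_phi phi_sphere phi_has_derivative homeo by blast

text \<open>Describing the image by strict inequalities makes its openness in the sphere evident, so
  that images of open sets are open there.\<close>

lemma range_phi:
  "range phi = {x \<in> sphere_set. 0 < x $ i0 \<and>
     (\<forall>i. sin (2 * pi * real (jj i) / m) < x $ \<iota> i \<and> x $ \<iota> i < sin ((2 * pi * real (jj i) + pi / 2) / m))}"
  (is "_ = ?R")
proof
  show "range phi \<subseteq> ?R"
  proof
    fix x assume "x \<in> range phi"
    then obtain y where y: "x = phi y" by auto
    have "sin (2 * pi * real (jj i) / m) < sn m jj i y \<and> sn m jj i y < sin ((2 * pi * real (jj i) + pi / 2) / m)" for i
    proof -
      have "0 \<le> 2 * pi * real (jj i) / m" using m by simp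
      moreover have "(2 * pi * real (jj i) + pi / 2) / m < pi / 2"
        using alp_bounds(4)[of i] small pi_gt3 by linarith
      ultimately show ?thesis unfolding sn_def using alp_bounds(1-3)[of i "y $ i"] alp_lt(2)[of i "y $ i"] pi_gt_zero
        by (intro conjI sin_monotone_2pi) linarith+
    qed
    then show "x \<in> ?R" using phi_sphere rt_pos by (simp add: y)
  qed
  show "?R \<subseteq> range phi"
  proof
    fix x assume x: "x \<in> ?R"
    define y where "y = psi x"
    have "sn m jj i y = x $ \<iota> i" for i
    proof -
      let ?lo = "2 * pi * real (jj i) / m" and ?hi = "(2 * pi * real (jj i) + pi / 2) / m"
      have lo: "0 \<le> ?lo" "?lo < pi / 2" using m alp_bounds(2)[of i 0] alp_lt(2)[of i 0] by auto
      have hi: "?hi < pi / 2" "0 \<le> ?hi"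
        using alp_bounds(4)[of i] small pi_gt3 m by (linarith, simp)
      define a where "a = arcsin (x $ \<iota> i)"
      have b: "-1 < x $ \<iota> i" "x $ \<iota> i < 1"
      proof -
        have "sin ?lo < x $ \<iota> i" "x $ \<iota> i < sin ?hi" using x by auto
        then show "-1 < x $ \<iota> i" "x $ \<iota> i < 1"
          using sin_ge_minus_one[of ?lo] sin_le_one[of ?hi] by linarith+
      qed
      have "sin a = x $ \<iota> i" unfolding a_def using b by (intro sin_arcsin) auto
      have "arcsin (sin ?lo) < a" "a < arcsin (sin ?hi)"
        unfolding a_def using x b by (auto intro!: arcsin_less_arcsin simp: sin_ge_minus_one sin_le_one)
      then have a: "?lo < a" "a < ?hi" using lo hi by (simp_all add: arcsin_sin)
      have ma: "2 * pi * real (jj i) < m * a" "m * a < 2 * pi * real (jj i) + pi / 2"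
        using a m by (simp_all add: field_simps)
      have yi: "y $ i = tan (2 * (m * a - 2 * pi * real (jj i) - pi / 4))"
        by (simp add: y_def psi_def a_def)
      have "arctan (y $ i) = 2 * (m * a - 2 * pi * real (jj i) - pi / 4)"
        unfolding yi by (rule arctan_tan) (use ma in \<open>simp_all add: algebra_simps\<close>)
      then have "alp m (jj i) (y $ i) = a" using m by (simp add: alp_def omg_def field_simps)
      then show ?thesis unfolding sn_def using \<open>sin a = x $ \<iota> i\<close> by simp
    qed
    moreover have "rt m jj y = x $ i0"
    proof -
      have "1 - (\<Sum>i\<in>UNIV. (x $ \<iota> i)\<^sup>2) = (x $ i0)\<^sup>2" using x by (simp add: sphere_iff)
      then show ?thesis using x by (simp add: rt_def calculation)
    qed
    ultimately have "phi y $ l = x $ l" for l using index_cases[of l] by auto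
    then have "x = phi y" by (simp add: vec_eq_iff)
    then show "x \<in> range phi" by blast
  qed
qed

lemma openin_range_phi: "openin (top_of_set sphere_set) (range phi)"
proof -
  have "open ({x :: real^'m. 0 < x $ i0} \<inter> (\<Inter>i. {x. sin (2 * pi * real (jj i) / m) < x $ \<iota> i} \<inter> {x. x $ \<iota> i < sin ((2 * pi * real (jj i) + pi / 2) / m)}))"
    by (intro open_Int open_INT ballI open_Collect_less continuous_intros) auto
  moreover have "range phi = sphere_set \<inter> ({x :: real^'m. 0 < x $ i0} \<inter> (\<Inter>i. {x. sin (2 * pi * real (jj i) / m) < x $ \<iota> i} \<inter> {x. x $ \<iota> i < sin ((2 * pi * real (jj i) + pi / 2) / m)}))"
    unfolding range_phi by auto
  ultimately show ?thesis unfolding openin_open by blast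
qed

lemma openin_phi_image: "open T \<Longrightarrow> openin (top_of_set sphere_set) (phi ` T)"
  using homeomorphism_imp_open_map[OF homeo, of T] openin_range_phi
  by (auto intro: openin_trans)

text \<open>\<open>m\<close> times the angle differs from \<open>omg (y $ i)\<close> by a multiple
  of \<open>2 * pi\<close>. The right-hand side does not mention \<open>m\<close> or
  \<open>jj\<close>, so one polynomial has the same local picture in every chart.\<close>

lemma csin_phi:
  assumes "m = real (2 * k + 1)"
  shows "csin k (phi y $ \<iota> i) = sin (omg (y $ i))"
proof -
  have "csin k (phi y $ \<iota> i) = sin (m * alp m (jj i) (y $ i))"
    unfolding phi_nth sn_def csin_sin by (simp only: assms[symmetric])
  also have "m * alp m (jj i) (y $ i) = omg (y $ i) + 2 * pi * real (jj i)" using m by (simp add: alp_def)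
  also have "sin \<dots> = sin (omg (y $ i))"
  proof -
    have e: "2 * pi * real (jj i) = real (2 * jj i) * pi" by simp
    show ?thesis unfolding e sin_add sin_npi cos_npi by simp
  qed
  finally show ?thesis .
qed

end

text \<open>A point determines \<open>2 * pi * real (jj i) + omg t\<close>, and values of
  \<open>omg\<close> differ by less than a full period, so it determines
  \<open>jj i\<close>.\<close>

lemma chart_ranges_disjoint:
  assumes "sphere_chart i0 \<iota> m jj" "sphere_chart i0 \<iota> m jj'" "jj \<noteq> jj'"
  shows "range (chart i0 \<iota> m jj) \<inter> range (chart i0 \<iota> m jj') = {}"
proof (rule ccontr)
  interpret A: sphere_chart i0 \<iota> m jj by fact
  interpret B: sphere_chart i0 \<iota> m jj' by fact
  assume "\<not> ?thesis"
  then obtain y y' where e: "chart i0 \<iota> m jj y = chart i0 \<iota> m jj' y'" by auto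
  have "jj i = jj' i" for i
  proof -
    have "sn m jj i y = sn m jj' i y'" using A.phi_nth(2)[of y i] B.phi_nth(2)[of y' i] e by simp
    then have "alp m (jj i) (y $ i) = alp m (jj' i) (y' $ i)" using A.arcsin_sn B.arcsin_sn by metis
    then have "2 * pi * real (jj i) + omg (y $ i) = 2 * pi * real (jj' i) + omg (y' $ i)" using A.m by (simp add: alp_def)
    then have "\<bar>2 * pi * (real (jj i) - real (jj' i))\<bar> < pi / 2"
      using omg_bounds[of "y $ i"] omg_bounds[of "y' $ i"] by (simp add: algebra_simps abs_if)
    then have "\<bar>real (jj i) - real (jj' i)\<bar> < 1" using pi_gt_zero by (simp add: abs_mult) 
    then show ?thesis by linarith
  qed
  then show False using assms(3) by auto
qed

section \<open>The local model\<close>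

lemma finite_jet_vars: "finite (jet_vars r :: ('n::finite, 'k::finite) jvar set)"
proof -
  have "finite {\<beta> :: 'n \<Rightarrow> nat. sum \<beta> UNIV \<le> r}"
  proof (rule finite_subset)
    show "{\<beta> :: 'n \<Rightarrow> nat. sum \<beta> UNIV \<le> r} \<subseteq> (\<Union>k\<le>r. {\<beta>. sum \<beta> UNIV = k})" by auto
  qed (auto intro: finite_multiindices)
  then have "finite ({\<beta> :: 'n \<Rightarrow> nat. sum \<beta> UNIV \<le> r} \<times> (UNIV :: 'k set))" by simp
  then have "finite (range (Inl :: 'n \<Rightarrow> ('n, 'k) jvar) \<union> Inr ` ({\<beta> :: 'n \<Rightarrow> nat. sum \<beta> UNIV \<le> r} \<times> (UNIV :: 'k set)))"
    by (intro finite_UnI finite_imageI) simp_all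
  moreover have "(jet_vars r :: ('n, 'k) jvar set) = range Inl \<union> Inr ` ({\<beta>. sum \<beta> UNIV \<le> r} \<times> UNIV)"
    by (auto simp: jet_vars_def)
  ultimately show ?thesis by simp
qed

lemma jet_vars_simps [simp]:
  "Inl i \<in> jet_vars r" "Inr (\<beta>, j) \<in> jet_vars r \<longleftrightarrow> sum \<beta> UNIV \<le> r"
  by (auto simp: jet_vars_def)

lemma pvars_td: "pvars e \<subseteq> jet_vars r \<Longrightarrow> pvars (td i e) \<subseteq> jet_vars (Suc r)"
proof (induction e)
  case (Var v)
  show ?case
  proof (cases v)
    case (Inr \<beta>j)
    obtain \<beta> j where b: "\<beta>j = (\<beta>, j)" by (cases \<beta>j)
    have "sum (\<beta>(i := Suc (\<beta> i))) UNIV = Suc (sum \<beta> UNIV)" by (simp add: sum.remove[of UNIV i])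
    then show ?thesis using Var by (simp add: Inr b)
  qed simp
next
  case (Mul a b)
  have "jet_vars r \<subseteq> (jet_vars (Suc r) :: ('a, 'b) jvar set)" by (auto simp: jet_vars_def)
  then show ?case using Mul by auto
qed auto

text \<open>The reference algebra of the local model: for \<open>m = 1\<close> and index 0 the angle
  is \<open>omg\<close> itself.\<close>

abbreviation bgens :: "(real^'n::finite \<Rightarrow> real) set" where
  "bgens \<equiv> coord_gens 1 (\<lambda>_. 0)"

definition svec :: "real^'n::finite \<Rightarrow> real^'n" where
  "svec y = (\<chi> i. sin (omg (y $ i)))"

lemma svec_nth: "svec y $ i = sn 1 (\<lambda>_. 0) i y"
  by (simp add: svec_def sn_def alp_def)

lemma parpoly_alg: "parpoly e F \<Longrightarrow> (\<lambda>y. F (svec y)) \<in> alg bgens"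
  by (induction rule: parpoly.induct) (auto simp: svec_nth intro: alg.intros)

lemma parpoly_power: "parpoly 0 F \<Longrightarrow> parpoly 0 (\<lambda>s. F s ^ k)"
proof (induction k)
  case (Suc k)
  then show ?case using parpoly.mul[of 0 F 0 "\<lambda>s. F s ^ k"] by simp
qed (simp add: parpoly.const)

lemma parpoly_sum: "(\<And>i. i \<in> I \<Longrightarrow> parpoly 0 (F i)) \<Longrightarrow> parpoly 0 (\<lambda>s. \<Sum>i\<in>I. F i s)"
  by (induction I rule: infinite_finite_induct) (auto intro: parpoly.const parpoly.add)

lemma parpoly_prod: "(\<And>i. i \<in> I \<Longrightarrow> parpoly 0 (F i)) \<Longrightarrow> parpoly 0 (\<lambda>s. \<Prod>i\<in>I. F i s)"
proof (induction I rule: infinite_finite_induct)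
  case (insert x I)
  then show ?case using parpoly.mul[of 0 "F x" 0 "\<lambda>s. \<Prod>i\<in>I. F i s"] by simp
qed (auto intro: parpoly.const)

lemma parpoly_coord_power: "parpoly e (\<lambda>s. s $ i ^ e)"
proof (induction e)
  case (Suc e)
  then show ?case using parpoly.mul[OF parpoly.coord[of i] Suc] by simp
qed (simp add: parpoly.const)

lemma parpoly_square_diff: "parpoly 0 (\<lambda>s. (s $ i)\<^sup>2 - c)"
proof -
  have "parpoly 0 (\<lambda>s. s $ i * s $ i)" by (rule parpoly.par[OF parpoly.mul[OF parpoly.coord parpoly.coord]]) simp
  from parpoly.add[OF this parpoly.const[of "- c"]] show ?thesis by (simp add: power2_eq_square)
qed

lemma sin_omg_pos: "0 < sin (omg t)" "0 < cos (omg t)"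
  using omg_bounds[of t] by (auto intro: sin_gt_zero2 cos_gt_zero)

lemma sin_omg_square_mono: "t < t' \<Longrightarrow> (sin (omg t))\<^sup>2 < (sin (omg t'))\<^sup>2"
proof -
  assume "t < t'"
  then have "sin (omg t) < sin (omg t')"
    using omg_bounds[of t] omg_bounds[of t'] omg_strict_mono[of t t'] by (intro sin_monotone_2pi) auto
  then show ?thesis using sin_omg_pos by (intro power_strict_mono) (auto intro: less_imp_le)
qed

locale local_model =
  fixes z :: "real^'n::finite"
begin

definition tau :: "'n \<Rightarrow> real^'n \<Rightarrow> real" where
  "tau i y = (svec y $ i)\<^sup>2 - (svec z $ i)\<^sup>2"

lemma tau_alg: "tau i \<in> alg bgens"
  unfolding tau_def[abs_def] svec_nth by (intro alg_intros coord_gens_mem)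

lemma tau_z [simp]: "tau i z = 0"
  by (simp add: tau_def)

lemma tau_fn: "tau i = (\<lambda>y. (\<lambda>t. (sin (omg t))\<^sup>2 - (svec z $ i)\<^sup>2) (y $ i))"
  by (rule ext) (simp add: tau_def svec_def)

lemma tau_other: "l \<noteq> i \<Longrightarrow> partial_at l (tau i) = (\<lambda>_. 0)"
  unfolding tau_fn by (rule partial_at_other_coord)

lemma tau_same: "partial_at i (tau i) z \<noteq> 0"
proof -
  have "((\<lambda>t. (sin (omg t))\<^sup>2 - c) has_real_derivative 2 * sin (omg t) * (cos (omg t) * ((1 / 2) * (1 / (1 + t\<^sup>2))))) (at t)" for t c
    by (auto intro!: derivative_eq_intros omg_derivative)
  then have "partial_at i (tau i) =
     (\<lambda>y. 2 * sin (omg (y $ i)) * (cos (omg (y $ i)) * ((1 / 2) * (1 / (1 + (y $ i)\<^sup>2)))))"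
    unfolding tau_fn by (rule partial_at_same_coord)
  moreover have "1 + (z $ i)\<^sup>2 \<noteq> 0" by (metis add_pos_nonneg less_numeral_extra(1) less_numeral_extra(3) zero_le_power2)
  ultimately show ?thesis using sin_omg_pos[of "z $ i"] by simp
qed

text \<open>The \<open>tau i\<close> are even in the sines and form local coordinates at \<open>z\<close>, as the sines do not vanish;
  an odd monomial in the sines is therefore a harmless prefactor.\<close>

lemma interpolate:
  fixes t :: "'k \<Rightarrow> ('n \<Rightarrow> nat) \<Rightarrow> real"
  assumes G: "parpoly 0 G" "G (svec z) \<noteq> 0"
  obtains F where "\<And>j. parpoly e (F j)"
    "\<And>j \<beta>. sum \<beta> UNIV \<le> L \<Longrightarrow> mpartial \<beta> (\<lambda>y. G (svec y) * F j (svec y)) z = t j \<beta>"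
proof -
  have "\<exists>F. parpoly e F \<and> (\<forall>\<beta>. sum \<beta> UNIV \<le> L \<longrightarrow> mpartial \<beta> (\<lambda>y. G (svec y) * F (svec y)) z = t j \<beta>)" for j
  proof -
    define S where "S = {(\<lambda>y. G (svec y) * F (svec y)) | F. parpoly e F}"
    define i1 :: 'n where "i1 = undefined"
    define \<sigma> where "\<sigma> y = G (svec y) * svec y $ i1 ^ e" for y
    have zero: "parpoly e (\<lambda>_. 0)"
      using parpoly.mul[OF parpoly.const[of 0] parpoly_coord_power[of e]] by simp
    have "\<exists>h\<in>S. \<forall>\<beta>. sum \<beta> UNIV \<le> L \<longrightarrow> mpartial \<beta> h z = t j \<beta>"
    proof (rule jets_surjective[OF smooth_coord_gens commuting_coord_gens tau_alg tau_z tau_other tau_same])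
      show "\<sigma> \<in> alg bgens"
        using parpoly_alg[OF parpoly.mul[OF G(1) parpoly_coord_power[of e i1]]] by (simp add: \<sigma>_def[abs_def])
      show "\<sigma> z \<noteq> 0" using G(2) sin_omg_pos(1)[of "z $ i1"] by (simp add: \<sigma>_def svec_def)
      show "S \<subseteq> alg bgens" unfolding S_def using parpoly_alg[OF parpoly.mul[OF G(1)]] by auto
      show "(\<lambda>_. 0) \<in> S" unfolding S_def using zero by (auto intro!: exI[of _ "\<lambda>_. 0"])
      show "(\<lambda>y. f y + g y) \<in> S" if fg: "f \<in> S" "g \<in> S" for f g
      proof -
        obtain F F' where "f = (\<lambda>y. G (svec y) * F (svec y))" "g = (\<lambda>y. G (svec y) * F' (svec y))" "parpoly e F" "parpoly e F'"
          using fg by (auto simp: S_def)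
        then show ?thesis unfolding S_def using parpoly.add[of e F F']
          by (auto intro!: exI[of _ "\<lambda>s. F s + F' s"] simp: distrib_left)
      qed
      show "(\<lambda>y. c * (\<sigma> y * (\<Prod>i\<in>UNIV. tau i y ^ \<gamma> i))) \<in> S" for c \<gamma>
      proof -
        define Fm where "Fm s = c * (s $ i1 ^ e * (\<Prod>i\<in>UNIV. ((s $ i)\<^sup>2 - (svec z $ i)\<^sup>2) ^ \<gamma> i))" for s
        have "parpoly (e + 0) (\<lambda>s. s $ i1 ^ e * (\<Prod>i\<in>UNIV. ((s $ i)\<^sup>2 - (svec z $ i)\<^sup>2) ^ \<gamma> i))"
          by (intro parpoly.mul parpoly_coord_power parpoly_prod parpoly_power parpoly_square_diff)
        from parpoly.mul[OF parpoly.const[of c] this] have "parpoly e Fm" by (simp add: Fm_def[abs_def])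
        moreover have "(\<lambda>y. c * (\<sigma> y * (\<Prod>i\<in>UNIV. tau i y ^ \<gamma> i))) = (\<lambda>y. G (svec y) * Fm (svec y))"
          by (rule ext) (simp add: \<sigma>_def Fm_def tau_def algebra_simps)
        ultimately show ?thesis unfolding S_def by blast
      qed
    qed
    then show ?thesis unfolding S_def by auto
  qed
  then obtain F where "\<And>j. parpoly e (F j)" "\<And>j \<beta>. sum \<beta> UNIV \<le> L \<Longrightarrow> mpartial \<beta> (\<lambda>y. G (svec y) * F j (svec y)) z = t j \<beta>"
    by metis
  then show thesis by (rule that)
qed

text \<open>The square of \<open>sin (omg t)\<close> is strictly monotone on the whole line, so
  small values of all \<open>tau i\<close> confine \<open>y\<close> to a neighbourhood of
  \<open>z\<close>; no remote component of the region can occur.\<close>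

lemma tau_region:
  assumes "\<delta> > 0"
  obtains \<epsilon> where "\<epsilon> > 0" "\<And>y. (\<Sum>i\<in>UNIV. (tau i y)\<^sup>2) \<le> \<epsilon>\<^sup>2 \<Longrightarrow> y \<in> cball z \<delta>"
proof -
  \<comment> \<open>Divided by the dimension because the norm is estimated by the sum of the
    coordinates.\<close>
  define \<delta>' where "\<delta>' = \<delta> / real CARD('n)"
  have n: "real CARD('n) > 0" by simp
  have \<delta>': "\<delta>' > 0" using assms by (simp add: \<delta>'_def)
  let ?q = "\<lambda>t. (sin (omg t))\<^sup>2"
  define M where "M = (\<Union>i\<in>UNIV. {?q (z $ i + \<delta>') - ?q (z $ i), ?q (z $ i) - ?q (z $ i - \<delta>')})"
  have M: "finite M" "M \<noteq> {}" "\<And>u. u \<in> M \<Longrightarrow> u > 0"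
    using \<delta>' by (auto simp: M_def sin_omg_square_mono)
  define \<epsilon> where "\<epsilon> = Min M / 2"
  have e: "\<epsilon> > 0" unfolding \<epsilon>_def using M by (simp add: Min_gr_iff)
  have eM: "\<epsilon> < u" if "u \<in> M" for u
  proof -
    have "Min M \<le> u" using M that by simp
    then show ?thesis using e by (simp add: \<epsilon>_def)
  qed
  show thesis
  proof (rule that[OF e])
    fix y assume y: "(\<Sum>i\<in>UNIV. (tau i y)\<^sup>2) \<le> \<epsilon>\<^sup>2"
    have "\<bar>y $ i - z $ i\<bar> \<le> \<delta>'" for i
    proof (rule ccontr)
      assume "\<not> ?thesis"
      then consider "z $ i + \<delta>' < y $ i" | "y $ i < z $ i - \<delta>'" by linarith
      then have "\<epsilon> < \<bar>tau i y\<bar>"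
      proof cases
        case 1
        have "\<epsilon> < ?q (z $ i + \<delta>') - ?q (z $ i)" by (rule eM) (auto simp: M_def)
        then show ?thesis using sin_omg_square_mono[OF 1] by (simp add: tau_def svec_def)
      next
        case 2
        have "\<epsilon> < ?q (z $ i) - ?q (z $ i - \<delta>')" by (rule eM) (auto simp: M_def)
        then show ?thesis using sin_omg_square_mono[OF 2] by (simp add: tau_def svec_def)
      qed
      then have "\<epsilon>\<^sup>2 < (tau i y)\<^sup>2" using e by (metis abs_of_pos abs_le_square_iff not_le)
      also have "\<dots> \<le> (\<Sum>i\<in>UNIV. (tau i y)\<^sup>2)" by (rule member_le_sum) auto
      finally show False using y by simp
    qed
    then have "(\<Sum>i\<in>UNIV. \<bar>(y - z) $ i\<bar>) \<le> real CARD('n) * \<delta>'"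
      using sum_bounded_above[of "UNIV :: 'n set" "\<lambda>i. \<bar>(y - z) $ i\<bar>" \<delta>'] by simp
    also have "\<dots> = \<delta>" using n by (simp add: \<delta>'_def)
    finally have "norm (y - z) \<le> \<delta>" using norm_le_l1_cart[of "y - z"] by linarith
    then show "y \<in> cball z \<delta>" by (simp add: dist_norm norm_minus_commute)
  qed
qed

text \<open>The germ at \<open>z\<close> with jet \<open>x\<close> is glued into the polynomial with jet \<open>b\<close>: their
  difference is multiplied by a polynomial vanishing to high order on the boundary of \<open>K\<close>.\<close>

lemma glued_polynomial:
  fixes x b :: "('n, 'k::finite) jvar \<Rightarrow> real"
  assumes "\<epsilon> > 0"
  obtains F :: "'k \<Rightarrow> real^'n \<Rightarrow> real" and K T where
    "\<And>j. parpoly e (F j)" "compact K" "open T" "T \<subseteq> K" "z \<in> T"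
    "\<And>j \<beta>. sum \<beta> UNIV \<le> Suc r \<Longrightarrow> mpartial \<beta> (\<lambda>y. F j (svec y)) z = x (Inr (\<beta>, j))"
    "\<And>y i. y \<in> K \<Longrightarrow> \<bar>y $ i - z $ i\<bar> < \<epsilon>"
    "\<And>y \<beta> j. y \<in> K - T \<Longrightarrow> sum \<beta> UNIV \<le> r \<Longrightarrow> \<bar>mpartial \<beta> (\<lambda>y. F j (svec y)) y - b (Inr (\<beta>, j))\<bar> < \<epsilon>"
proof -
  obtain Fg where Fg: "\<And>j. parpoly e (Fg j :: real^'n \<Rightarrow> real)"
    "\<And>j \<beta>. sum \<beta> UNIV \<le> r \<Longrightarrow> mpartial \<beta> (\<lambda>y. 1 * Fg j (svec y)) z = b (Inr (\<beta>, j :: 'k))"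
    using interpolate[OF parpoly.const[of 1], of e r "\<lambda>j \<beta>. b (Inr (\<beta>, j))"] by auto
  define g where "g j y = Fg j (svec y)" for j y
  have g_alg: "g j \<in> alg bgens" for j unfolding g_def[abs_def] by (rule parpoly_alg[OF Fg(1)])
  have gz: "mpartial \<beta> (g j) z = b (Inr (\<beta>, j))" if "sum \<beta> UNIV \<le> r" for j \<beta>
    using Fg(2)[OF that, of j] by (simp add: g_def[abs_def])
  have "\<exists>d>0. \<forall>y. dist y z < d \<longrightarrow> \<bar>mpartial (fst \<beta>j) (g (snd \<beta>j)) y - mpartial (fst \<beta>j) (g (snd \<beta>j)) z\<bar> < \<epsilon>" for \<beta>j
    using alg_continuous[OF smooth_coord_gens mpartial_alg[OF smooth_coord_gens g_alg], of UNIV] assms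
    unfolding continuous_on_iff dist_real_def by (metis UNIV_I)
  then obtain d where d: "\<And>\<beta>j. d \<beta>j > 0"
    "\<And>\<beta>j y. dist y z < d \<beta>j \<Longrightarrow> \<bar>mpartial (fst \<beta>j) (g (snd \<beta>j)) y - mpartial (fst \<beta>j) (g (snd \<beta>j)) z\<bar> < \<epsilon>" by metis
  define Q where "Q = {\<beta>j. Inr \<beta>j \<in> (jet_vars r :: ('n, 'k) jvar set)}"
  have Q: "finite Q"
    unfolding Q_def using finite_vimageI[OF finite_jet_vars[of r] , of Inr] by (simp add: vimage_def)
  define \<delta> where "\<delta> = Min (insert \<epsilon> (d ` Q)) / 2"
  have "Min (insert \<epsilon> (d ` Q)) > 0" using Q d(1) assms by (subst Min_gr_iff) auto
  then have \<delta>: "\<delta> > 0" "\<delta> < Min (insert \<epsilon> (d ` Q))" by (auto simp: \<delta>_def)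
  have \<delta>\<epsilon>: "\<delta> < \<epsilon>" using \<delta>(2) Q by (simp add: Min_gr_iff)
  have \<delta>d: "\<delta> < d q" if "q \<in> Q" for q using \<delta>(2) Q that by (simp add: Min_gr_iff)
  obtain \<epsilon>2 where \<epsilon>2: "\<epsilon>2 > 0" "\<And>y. (\<Sum>i\<in>UNIV. (tau i y)\<^sup>2) \<le> \<epsilon>2\<^sup>2 \<Longrightarrow> y \<in> cball z \<delta>"
    using tau_region[OF \<delta>(1)] by blast
  \<comment> \<open>The region where this is nonnegative is the compact neighbourhood of
    \<open>z\<close>; it is even in the sines, so multiplying by it preserves parity.\<close>
  define GA where "GA s = \<epsilon>2\<^sup>2 - (\<Sum>i\<in>UNIV. ((s $ i)\<^sup>2 - (svec z $ i)\<^sup>2)\<^sup>2)" for s :: "real^'n"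
  define a where "a y = GA (svec y)" for y
  have a_eq: "a y = \<epsilon>2\<^sup>2 - (\<Sum>i\<in>UNIV. (tau i y)\<^sup>2)" for y by (simp add: a_def GA_def tau_def)
  have GA: "parpoly 0 GA"
  proof -
    have "parpoly 0 (\<lambda>s. \<epsilon>2\<^sup>2 + (0 + (-1)) * (\<Sum>i\<in>UNIV. ((s $ i)\<^sup>2 - (svec z $ i)\<^sup>2)\<^sup>2))"
      by (intro parpoly.add parpoly.const parpoly.mul[of 0 _ 0, simplified] parpoly_sum parpoly_power parpoly_square_diff)
    then show ?thesis by (simp add: GA_def[abs_def])
  qed
  have a_alg: "a \<in> alg bgens" unfolding a_def[abs_def] by (rule parpoly_alg[OF GA])
  \<comment> \<open>With exponent \<open>Suc r\<close>, all derivatives up to order \<open>r\<close>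
    of the correction vanish where \<open>a\<close> does.\<close>
  have GAp: "parpoly 0 (\<lambda>s. GA s ^ Suc r)" by (rule parpoly_power[OF GA])
  have "GA (svec z) = \<epsilon>2\<^sup>2" using a_eq[of z] by (simp add: a_def)
  then have GAz: "GA (svec z) ^ Suc r \<noteq> 0" using \<epsilon>2(1) by simp
  \<comment> \<open>Order \<open>Suc r\<close> is prescribed at \<open>z\<close>, one more than the
    jets of \<open>W\<close>, because transversality involves the first derivatives of the
    r-jet.\<close>
  obtain Fq where Fq: "\<And>j. parpoly e (Fq j :: real^'n \<Rightarrow> real)"
    "\<And>j \<beta>. sum \<beta> UNIV \<le> Suc r \<Longrightarrow> mpartial \<beta> (\<lambda>y. GA (svec y) ^ Suc r * Fq j (svec y)) z = x (Inr (\<beta>, j :: 'k)) - mpartial \<beta> (g j) z"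
    using interpolate[OF GAp GAz, of e "Suc r" "\<lambda>j \<beta>. x (Inr (\<beta>, j)) - mpartial \<beta> (g j) z"] by blast
  define F where "F j s = Fg j s + GA s ^ Suc r * Fq j s" for j s
  have Fpar: "parpoly e (F j)" for j
    unfolding F_def[abs_def] using parpoly.mul[OF GAp Fq(1)[of j]] by (intro parpoly.add Fg) simp
  define q where "q j y = Fq j (svec y)" for j y
  have q_alg: "q j \<in> alg bgens" for j unfolding q_def[abs_def] by (rule parpoly_alg[OF Fq(1)])
  have F_eq: "(\<lambda>y. F j (svec y)) = (\<lambda>y. g j y + a y ^ Suc r * q j y)" for j
    by (simp add: F_def g_def a_def q_def)
  have mF: "mpartial \<beta> (\<lambda>y. F j (svec y)) y = mpartial \<beta> (g j) y + mpartial \<beta> (\<lambda>y. a y ^ Suc r * q j y) y" for \<beta> j y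
    unfolding F_eq mpartial_def
      pderivs_add[OF smooth_coord_gens g_alg alg.mul[OF alg_power[OF a_alg] q_alg]] ..
  define K where "K = {y. 0 \<le> a y}"
  define T where "T = {y. 0 < a y}"
  have Kball: "K \<subseteq> cball z \<delta>" using \<epsilon>2(2) by (auto simp: K_def a_eq)
  have ca: "continuous_on UNIV a" by (rule alg_continuous[OF smooth_coord_gens a_alg])
  have "closed K" unfolding K_def by (intro closed_Collect_le continuous_on_const ca)
  then have "compact K" using Kball by (metis bounded_cball bounded_subset compact_eq_bounded_closed)
  moreover have "open T" unfolding T_def by (intro open_Collect_less continuous_on_const ca)
  moreover have "T \<subseteq> K" by (auto simp: T_def K_def)
  moreover have "z \<in> T" using \<epsilon>2(1) by (simp add: T_def a_eq)
  moreover have "mpartial \<beta> (\<lambda>y. F j (svec y)) z = x (Inr (\<beta>, j))" if "sum \<beta> UNIV \<le> Suc r" for \<beta> j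
    using Fq(2)[OF that, of j] unfolding mF a_def q_def by simp
  moreover have "\<bar>y $ i - z $ i\<bar> < \<epsilon>" if "y \<in> K" for y i
  proof -
    have "\<bar>(y - z) $ i\<bar> \<le> norm (y - z)" by (rule component_le_norm_cart)
    also have "\<dots> \<le> \<delta>" using Kball that by (auto simp: dist_norm norm_minus_commute)
    finally show ?thesis using \<delta>\<epsilon> by simp
  qed
  moreover have "\<bar>mpartial \<beta> (\<lambda>y. F j (svec y)) y - b (Inr (\<beta>, j))\<bar> < \<epsilon>" if y: "y \<in> K - T" and \<beta>: "sum \<beta> UNIV \<le> r" for y \<beta> j
  proof -
    have "a y = 0" using y by (auto simp: K_def T_def)
    then have "mpartial \<beta> (\<lambda>y. a y ^ Suc r * q j y) y = 0"
      unfolding mpartial_def using \<beta>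
      by (intro pderivs_power_mult_vanish[OF smooth_coord_gens a_alg q_alg]) (simp_all add: length_mpartial_list)
    moreover have "(\<beta>, j) \<in> Q" using \<beta> by (simp add: Q_def)
    from \<delta>d[OF this] have "dist y z < d (\<beta>, j)" using Kball y by (auto simp: dist_commute)
    from d(2)[OF this] have "\<bar>mpartial \<beta> (g j) y - b (Inr (\<beta>, j))\<bar> < \<epsilon>" using gz[OF \<beta>] by simp
    ultimately show ?thesis unfolding mF by simp
  qed
  ultimately show thesis by (rule that[OF Fpar])
qed

end

section \<open>Singular loci with many components\<close>

lemma pderivs_translate: "pderivs is (\<lambda>w. f (w + a)) = (\<lambda>w. pderivs is f (w + a))"
proof (induction "is")
  case (Cons i "is")
  have "partial_at i (\<lambda>w. g (w + a)) y = partial_at i g (y + a)" for g y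
    by (simp add: partial_at_def algebra_simps)
  then show ?case using Cons by auto
qed simp

lemma mpartial_translate: "mpartial \<beta> (\<lambda>w. f (w + a)) y = mpartial \<beta> f (y + a)"
  unfolding mpartial_def pderivs_translate ..

text \<open>Jets include the base point in \<open>real^'n\<close>. Translating the chart changes
  that coordinate at will while leaving the derivatives alone.\<close>

lemma embedding_translate:
  assumes "embedding_into_sphere \<phi>"
  shows "embedding_into_sphere (\<lambda>w. \<phi> (w + a))"
proof -
  have tr: "((\<lambda>w. w + a) has_derivative (\<lambda>h. h)) (at w)" for w by (auto intro!: derivative_eq_intros)
  have "smooth_map (\<lambda>w. \<phi> (w + a))"
    unfolding smooth_map_def
  proof (intro allI)
    fix "is" j
    have "pderivs is (\<lambda>z. \<phi> z $ j) differentiable at (w + a)" for w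
      using assms by (auto simp: embedding_into_sphere_def smooth_map_def differentiable_on_def)
    then have "(\<lambda>w. pderivs is (\<lambda>z. \<phi> z $ j) (w + a)) differentiable at w" for w
      unfolding differentiable_def using has_derivative_compose[OF tr] by blast
    then show "pderivs is (\<lambda>w. \<phi> (w + a) $ j) differentiable_on UNIV"
      unfolding pderivs_translate[of "is" "\<lambda>z. \<phi> z $ j"] by (simp add: differentiable_on_def)
  qed
  moreover have "range (\<lambda>w. \<phi> (w + a)) = range \<phi>"
    by (auto simp: image_iff) (metis diff_add_cancel)
  moreover have "\<exists>D. ((\<lambda>w. \<phi> (w + a)) has_derivative D) (at y) \<and> inj D" for y
  proof -
    obtain D where "(\<phi> has_derivative D) (at (y + a))" "inj D"
      using assms by (auto simp: embedding_into_sphere_def)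
    then show ?thesis using has_derivative_compose[OF tr, of \<phi> D y] by blast
  qed
  moreover have "\<exists>\<psi>. homeomorphism UNIV (range \<phi>) (\<lambda>w. \<phi> (w + a)) \<psi>"
  proof -
    obtain \<psi> where \<psi>: "homeomorphism UNIV (range \<phi>) \<phi> \<psi>" using assms by (auto simp: embedding_into_sphere_def)
    have "homeomorphism UNIV UNIV (\<lambda>w. w + a) (\<lambda>w. w - a)"
      unfolding homeomorphism_def by (auto intro!: continuous_intros image_eqI[of _ _ "_ - a"] image_eqI[of _ _ "_ + a"])
    from homeomorphism_compose[OF this \<psi>] show ?thesis by (auto simp: o_def)
  qed
  ultimately show ?thesis using assms by (simp add: embedding_into_sphere_def)
qed

lemma smooth_poly_map: "smooth_map (poly_map d c :: real^'m::finite \<Rightarrow> real^'k::finite)"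
proof -
  have "(\<lambda>x. poly_map d c x $ j) \<in> alg (coord_gens 1 (\<lambda>_. 0))" for j
    unfolding poly_map_def by simp (intro alg_intros coord_gens_mem)
  then show ?thesis
    unfolding smooth_map_def differentiable_on_def
    by (intro allI ballI alg_differentiable[OF smooth_coord_gens] pderivs_alg[OF smooth_coord_gens])
qed

context sphere_chart
begin

lemma poly_chart_alg: "(\<lambda>y. poly_map d c (phi y) $ j) \<in> alg (chart_gens m jj)"
  unfolding poly_map_def by simp (intro alg_intros phi_alg)

text \<open>A polynomial map depends linearly on its coefficients, and the derivatives of the
  finitely many monomials are bounded on \<open>K\<close>.\<close>

lemma coefficient_perturbation:
  assumes K: "compact K"
  obtains M where "M \<ge> 0"
    "\<And>c c' t y \<beta> j. \<forall>j. \<forall>\<alpha>\<in>monomials d. \<bar>c j \<alpha> - c' j \<alpha>\<bar> \<le> t \<Longrightarrow> y \<in> K \<Longrightarrow> sum \<beta> UNIV \<le> r \<Longrightarrow>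
      \<bar>mpartial \<beta> (\<lambda>y. poly_map d c (phi y) $ j) y - mpartial \<beta> (\<lambda>y. (poly_map d c' (phi y) :: real^'k::finite) $ j) y\<bar> \<le> M * t"
proof -
  define P where "P \<alpha> = (\<lambda>y. xpow \<alpha> (phi y))" for \<alpha>
  have P: "P \<alpha> \<in> alg (chart_gens m jj)" for \<alpha>
    unfolding P_def xpow_def by (intro alg_intros phi_alg)
  have mp: "mpartial \<beta> (\<lambda>y. (poly_map d c (phi y) :: real^'k) $ j) y = (\<Sum>\<alpha>\<in>monomials d. c j \<alpha> * mpartial \<beta> (P \<alpha>) y)" for \<beta> c j y
  proof -
    have "(\<lambda>y. (poly_map d c (phi y) :: real^'k) $ j) = (\<lambda>y. \<Sum>\<alpha>\<in>monomials d. c j \<alpha> * P \<alpha> y)"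
      by (simp add: poly_map_def P_def xpow_def)
    then show ?thesis unfolding mpartial_def
      by (simp only: pderivs_sum[OF smooth_chart_gens alg.mul[OF alg.const P]] pderivs_cmult[OF smooth_chart_gens P])
  qed
  have ex: "\<exists>B. B \<ge> 0 \<and> (\<forall>y\<in>K. \<bar>mpartial \<beta> (P \<alpha>) y\<bar> \<le> B)" for \<alpha> \<beta>
  proof -
    have "bounded (mpartial \<beta> (P \<alpha>) ` K)"
      by (intro compact_imp_bounded compact_continuous_image[OF _ K] alg_continuous[OF smooth_chart_gens] mpartial_alg[OF smooth_chart_gens] P)
    then obtain B where "\<forall>y\<in>K. \<bar>mpartial \<beta> (P \<alpha>) y\<bar> \<le> B" by (auto simp: bounded_iff)
    then show ?thesis by (intro exI[of _ "\<bar>B\<bar>"]) force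
  qed
  have "\<forall>\<alpha>. \<exists>B. \<forall>\<beta>. B \<beta> \<ge> 0 \<and> (\<forall>y\<in>K. \<bar>mpartial \<beta> (P \<alpha>) y\<bar> \<le> B \<beta>)"
    using ex by (intro allI choice)
  then obtain B where "\<forall>\<alpha> \<beta>. B \<alpha> \<beta> \<ge> 0 \<and> (\<forall>y\<in>K. \<bar>mpartial \<beta> (P \<alpha>) y\<bar> \<le> B \<alpha> \<beta>)"
    by (auto dest: choice)
  then have B: "\<And>\<alpha> \<beta>. B \<alpha> \<beta> \<ge> 0" "\<And>\<alpha> \<beta> y. y \<in> K \<Longrightarrow> \<bar>mpartial \<beta> (P \<alpha>) y\<bar> \<le> B \<alpha> \<beta>" by auto
  define Q where "Q = {\<beta> :: 'n \<Rightarrow> nat. sum \<beta> UNIV \<le> r}"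
  have Q: "finite Q"
  proof (rule finite_subset)
    show "Q \<subseteq> (\<Union>k\<le>r. {\<beta>. sum \<beta> UNIV = k})" by (auto simp: Q_def)
  qed (auto intro: finite_multiindices)
  define M where "M = (\<Sum>\<beta>\<in>Q. \<Sum>\<alpha>\<in>monomials d. B \<alpha> \<beta>)"
  show thesis
  proof (rule that[of M])
    show "M \<ge> 0" unfolding M_def using B(1) by (intro sum_nonneg) auto
    fix c c' :: "'k \<Rightarrow> ('m \<Rightarrow> nat) \<Rightarrow> real" and t :: real and y and \<beta> :: "'n \<Rightarrow> nat" and j :: 'k
    assume c: "\<forall>j. \<forall>\<alpha>\<in>monomials d. \<bar>c j \<alpha> - c' j \<alpha>\<bar> \<le> t" and y: "y \<in> K" and \<beta>: "sum \<beta> (UNIV :: 'n set) \<le> r"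
    show "\<bar>mpartial \<beta> (\<lambda>y. poly_map d c (phi y) $ j) y - mpartial \<beta> (\<lambda>y. (poly_map d c' (phi y) :: real^'k) $ j) y\<bar> \<le> M * t"
    proof (cases "monomials d = ({} :: ('m \<Rightarrow> nat) set)")
      case True
      then show ?thesis unfolding mp by (simp add: M_def)
    next
      case False
      \<comment> \<open>The presence of a coefficient forces its bound \<open>t\<close> to be
        nonnegative.\<close>
      then have t: "t \<ge> 0" using c abs_ge_zero order_trans by blast
      have "mpartial \<beta> (\<lambda>y. poly_map d c (phi y) $ j) y - mpartial \<beta> (\<lambda>y. (poly_map d c' (phi y) :: real^'k) $ j) y
         = (\<Sum>\<alpha>\<in>monomials d. (c j \<alpha> - c' j \<alpha>) * mpartial \<beta> (P \<alpha>) y)"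
        unfolding mp by (simp add: sum_subtractf left_diff_distrib)
      also have "\<bar>\<dots>\<bar> \<le> (\<Sum>\<alpha>\<in>monomials d. t * B \<alpha> \<beta>)"
        using c B y t by (intro order_trans[OF sum_abs] sum_mono) (auto simp: abs_mult intro!: mult_mono)
      also have "\<dots> = (\<Sum>\<alpha>\<in>monomials d. B \<alpha> \<beta>) * t" by (simp add: sum_distrib_left mult.commute)
      also have "\<dots> \<le> M * t"
        unfolding M_def using t \<beta> Q B(1)
        by (intro mult_right_mono member_le_sum[of \<beta> Q "\<lambda>\<beta>. \<Sum>\<alpha>\<in>monomials d. B \<alpha> \<beta>"]) (auto simp: Q_def intro!: sum_nonneg)
      finally show ?thesis .
    qed
  qed
qed

end

lemma coefficient_ball_open:
  "open_in_coeff_space d {c :: 'k::finite \<Rightarrow> ('m::finite \<Rightarrow> nat) \<Rightarrow> real. c \<in> coeff_space d \<and> (\<forall>j. \<forall>\<alpha>\<in>monomials d. \<bar>c j \<alpha> - c0 j \<alpha>\<bar> < \<eta>)}"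
  unfolding open_in_coeff_space_def
proof (intro conjI ballI)
  fix c :: "'k \<Rightarrow> ('m \<Rightarrow> nat) \<Rightarrow> real"
  assume c: "c \<in> {c. c \<in> coeff_space d \<and> (\<forall>j. \<forall>\<alpha>\<in>monomials d. \<bar>c j \<alpha> - c0 j \<alpha>\<bar> < \<eta>)}"
  let ?E = "insert 1 ((\<lambda>(j, \<alpha>). \<eta> - \<bar>c j \<alpha> - c0 j \<alpha>\<bar>) ` (UNIV \<times> monomials d))"
  have fin: "finite ?E" by (simp add: finite_monomials)
  have pos: "Min ?E > 0" using c fin by (subst Min_gr_iff) auto
  have le: "Min ?E \<le> \<eta> - \<bar>c j \<alpha> - c0 j \<alpha>\<bar>" if "\<alpha> \<in> monomials d" for j \<alpha>
    using fin that by (intro Min_le) auto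
  show "\<exists>e>0. \<forall>c'\<in>coeff_space d. (\<forall>j. \<forall>\<alpha>\<in>monomials d. \<bar>c' j \<alpha> - c j \<alpha>\<bar> < e) \<longrightarrow>
      c' \<in> {c. c \<in> coeff_space d \<and> (\<forall>j. \<forall>\<alpha>\<in>monomials d. \<bar>c j \<alpha> - c0 j \<alpha>\<bar> < \<eta>)}"
  proof (intro exI[of _ "Min ?E"] conjI ballI impI pos CollectI allI)
    fix c' :: "'k \<Rightarrow> ('m \<Rightarrow> nat) \<Rightarrow> real" and j :: 'k and \<alpha> :: "'m \<Rightarrow> nat"
    assume "\<forall>j. \<forall>\<alpha>\<in>monomials d. \<bar>c' j \<alpha> - c j \<alpha>\<bar> < Min ?E" "\<alpha> \<in> monomials d"
    then have "\<bar>c' j \<alpha> - c j \<alpha>\<bar> < Min ?E" by blast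
    with le[OF \<open>\<alpha> \<in> monomials d\<close>, of j] show "\<bar>c' j \<alpha> - c0 j \<alpha>\<bar> < \<eta>" by linarith
  qed
qed auto

text \<open>The model \<open>F\<close>, its neighbourhood \<open>T\<close> inside \<open>K\<close>,
  and the tolerances are fixed from \<open>W0\<close> and the parity \<open>e\<close> before
  \<open>k\<close> and \<open>d\<close> appear, so \<open>N\<close> is uniform. Each chart then
  contributes one clopen piece of the singular locus.\<close>

lemma many_singular_components:
  fixes W0 :: "('n::finite, 'k::finite) jet set" and r e :: nat
  assumes dim_m: "CARD('m::finite) = CARD('n) + 1"
    and intr: "intrinsic r W0 TYPE('m)"
    and sa: "semialgebraic (jet_vars r) W0"
    and ne: "W0 \<noteq> {}"
    and codim_pos: "0 < jet_codim r W0"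
    and codim_le: "jet_codim r W0 \<le> int CARD('n)"
  shows "\<exists>N. \<forall>k d. N * (2 * k + 1) \<le> d \<longrightarrow> d mod 2 = e mod 2 \<longrightarrow>
    (\<exists>U. U \<noteq> {} \<and> open_in_coeff_space d U \<and> (\<forall>c\<in>U.
       of_nat (((2 * k + 1) div (8 * (CARD('n) + 1))) ^ CARD('n)) \<le>
         betti_sum (Sigma_W r W0 (poly_map d (c :: 'k \<Rightarrow> ('m \<Rightarrow> nat) \<Rightarrow> real)) :: (real^'m) set)))"
proof -
  let ?V = "jet_vars r :: ('n, 'k) jvar set"
  have finV: "finite ?V" by (rule finite_jet_vars)
  obtain I where I: "I \<subseteq> ?V" "proj_has_interior I W0" "sa_dim ?V W0 = card I"
    using sa_dim_witness[OF finV ne] by blast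
  have cardVI: "card (?V - I) \<le> CARD('n)"
  proof -
    have "card (?V - I) = card ?V - card I" using I(1) finV by (simp add: card_Diff_subset finite_subset)
    then show ?thesis using codim_le I(3) unfolding jet_codim_def by linarith
  qed
  have "sa_dim ?V W0 < card ?V" using codim_pos unfolding jet_codim_def by linarith
  from positive_codim_box[OF finV sa ne this] obtain b eb where b: "eb > 0" "box_around ?V b eb \<inter> W0 = {}" by blast
  obtain C x A f \<epsilon> where C: "0 \<in> C" "1 \<in> C" "-1 \<in> C" and T: "triangular C x UNIV A f" and A: "A \<subseteq> ?V - I"
    and fV: "\<And>a. a \<in> A \<Longrightarrow> pvars (f a) \<subseteq> ?V" and \<epsilon>: "\<epsilon> > 0"
    and W: "\<And>y. y \<in> coord_space ?V \<Longrightarrow> (\<forall>u\<in>?V. \<bar>y u - x u\<bar> < \<epsilon>) \<Longrightarrow> (\<forall>a\<in>A. peval (f a) y = 0) \<Longrightarrow> y \<in> W0"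
    by (rule generic_point_equations[OF finV sa I(1,2)]) blast
  have finA: "finite A" using A finV finite_subset by blast
  have cardA: "card A \<le> CARD('n)" using card_mono[OF _ A] finV cardVI by simp
  have f0: "peval (f a) x = 0" if "a \<in> A" for a using T that unfolding triangular_def by blast
  have ord: "Inr (\<gamma>, j) \<notin> pvars (f a)" if "a \<in> A" "r < sum \<gamma> UNIV" for a \<gamma> j
    using fV[OF that(1)] that(2) by auto
  have indep: "\<forall>a\<in>A. \<xi> a = 0" if "\<And>i. (\<Sum>a\<in>A. \<xi> a * peval (td i (f a)) x) = 0" for \<xi>
    by (rule total_derivatives_independent[OF C T ord cardA that])
  define z :: "real^'n" where "z = (\<chi> i. x (Inl i))"
  interpret local_model z .
  obtain F :: "'k \<Rightarrow> real^'n \<Rightarrow> real" and K T where F: "\<And>j. parpoly e (F j)"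
    and K: "compact K" and T: "open T" "T \<subseteq> K" "z \<in> T"
    and Fz: "\<And>j \<beta>. sum \<beta> UNIV \<le> Suc r \<Longrightarrow> mpartial \<beta> (\<lambda>y. F j (svec y)) z = x (Inr (\<beta>, j))"
    and Kz: "\<And>y i. y \<in> K \<Longrightarrow> \<bar>y $ i - z $ i\<bar> < eb / 2"
    and Fb: "\<And>y \<beta> j. y \<in> K - T \<Longrightarrow> sum \<beta> UNIV \<le> r \<Longrightarrow> \<bar>mpartial \<beta> (\<lambda>y. F j (svec y)) y - b (Inr (\<beta>, j))\<bar> < eb / 2"
    by (rule glued_polynomial[of "eb / 2" e r x b]) (use b(1) in auto)
  define H where "H j y = F j (svec y)" for j y
  have H_alg: "H j \<in> alg bgens" for j unfolding H_def[abs_def] by (rule parpoly_alg[OF F])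
  obtain \<delta> where \<delta>: "\<delta> > 0" "cball z \<delta> \<subseteq> T" using T by (meson open_contains_cball)
  have Jx: "jinf H z u = x u" if "u \<in> jet_vars (Suc r)" for u
  proof (cases u)
    case (Inr \<beta>j)
    then show ?thesis using that Fz by (cases \<beta>j) (simp add: jinf_def H_def[abs_def])
  qed (simp add: jinf_def z_def)
  \<comment> \<open>The gradient at \<open>z\<close> of the equation composed with the jet, by
    \<open>peval_jinf_has_derivative\<close>; independence of these vectors is
    transversality.\<close>
  define g where "g a = (\<chi> i. peval (td i (f a)) x)" for a
  have "\<exists>\<eta>>0. \<forall>G. (\<forall>y. G y \<in> coord_space ?V) \<longrightarrow> (\<forall>u\<in>?V. continuous_on (cball z \<delta>) (\<lambda>y. G y u)) \<longrightarrow>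
     (\<forall>y\<in>cball z \<delta>. \<forall>u\<in>?V. \<bar>G y u - jinf H y u\<bar> < \<eta>) \<longrightarrow> (\<exists>y\<in>cball z \<delta>. G y \<in> W0)"
  proof (rule robust_intersection[OF finV finA fV _ _ f0 _ _ \<epsilon> W \<delta>(1)])
    show "jinf H z u = x u" if "u \<in> ?V" for u
    proof -
      have "u \<in> jet_vars (Suc r)" using that by (auto simp: jet_vars_def)
      then show ?thesis by (rule Jx)
    qed
    show "continuous_on UNIV (\<lambda>y. jinf H y u)" for u
    proof (cases u)
      case (Inl i)
      then show ?thesis by (simp add: jinf_def continuous_on_component)
    next
      case (Inr \<beta>j)
      obtain \<beta> j where "\<beta>j = (\<beta>, j)" by (cases \<beta>j)
      then show ?thesis using Inr alg_continuous[OF smooth_coord_gens mpartial_alg[OF smooth_coord_gens H_alg], of UNIV \<beta> j]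
        by (simp add: jinf_def)
    qed
    show "((\<lambda>y. peval (f a) (jinf H y)) has_derivative (\<lambda>h. g a \<bullet> h)) (at z)" if "a \<in> A" for a
    proof -
      have "peval (td i (f a)) (jinf H z) = peval (td i (f a)) x" for i
        using pvars_td[OF fV[OF that], of i] Jx by (intro peval_cong) auto
      then have "(\<lambda>h. \<Sum>i\<in>UNIV. h $ i * peval (td i (f a)) (jinf H z)) = (\<lambda>h. g a \<bullet> h)"
        by (simp add: g_def inner_vec_def mult.commute)
      then show ?thesis using peval_jinf_has_derivative[where H = H and e = "f a" and y = z, OF smooth_coord_gens commuting_coord_gens H_alg] by simp
    qed
    show "\<forall>a\<in>A. c a = 0" if c: "(\<Sum>a\<in>A. c a *\<^sub>R g a) = 0" for c
    proof (rule indep)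
      fix i
      have "(\<Sum>a\<in>A. c a * peval (td i (f a)) x) = (\<Sum>a\<in>A. c a *\<^sub>R g a) $ i"
        by (simp add: g_def)
      then show "(\<Sum>a\<in>A. c a * peval (td i (f a)) x) = 0" by (simp add: c)
    qed
  qed
  then obtain \<eta> where \<eta>: "\<eta> > 0" and rob: "\<And>G. (\<forall>y. G y \<in> coord_space ?V) \<Longrightarrow> (\<forall>u\<in>?V. continuous_on (cball z \<delta>) (\<lambda>y. G y u)) \<Longrightarrow>
     (\<forall>y\<in>cball z \<delta>. \<forall>u\<in>?V. \<bar>G y u - jinf H y u\<bar> < \<eta>) \<Longrightarrow> (\<exists>y\<in>cball z \<delta>. G y \<in> W0)" by blast
  define i0 :: 'm where "i0 = undefined"
  have "card (UNIV :: 'n set) = card (UNIV - {i0})" using dim_m by (simp add: card_Diff_singleton)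
  then obtain \<iota> :: "'n \<Rightarrow> 'm" where "bij_betw \<iota> UNIV (UNIV - {i0})"
    using finite_same_card_bij[of "UNIV :: 'n set" "UNIV - {i0}"] by auto
  then have \<iota>: "inj \<iota>" "range \<iota> = UNIV - {i0}" by (auto simp: bij_betw_def)
  obtain N where N: "\<And>k d. N * (2 * k + 1) \<le> d \<Longrightarrow> d mod 2 = e mod 2 \<Longrightarrow>
    (\<exists>c\<in>coeff_space d. \<forall>x\<in>sphere_set. \<forall>j. poly_map d c x $ j = F j (\<chi> i. csin k (x $ \<iota> i)))"
    using parpoly_realised[where F = F and \<iota> = \<iota>, OF F] by blast
  show ?thesis
  proof (intro exI[of _ N] allI impI)
    fix k d assume kd: "N * (2 * k + 1) \<le> d" "d mod 2 = e mod 2"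
    obtain c0 where c0: "c0 \<in> coeff_space d" "\<And>x j. x \<in> sphere_set \<Longrightarrow> poly_map d c0 x $ j = F j (\<chi> i. csin k (x $ \<iota> i))"
      using N[OF kd] by blast
    define m where "m = real (2 * k + 1)"
    \<comment> \<open>The number of admissible indices per coordinate; 8 stands in for
      \<open>2 * pi\<close>, so every index below \<open>Jn\<close> satisfies the bound of
      \<open>sphere_chart\<close>.\<close>
    define Jn where "Jn = (2 * k + 1) div (8 * (CARD('n) + 1))"
    define JJ where "JJ = (PiE UNIV (\<lambda>_. {..<Jn}) :: ('n \<Rightarrow> nat) set)"
    have finJJ: "finite JJ" unfolding JJ_def by (intro finite_PiE) auto
    have cardJJ: "card JJ = Jn ^ CARD('n)" unfolding JJ_def by (subst card_PiE) auto
    have chart: "sphere_chart i0 \<iota> m jj" if jJ: "jj \<in> JJ" for jj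
    proof
      show "inj \<iota>" "range \<iota> = UNIV - {i0}" by (rule \<iota>)+
      show "m > 0" by (simp add: m_def)
      fix i
      have "jj i < Jn" using jJ by (auto simp: JJ_def PiE_def Pi_def)
      then have "real (jj i) + 1 \<le> real Jn" by linarith
      have "8 * (CARD('n) + 1) * Jn \<le> 2 * k + 1" unfolding Jn_def by (rule times_div_less_eq_dividend)
      then have "real (8 * (CARD('n) + 1) * Jn) \<le> m" unfolding m_def using of_nat_le_iff by blast
      then have Jm: "8 * real Jn \<le> m / (real CARD('n) + 1)" by (simp add: field_simps)
      have "2 * pi * (real (jj i) + 1) \<le> 8 * real Jn"
        using \<open>real (jj i) + 1 \<le> real Jn\<close> pi_less_4 by (intro mult_mono) auto
      then show "2 * pi * (real (jj i) + 1) \<le> m / (real CARD('n) + 1)" using Jm by linarith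
    qed
    \<comment> \<open>The same \<open>H\<close> arises in every chart, so the tolerances found for
      it apply to all of them.\<close>
    have base: "mpartial \<beta> (\<lambda>y. poly_map d c0 (chart i0 \<iota> m jj y) $ j) = mpartial \<beta> (H j)" if jJ: "jj \<in> JJ" for \<beta> j jj
    proof -
      interpret sphere_chart i0 \<iota> m jj by (rule chart[OF jJ])
      have "(\<lambda>y. poly_map d c0 (phi y) $ j) = H j"
        by (rule ext) (simp only: c0(2)[OF phi_sphere] csin_phi[OF m_def] H_def svec_def)
      then show ?thesis by simp
    qed
    have "\<exists>M\<ge>0. \<forall>c t y \<beta> j. (\<forall>j. \<forall>\<alpha>\<in>monomials d. \<bar>c j \<alpha> - c0 j \<alpha>\<bar> \<le> t) \<longrightarrow> y \<in> K \<longrightarrow> sum \<beta> UNIV \<le> r \<longrightarrow>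
      \<bar>mpartial \<beta> (\<lambda>y. poly_map d c (chart i0 \<iota> m jj y) $ j) y - mpartial \<beta> (H j) y\<bar> \<le> M * t" if jJ: "jj \<in> JJ" for jj
    proof -
      interpret sphere_chart i0 \<iota> m jj by (rule chart[OF jJ])
      obtain M where "M \<ge> 0" "\<And>c c' t y \<beta> j. \<forall>j. \<forall>\<alpha>\<in>monomials d. \<bar>c j \<alpha> - c' j \<alpha>\<bar> \<le> t \<Longrightarrow> y \<in> K \<Longrightarrow> sum \<beta> UNIV \<le> r \<Longrightarrow>
        \<bar>mpartial \<beta> (\<lambda>y. poly_map d c (phi y) $ j) y - mpartial \<beta> (\<lambda>y. (poly_map d c' (phi y) :: real^'k) $ j) y\<bar> \<le> M * t"
        using coefficient_perturbation[OF K, of d r] by blast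
      then show ?thesis using base[OF jJ] by (intro exI[of _ M]) metis
    qed
    then obtain M where M: "\<And>jj. jj \<in> JJ \<Longrightarrow> M jj \<ge> 0"
      "\<And>jj c t y \<beta> j. jj \<in> JJ \<Longrightarrow> \<forall>j. \<forall>\<alpha>\<in>monomials d. \<bar>c j \<alpha> - c0 j \<alpha>\<bar> \<le> t \<Longrightarrow> y \<in> K \<Longrightarrow> sum \<beta> UNIV \<le> r \<Longrightarrow>
      \<bar>mpartial \<beta> (\<lambda>y. poly_map d c (chart i0 \<iota> m jj y) $ j) y - mpartial \<beta> (H j) y\<bar> \<le> M jj * t"
      by metis
    define Mt where "Mt = (\<Sum>jj\<in>JJ. M jj)"
    have Mt: "Mt \<ge> 0" "\<And>jj. jj \<in> JJ \<Longrightarrow> M jj \<le> Mt"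
      unfolding Mt_def using M(1) finJJ by (auto intro: sum_nonneg member_le_sum)
    \<comment> \<open>Dividing by \<open>Mt + 1\<close> serves all charts at once, and the factor 2
      makes the bounds strict.\<close>
    define \<rho> where "\<rho> = min \<eta> (eb / 2) / (2 * (Mt + 1))"
    have \<rho>: "\<rho> > 0" using \<eta> b(1) Mt(1) by (simp add: \<rho>_def)
    have M\<rho>: "M jj * \<rho> < \<eta>" "M jj * \<rho> < eb / 2" if "jj \<in> JJ" for jj
    proof -
      have "M jj * \<rho> \<le> (Mt + 1) * \<rho>" using Mt(2)[OF that] \<rho> by (intro mult_right_mono) auto
      also have "\<dots> = min \<eta> (eb / 2) / 2"
      proof -
        have "L * (u / (2 * L)) = u / 2" if "L \<noteq> 0" for L u :: real using that by simp
        then show ?thesis unfolding \<rho>_def using Mt(1) by (metis add_nonneg_pos less_irrefl zero_less_one)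
      qed
      also have "\<dots> < min \<eta> (eb / 2)"
      proof -
        have "0 < min \<eta> (eb / 2)" using \<eta> b(1) by simp
        then show ?thesis by linarith
      qed
      finally show "M jj * \<rho> < \<eta>" "M jj * \<rho> < eb / 2" by simp_all
    qed
    define U where "U = {c. c \<in> coeff_space d \<and> (\<forall>j. \<forall>\<alpha>\<in>monomials d. \<bar>c j \<alpha> - c0 j \<alpha>\<bar> < \<rho>)}"
    show "\<exists>U. U \<noteq> {} \<and> open_in_coeff_space d U \<and> (\<forall>c\<in>U.
       of_nat (((2 * k + 1) div (8 * (CARD('n) + 1))) ^ CARD('n)) \<le>
         betti_sum (Sigma_W r W0 (poly_map d (c :: 'k \<Rightarrow> ('m \<Rightarrow> nat) \<Rightarrow> real)) :: (real^'m) set))"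
    proof (intro exI[of _ U] conjI ballI)
      show "U \<noteq> {}" using c0(1) \<rho> by (auto simp: U_def)
      show "open_in_coeff_space d U" unfolding U_def by (rule coefficient_ball_open)
      fix c assume c: "c \<in> U"
      define p where "p = (poly_map d c :: real^'m \<Rightarrow> real^'k)"
      define S where "S = Sigma_W r W0 p"
      have smooth_p: "smooth_map p" unfolding p_def by (rule smooth_poly_map)
      have close: "\<bar>mpartial \<beta> (\<lambda>y. p (chart i0 \<iota> m jj y) $ j) y - mpartial \<beta> (H j) y\<bar> \<le> M jj * \<rho>"
        if "jj \<in> JJ" "y \<in> K" "sum \<beta> UNIV \<le> r" for jj y \<beta> j
        unfolding p_def using c that(2,3) by (intro M(2)[OF that(1)]) (auto simp: U_def intro: less_imp_le)
      have hit: "\<exists>y\<in>T. chart i0 \<iota> m jj y \<in> S" if jJ: "jj \<in> JJ" for jj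
      proof -
        interpret sphere_chart i0 \<iota> m jj by (rule chart[OF jJ])
        define G where "G y = jet r (p \<circ> phi) y" for y
        have "\<exists>y\<in>cball z \<delta>. G y \<in> W0"
        proof (rule rob, safe)
          show "G y \<in> coord_space ?V" for y
            by (auto simp: G_def jet_def coord_space_def jet_vars_def split: sum.splits)
        next
          fix u assume u: "u \<in> ?V"
          show "continuous_on (cball z \<delta>) (\<lambda>y. G y u)"
          proof (cases u)
            case (Inl i)
            then show ?thesis by (simp add: G_def jet_def continuous_on_component)
          next
            case (Inr \<beta>j)
            obtain \<beta> j where "\<beta>j = (\<beta>, j)" by (cases \<beta>j)
            then show ?thesis using Inr u
                alg_continuous[OF smooth_chart_gens mpartial_alg[OF smooth_chart_gens poly_chart_alg], of "cball z \<delta>" \<beta> d c j]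
              by (simp add: G_def jet_def p_def)
          qed
        next
          fix y u assume y: "y \<in> cball z \<delta>" and u: "u \<in> ?V"
          have yK: "y \<in> K" using y \<delta>(2) T(2) by blast
          show "\<bar>G y u - jinf H y u\<bar> < \<eta>"
          proof (cases u)
            case (Inl i)
            then show ?thesis using \<eta> by (simp add: G_def jet_def jinf_def)
          next
            case (Inr \<beta>j)
            obtain \<beta> j where b: "\<beta>j = (\<beta>, j)" by (cases \<beta>j)
            then have "sum \<beta> UNIV \<le> r" using u Inr by simp
            then show ?thesis using close[OF jJ yK, of \<beta> j] M\<rho>(1)[OF jJ] by (simp add: Inr b G_def jet_def jinf_def)
          qed
        qed
        then obtain y where y: "y \<in> cball z \<delta>" "G y \<in> W0" by blast
        then have "phi y \<in> S" unfolding S_def Sigma_W_def G_def using embedding_phi phi_sphere by blast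
        then show ?thesis using y \<delta>(2) by blast
      qed
      have miss: "chart i0 \<iota> m jj y \<notin> S" if jJ: "jj \<in> JJ" and y: "y \<in> K - T" for jj y
      proof
        interpret sphere_chart i0 \<iota> m jj by (rule chart[OF jJ])
        assume "phi y \<in> S"
        then obtain \<phi> :: "real^'n \<Rightarrow> real^'m" and y' where \<phi>: "embedding_into_sphere \<phi>" "\<phi> y' = phi y" "jet r (p \<circ> \<phi>) y' \<in> W0"
          by (auto simp: S_def Sigma_W_def)
        \<comment> \<open>Shifts the base point of \<open>y\<close> to within \<open>eb / 2\<close>
          of that of \<open>b\<close>, so the whole jet, base point included, lies in the box that
          avoids \<open>W0\<close>.\<close>
        define a where "a = z - (\<chi> i. b (Inl i))"
        define \<psi> where "\<psi> w = phi (w + a)" for w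
        have "embedding_into_sphere \<psi>" unfolding \<psi>_def[abs_def] by (rule embedding_translate[OF embedding_phi])
        moreover have "\<phi> y' = \<psi> (y - a)" by (simp add: \<psi>_def \<phi>)
        \<comment> \<open>\<open>\<phi>\<close> is an arbitrary embedding; intrinsicness moves the
          membership to the translated chart, whose jets are known.\<close>
        ultimately have inW: "jet r (p \<circ> \<psi>) (y - a) \<in> W0"
          using intr \<phi>(1,3) smooth_p unfolding intrinsic_def by blast
        have yK: "y \<in> K" using y by blast
        have "jet r (p \<circ> \<psi>) (y - a) \<in> box_around ?V b eb"
          unfolding box_around_def
        proof (intro CollectI conjI ballI)
          show "jet r (p \<circ> \<psi>) (y - a) \<in> coord_space ?V"
            by (auto simp: jet_def coord_space_def jet_vars_def split: sum.splits)
          fix u assume u: "u \<in> ?V"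
          show "\<bar>jet r (p \<circ> \<psi>) (y - a) u - b u\<bar> < eb"
          proof (cases u)
            case (Inl i)
            then show ?thesis using Kz[OF yK, of i] b(1) by (simp add: jet_def a_def)
          next
            case (Inr \<beta>j)
            obtain \<beta> j where bj: "\<beta>j = (\<beta>, j)" by (cases \<beta>j)
            have \<beta>: "sum \<beta> UNIV \<le> r" using u Inr bj by simp
            have "mpartial \<beta> (\<lambda>w. (p \<circ> \<psi>) w $ j) (y - a) = mpartial \<beta> (\<lambda>w. p (phi w) $ j) y"
              using mpartial_translate[of \<beta> "\<lambda>w. p (phi w) $ j" a "y - a"] by (simp add: \<psi>_def)
            moreover have "H j = (\<lambda>y. F j (svec y))" by (simp add: H_def[abs_def])
            then have "\<bar>mpartial \<beta> (\<lambda>w. p (phi w) $ j) y - b (Inr (\<beta>, j))\<bar> < eb"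
              using close[OF jJ yK \<beta>, of j] M\<rho>(2)[OF jJ] Fb[OF y \<beta>, of j] by (simp only:)
            ultimately show ?thesis using \<beta> by (simp add: Inr bj jet_def)
          qed
        qed
        then show False using inW b(2) by blast
      qed
      have Ssub: "S \<subseteq> sphere_set" by (auto simp: S_def Sigma_W_def)
      obtain pt where pt: "\<And>jj. jj \<in> JJ \<Longrightarrow> pt jj \<in> T \<and> chart i0 \<iota> m jj (pt jj) \<in> S" using hit by metis
      have "of_nat (card JJ) \<le> betti_sum S"
      proof (rule betti_sum_ge_pieces[OF finJJ])
        fix jj assume jJ: "jj \<in> JJ"
        interpret sphere_chart i0 \<iota> m jj by (rule chart[OF jJ])
        show "phi (pt jj) \<in> S \<inter> phi ` T" using pt[OF jJ] by blast
        obtain O' where O': "open O'" "phi ` T = sphere_set \<inter> O'" using openin_phi_image[OF T(1)] by (auto simp: openin_open)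
        then have "S \<inter> phi ` T = S \<inter> O'" using Ssub by blast
        then show "openin (top_of_set S) (S \<inter> phi ` T)" using O'(1) by (simp add: openin_open_Int)
        \<comment> \<open>No singular point lies over \<open>K - T\<close>, so cutting
          \<open>S\<close> with the image of \<open>T\<close> or of \<open>K\<close> gives the same
          set: open from the one, closed from the other.\<close>
        have "phi ` K \<inter> S \<subseteq> phi ` T" using miss[OF jJ] by blast
        then have "S \<inter> phi ` T = S \<inter> phi ` K" using T(2) by blast
        moreover have "closed (phi ` K)"
          by (intro compact_imp_closed compact_continuous_image K continuous_phi)
        ultimately show "closedin (top_of_set S) (S \<inter> phi ` T)" by (simp add: closedin_closed_Int)
        fix jj' assume jj': "jj' \<in> JJ" "jj \<noteq> jj'"
        show "phi ` T \<inter> chart i0 \<iota> m jj' ` T = {}"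
          using chart_ranges_disjoint[OF chart[OF jJ] chart[OF jj'(1)] jj'(2)] by blast
      qed
      then show "of_nat (((2 * k + 1) div (8 * (CARD('n) + 1))) ^ CARD('n)) \<le> betti_sum (Sigma_W r W0 (poly_map d c))"
        by (simp add: S_def p_def cardJJ Jn_def)
    qed
  qed
qed

text \<open>\<open>2 * k + 1\<close> is the largest odd number up to \<open>d div N\<close>.
  Rounding loses at most \<open>16 * N * (n + 1)\<close> in \<open>d\<close>, no more than half of
  it beyond the threshold with 32; hence 16 in place of 8.\<close>

lemma box_count:
  fixes n N d :: nat
  assumes N: "N \<ge> 1" and d: "d \<ge> 32 * N * (n + 1)"
  obtains k where "N * (2 * k + 1) \<le> d" "real d / real (16 * N * (n + 1)) \<le> real ((2 * k + 1) div (8 * (n + 1)))"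
proof -
  define k where "k = (d div N - 1) div 2"
  have "1 \<le> d div N"
  proof -
    have "N \<le> 32 * N * (n + 1)" by simp
    then have "N \<le> d" using d by linarith
    then show ?thesis using N by (simp add: Suc_le_eq div_greater_zero_iff)
  qed
  then have k1: "2 * k + 1 \<le> d div N" and k2: "d div N \<le> 2 * k + 1 + 1" unfolding k_def by linarith+
  have "N * (2 * k + 1) \<le> N * (d div N)" using k1 by (rule mult_le_mono2)
  also have "\<dots> \<le> d" by simp
  finally have A: "N * (2 * k + 1) \<le> d" .
  define q where "q = (2 * k + 1) div (8 * (n + 1))"
  have "2 * k + 1 < 8 * (n + 1) * (q + 1)"
  proof -
    define D where "D = 8 * (n + 1)"
    have "(2 * k + 1) mod D < D" by (simp add: D_def)
    moreover have "2 * k + 1 = D * q + (2 * k + 1) mod D" by (simp add: q_def D_def)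
    ultimately show ?thesis unfolding D_def[symmetric] by (simp add: algebra_simps)
  qed
  then have "2 * k + 1 + 2 \<le> 8 * (n + 1) * (q + 1) + 1" by linarith
  have "d < N * (d div N) + N" using dividend_less_times_div[of N d] N by simp
  also have "\<dots> = N * (d div N + 1)" by simp
  also have "\<dots> \<le> N * (8 * (n + 1) * (q + 1) + 1)"
    using k2 \<open>2 * k + 1 + 2 \<le> _\<close> by (intro mult_le_mono2) linarith
  also have "\<dots> \<le> N * (8 * (n + 1) * (q + 2))" by (intro mult_le_mono2) (simp add: algebra_simps)
  finally have "real d \<le> real (N * (8 * (n + 1) * (q + 2)))" using of_nat_le_iff less_imp_le by blast
  then have 1: "real d \<le> 8 * real N * (real n + 1) * real q + 16 * real N * (real n + 1)" by (simp add: algebra_simps)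
  have 2: "32 * real N * (real n + 1) \<le> real d" using d of_nat_le_iff[of "32 * N * (n + 1)" d, where ?'a = real] by (simp add: algebra_simps)
  have "real d \<le> 16 * real N * (real n + 1) * real q" using 1 2 by linarith
  moreover have "0 < real (16 * N * (n + 1))" using N by (intro of_nat_0_less_iff[THEN iffD2]) simp
  ultimately have "real d / real (16 * N * (n + 1)) \<le> real q" by (simp add: pos_divide_le_eq algebra_simps)
  then show thesis using that[OF A] by (simp add: q_def)
qed

theorem theorem1p1:
  fixes W0 :: "('n::finite, 'k::finite) jet set" and r :: nat
  assumes dim_m: "CARD('m::finite) = CARD('n) + 1"
    and intr: "intrinsic r W0 TYPE('m)"
    and sa: "semialgebraic (jet_vars r) W0"
    and ne: "W0 \<noteq> {}"
    and codim_pos: "0 < jet_codim r W0"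
    and codim_le: "jet_codim r W0 \<le> int CARD('n)"
  shows "\<exists>dW::nat. \<exists>c2::real. c2 > 0 \<and>
           (\<forall>d\<ge>dW. \<exists>U. U \<noteq> {} \<and> open_in_coeff_space d U \<and>
              (\<forall>c\<in>U. ennreal (c2 * real d ^ CARD('n))
                        \<le> betti_sum (Sigma_W r W0 (poly_map d (c :: 'k \<Rightarrow> ('m \<Rightarrow> nat) \<Rightarrow> real)) :: (real^'m) set)))"
proof -
  let ?n = "CARD('n)"
  have "\<exists>N. \<forall>k d. N * (2 * k + 1) \<le> d \<longrightarrow> d mod 2 = e mod 2 \<longrightarrow>
    (\<exists>U. U \<noteq> {} \<and> open_in_coeff_space d U \<and> (\<forall>c\<in>U. of_nat (((2 * k + 1) div (8 * (?n + 1))) ^ ?n) \<le>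
         betti_sum (Sigma_W r W0 (poly_map d (c :: 'k \<Rightarrow> ('m \<Rightarrow> nat) \<Rightarrow> real)) :: (real^'m) set)))" for e
    by (rule many_singular_components[OF assms])
  then obtain N where N: "\<And>e k d. N e * (2 * k + 1) \<le> d \<Longrightarrow> d mod 2 = e mod 2 \<Longrightarrow>
    (\<exists>U. U \<noteq> {} \<and> open_in_coeff_space d U \<and> (\<forall>c\<in>U. of_nat (((2 * k + 1) div (8 * (?n + 1))) ^ ?n) \<le>
         betti_sum (Sigma_W r W0 (poly_map d (c :: 'k \<Rightarrow> ('m \<Rightarrow> nat) \<Rightarrow> real)) :: (real^'m) set)))" by metis
  \<comment> \<open>One constant for both parity classes; the summand 1 keeps it positive.\<close>
  define M where "M = N 0 + N 1 + 1"
  define c1 where "c1 = 1 / real (16 * M * (?n + 1))"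
  have "0 < 16 * M * (?n + 1)" by (simp add: M_def)
  then have c1: "c1 > 0" unfolding c1_def by (intro divide_pos_pos) (simp_all only: of_nat_0_less_iff zero_less_one)
  show ?thesis
  proof (intro exI[of _ "32 * M * (?n + 1)"] exI[of _ "c1 ^ ?n"] conjI allI impI)
    show "c1 ^ ?n > 0" using c1 by simp
    fix d assume d: "d \<ge> 32 * M * (?n + 1)"
    obtain k where k: "M * (2 * k + 1) \<le> d" "real d / real (16 * M * (?n + 1)) \<le> real ((2 * k + 1) div (8 * (?n + 1)))"
      using box_count[OF _ d] by (auto simp: M_def)
    have "N (d mod 2) \<le> M" by (cases "even d") (auto simp: M_def odd_iff_mod_2_eq_one)
    then have "N (d mod 2) * (2 * k + 1) \<le> d" using k(1) by (meson le_trans mult_le_mono1)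
    from N[OF this] obtain U where U: "U \<noteq> {}" "open_in_coeff_space d U"
      "\<And>c. c \<in> U \<Longrightarrow> of_nat (((2 * k + 1) div (8 * (?n + 1))) ^ ?n) \<le>
         betti_sum (Sigma_W r W0 (poly_map d (c :: 'k \<Rightarrow> ('m \<Rightarrow> nat) \<Rightarrow> real)) :: (real^'m) set)" by auto
    have "c1 ^ ?n * real d ^ ?n = (c1 * real d) ^ ?n" by (simp add: power_mult_distrib)
    also have "\<dots> \<le> real ((2 * k + 1) div (8 * (?n + 1))) ^ ?n"
      using k(2) c1 by (intro power_mono) (auto simp: c1_def)
    finally have "ennreal (c1 ^ ?n * real d ^ ?n) \<le> ennreal (real (((2 * k + 1) div (8 * (?n + 1))) ^ ?n))"
      by (intro ennreal_leI) simp
    also have "\<dots> = of_nat (((2 * k + 1) div (8 * (?n + 1))) ^ ?n)" by (rule ennreal_of_nat_eq_real_of_nat[symmetric])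
    finally have "ennreal (c1 ^ ?n * real d ^ ?n) \<le> betti_sum (Sigma_W r W0 (poly_map d c) :: (real^'m) set)" if "c \<in> U" for c
      using U(3)[OF that] by (rule order_trans)
    then show "\<exists>U. U \<noteq> {} \<and> open_in_coeff_space d U \<and>
              (\<forall>c\<in>U. ennreal (c1 ^ ?n * real d ^ ?n)
                        \<le> betti_sum (Sigma_W r W0 (poly_map d (c :: 'k \<Rightarrow> ('m \<Rightarrow> nat) \<Rightarrow> real)) :: (real^'m) set))"
      using U(1,2) by blast
  qed
qed

end
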